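(* Let $d\ge1$, $2\le p<\infty$ and $s=d(2/p-1)$. Then the Fourier transform $\mathcal{F}\colon L^p(\mathbb{R}^d)\to\dot W^p_s(\mathbb{R}^d)$, $f\mapsto[\hat f]$, is bounded, i.e. there is a constant $C>0$ such that for every $f\in L^p(\mathbb{R}^d)$ the class $[\hat f]\in\mathcal{S}'/\mathcal{P}$ belongs to $\dot W^p_s(\mathbb{R}^d)$ and $\|\hat f\|_{\dot W^p_s}\le C\|f\|_{L^p}$.
   Context: $\mathcal{S}$ is the Schwartz space on $\mathbb{R}^d$, $\mathcal{S}'$ the tempered distributions, $\mathcal{P}$ the space of polynomials; $[f]$ denotes the class of $f\in\mathcal{S}'$ in $\mathcal{S}'/\mathcal{P}$. The Fourier transform is $\hat f(\xi)=\mathcal{F}f(\xi)=\int_{\mathbb{R}^d}f(x)e^{-2\pi i x\cdot\xi}\,dx$ on $\mathcal{S}$, extended to $\mathcal{S}'$ by $\langle\hat f,g\rangle=\langle f,\hat g\rangle$. Fix $\varphi\in\mathcal{S}$ with $\hat\varphi$ radially decreasing, $\hat\varphi(\xi)=1$ for $|\xi|\le1$, $\hat\varphi(\xi)=0$ for $|\xi|\ge2$. Define $\varphi_k$, $k\in\mathbb{Z}$, by $\hat\varphi_0(\xi)=\hat\varphi(\xi/2)-\hat\varphi(\xi)$ and $\hat\varphi_k(\xi)=\hat\varphi_0(2^{-k}\xi)$. For $1<p<\infty$ and $s\in\mathbb{R}$, the homogeneous Sobolev space is $\dot W^p_s=\{[f]\in\mathcal{S}'/\mathcal{P}:\|f\|_{\dot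 W^p_s}<\infty\}$ with norm $\|f\|_{\dot W^p_s}=\left\|\left(\sum_{k\in\mathbb{Z}}|2^{ks}(\varphi_k*f)|^2\right)^{1/2}\right\|_{L^p}$ (the homogeneous Triebel–Lizorkin space $\dot F^{p,2}_s$; different choices of $\varphi$ give equivalent norms). *)

theory Defs
  imports "HOL-Analysis.Analysis"
begin

text \<open>
  The space \<open>\<real>\<^sup>d\<close> is a type \<open>'a::euclidean_space\<close> with \<open>d = DIM('a) \<ge> 1\<close>; all functions are
  complex-valued and all integrals are with respect to Lebesgue measure.
\<close>

section \<open>Schwartz functions\<close>

text \<open>
  \<open>partials [b1, ..., bm] f\<close> is the iterated directional derivative of \<open>f\<close> along \<open>bm\<close>, ..., \<open>b1\<close>;
  for lists of elements of \<open>Basis\<close> these are the derivatives \<open>\<partial>\<^sup>\<beta> f\<close>.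
\<close>

primrec partials :: "'a::euclidean_space list \<Rightarrow> ('a \<Rightarrow> complex) \<Rightarrow> 'a \<Rightarrow> complex" where
  "partials [] f = f"
| "partials (b # bs) f = (\<lambda>x. frechet_derivative (partials bs f) (at x) b)"

text \<open>
  Differentiability of all iterated partial derivatives expresses smoothness, and makes
  \<open>frechet_derivative\<close>, which is unspecified elsewhere, meaningful.
\<close>

definition schwartz :: "('a::euclidean_space \<Rightarrow> complex) set" where
  "schwartz = {f. \<forall>bs. set bs \<subseteq> Basis \<longrightarrow>
      (\<forall>x. partials bs f differentiable at x) \<and>
      (\<forall>m::nat. bounded (range (\<lambda>x. norm x ^ m * norm (partials bs f x))))}"

definition schwartz_seminorm ::
    "nat \<Rightarrow> 'a::euclidean_space list \<Rightarrow> ('a \<Rightarrow> complex) \<Rightarrow> real" where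
  "schwartz_seminorm m bs f = (SUP x. norm x ^ m * norm (partials bs f x))"

definition schwartz_tendsto ::
    "(nat \<Rightarrow> 'a::euclidean_space \<Rightarrow> complex) \<Rightarrow> ('a \<Rightarrow> complex) \<Rightarrow> bool" where
  "schwartz_tendsto F f \<longleftrightarrow>
     (\<forall>m bs. set bs \<subseteq> Basis \<longrightarrow> (\<lambda>n. schwartz_seminorm m bs (\<lambda>x. F n x - f x)) \<longlonglongrightarrow> 0)"

definition fourier :: "('a::euclidean_space \<Rightarrow> complex) \<Rightarrow> 'a \<Rightarrow> complex" where
  "fourier f \<xi> = (\<integral>x. f x * exp (- (2 * of_real pi * \<i> * of_real (x \<bullet> \<xi>))) \<partial>lebesgue)"


section \<open>Tempered distributions\<close>

text \<open>
  Functionals are only meaningful on \<open>schwartz\<close>; requiring them to be \<open>extensional\<close> (a fixed junk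
  value elsewhere) makes equality of distributions coincide with equality of functions.
  The Schwartz space is metrizable, so sequential continuity is continuity.
\<close>

type_synonym 'a functional = "('a \<Rightarrow> complex) \<Rightarrow> complex"

definition tempered :: "'a::euclidean_space functional set" where
  "tempered = {T \<in> extensional schwartz.
      (\<forall>g\<in>schwartz. \<forall>h\<in>schwartz. T (\<lambda>x. g x + h x) = T g + T h) \<and>
      (\<forall>c. \<forall>g\<in>schwartz. T (\<lambda>x. c * g x) = c * T g) \<and>
      (\<forall>G g. (\<forall>n. G n \<in> schwartz) \<and> g \<in> schwartz \<and> schwartz_tendsto G g
          \<longrightarrow> (\<lambda>n. T (G n)) \<longlonglongrightarrow> T g)}"

definition dist_of :: "('a::euclidean_space \<Rightarrow> complex) \<Rightarrow> 'a functional" where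
  "dist_of f = (\<lambda>g\<in>schwartz. \<integral>x. f x * g x \<partial>lebesgue)"

definition fourier_dist :: "'a::euclidean_space functional \<Rightarrow> 'a functional" where
  "fourier_dist T = (\<lambda>g\<in>schwartz. T (fourier g))"

definition conv_dist :: "('a::euclidean_space \<Rightarrow> complex) \<Rightarrow> 'a functional \<Rightarrow> 'a \<Rightarrow> complex" where
  "conv_dist \<psi> T x = T (\<lambda>y. \<psi> (x - y))"

text \<open>
  Two distributions are related iff they differ by a polynomial; \<open>\<S>'/\<P>\<close> is the quotient
  \<open>tempered // mod_poly\<close>, and \<open>[T]\<close> is \<open>mod_poly `` {T}\<close>.
\<close>

definition mod_poly :: "('a::euclidean_space functional \<times> 'a functional) set" where
  "mod_poly = {(T, U). T \<in> tempered \<and> U \<in> tempered \<and>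
      (\<exists>q :: 'a \<Rightarrow> complex. polynomial_function q \<and>
         (\<forall>g\<in>schwartz. U g - T g = dist_of q g))}"


section \<open>Lebesgue norms\<close>

text \<open>Power of an extended non-negative real with exponent \<open>a > 0\<close>.\<close>

definition epowr :: "ennreal \<Rightarrow> real \<Rightarrow> ennreal" where
  "epowr u a = (if u = \<infinity> then \<infinity> else ennreal (enn2real u powr a))"

definition Lp_norm :: "real \<Rightarrow> ('a::euclidean_space \<Rightarrow> ennreal) \<Rightarrow> ennreal" where
  "Lp_norm p u = epowr (\<integral>\<^sup>+x. epowr (u x) p \<partial>lebesgue) (1 / p)"

definition Lp :: "real \<Rightarrow> ('a::euclidean_space \<Rightarrow> complex) set" where
  "Lp p = {f \<in> borel_measurable lebesgue. Lp_norm p (\<lambda>x. ennreal (norm (f x))) < \<infinity>}"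


section \<open>Homogeneous Sobolev spaces\<close>

definition lp_generator :: "('a::euclidean_space \<Rightarrow> complex) \<Rightarrow> bool" where
  "lp_generator \<phi> \<longleftrightarrow> \<phi> \<in> schwartz \<and>
     (\<exists>h :: real \<Rightarrow> real. antimono_on {0..} h \<and> (\<forall>\<xi>. fourier \<phi> \<xi> = of_real (h (norm \<xi>)))) \<and>
     (\<forall>\<xi>. norm \<xi> \<le> 1 \<longrightarrow> fourier \<phi> \<xi> = 1) \<and>
     (\<forall>\<xi>. norm \<xi> \<ge> 2 \<longrightarrow> fourier \<phi> \<xi> = 0)"

definition lp_symbol :: "('a::euclidean_space \<Rightarrow> complex) \<Rightarrow> 'a \<Rightarrow> complex" where
  "lp_symbol \<phi> \<xi> = fourier \<phi> (\<xi> /\<^sub>R 2) - fourier \<phi> \<xi>"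

text \<open>
  The function \<open>\<phi>\<^sub>k\<close> is determined by its Fourier transform, since the Fourier transform is a
  bijection of the Schwartz space.
\<close>

definition lp_piece :: "('a::euclidean_space \<Rightarrow> complex) \<Rightarrow> int \<Rightarrow> 'a \<Rightarrow> complex" where
  "lp_piece \<phi> k =
     (THE \<psi>. \<psi> \<in> schwartz \<and> (\<forall>\<xi>. fourier \<psi> \<xi> = lp_symbol \<phi> ((2 powi (- k)) *\<^sub>R \<xi>)))"

definition sobolev_norm ::
    "('a::euclidean_space \<Rightarrow> complex) \<Rightarrow> real \<Rightarrow> real \<Rightarrow> 'a functional \<Rightarrow> ennreal" where
  "sobolev_norm \<phi> p s T = Lp_norm p (\<lambda>x.
     epowr (\<Sum>\<^sub>\<infinity>k::int.
       ennreal ((norm (of_real (2 powr (of_int k * s)) * conv_dist (lp_piece \<phi> k) T x))\<^sup>2)) (1 / 2))"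

text \<open>
  The norm does not depend on the representative, because the Fourier transform of \<open>\<phi>\<^sub>k\<close> vanishes
  near the origin.
\<close>

definition homogeneous_sobolev ::
    "('a::euclidean_space \<Rightarrow> complex) \<Rightarrow> real \<Rightarrow> real \<Rightarrow> 'a functional set set" where
  "homogeneous_sobolev \<phi> p s = {mod_poly `` {T} | T. T \<in> tempered \<and> sobolev_norm \<phi> p s T < \<infinity>}"

end

theory Submission
  imports Defs "HOL-Probability.Characteristic_Functions" "HOL-Probability.Sinc_Integral"
begin

text \<open>
  Let \<open>m\<^sub>k\<close> be the Fourier multiplier of \<open>\<phi>\<^sub>k\<close>. Since \<open>m\<^sub>k\<close> is even, \<open>\<phi>\<^sub>k * \<F>f = \<F>(f m\<^sub>k)\<close>, and the
  \<open>m\<^sub>k\<close> are nonnegative with telescoping sums bounded by 1. No Littlewood--Paley theory is needed: the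
  estimate is dual to a vector-valued Paley inequality
  \<open>\<integral> |\<xi>|\<^bsup>d(q-2)\<^esup> (\<Sum>\<^sub>k m\<^sub>k |\<F>g\<^sub>k|)\<^sup>q \<le> C \<integral> (\<Sum>\<^sub>k |g\<^sub>k|\<^sup>2)\<^bsup>q/2\<^esup>\<close> for the conjugate exponent
  \<open>1 < q \<le> 2\<close>. The latter follows by Marcinkiewicz interpolation for \<open>|\<xi>|\<^sup>d \<Sum>\<^sub>k m\<^sub>k |\<F>g\<^sub>k|\<close> with respect
  to the measure \<open>|\<xi>|\<^bsup>-2d\<^esup> d\<xi>\<close>: weak type (1,1) is trivial and type (2,2) is Plancherel. It is applied to
  \<open>g\<^sub>k = F\<^sub>k\<^sup>* Q\<^bsup>p-2\<^esup>\<close> on a ball, where \<open>F\<^sub>k = 2\<^bsup>ks\<^esup> \<F>(f m\<^sub>k)\<close>, \<open>F\<^sub>k\<^sup>*\<close> is its complex conjugate, and \<open>Q\<close>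
  is the square function; there the factor \<open>2\<^bsup>ks\<^esup> \<le> C |\<xi>|\<^sup>s\<close> on the support of \<open>m\<^sub>k\<close> produces exactly the
  Paley weight.
\<close>

section \<open>The Schwartz space\<close>

text \<open>Both endpoints of the interpolation rest on the same pointwise fact: a sum with
  nonnegative weights of total at most 1 is bounded by the largest |\<F>g_k|, and by Cauchy-Schwarz
  its square is at most the sum of the |\<F>g_k|^2. The density |\<xi>|^(-2d) is dictated by the L^2
  endpoint, where it must cancel the square of |\<xi>|^d. It also gives mass of order R^(-d) to
  |\<xi>| >= R, which is what weak type (1,1) asks of |\<xi>|^d times a bounded function. The value
  of s enters through s <= 0 and s q = d(q-2). The obstacle is that duality is applied before the
  square function is known to lie in L^p. Finitely many k and a ball make the integral J of its p-th
  power finite. For the chosen g_k the integral of the q-th power of their l2 norm is again J, so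
  Young's inequality with a small parameter gives J <= C |f|_p^p + J/2, and finiteness allows J/2 to
  be absorbed. No constant depends on the range of k or on the radius, so monotone convergence
  removes both restrictions.\<close>

definition rapid_decay :: "('a::euclidean_space \<Rightarrow> complex) \<Rightarrow> bool" where
  "rapid_decay f \<longleftrightarrow> (\<forall>m::nat. \<exists>C. \<forall>x. norm x ^ m * norm (f x) \<le> C)"

lemma rapid_decay_bounded:
  assumes "rapid_decay f"
  shows "bounded (range (\<lambda>x. norm x ^ m * norm (f x)))"
proof -
  obtain C where "\<And>x. norm x ^ m * norm (f x) \<le> C"
    using assms by (auto simp: rapid_decay_def)
  then show ?thesis
    by (intro boundedI[where B=C]) auto
qed

text \<open>Closure proofs only have to exhibit a set \<open>X\<close> stable under a single partial
  derivative; induction on the list then covers all iterated partials, so higher-order Leibniz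
  formulas never appear.\<close>

lemma schwartz_coinduct:
  assumes "f \<in> X"
    and "\<And>f x. f \<in> X \<Longrightarrow> f differentiable at x"
    and "\<And>f. f \<in> X \<Longrightarrow> rapid_decay f"
    and "\<And>f b. f \<in> X \<Longrightarrow> b \<in> Basis \<Longrightarrow> partials [b] f \<in> X"
  shows "f \<in> schwartz"
proof -
  have "partials bs f \<in> X" if "set bs \<subseteq> Basis" for bs
    using that
  proof (induction bs)
    case (Cons b bs)
    then show ?case using assms(4)[of "partials bs f" b] by simp
  qed (use assms(1) in simp)
  then show ?thesis
    unfolding schwartz_def using assms(2) rapid_decay_bounded[OF assms(3)] by blast
qed

lemma schwartz_differentiable: "f \<in> schwartz \<Longrightarrow> f differentiable at x"
  unfolding schwartz_def using partials.simps(1) by (metis (mono_tags, lifting) empty_set empty_subsetI mem_Collect_eq)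

lemma schwartz_has_derivative:
  "f \<in> schwartz \<Longrightarrow> (f has_derivative frechet_derivative f (at x)) (at x)"
  using frechet_derivative_works schwartz_differentiable by blast

lemma schwartz_rapid_decay:
  assumes "f \<in> schwartz"
  shows "rapid_decay f"
  unfolding rapid_decay_def
proof
  fix m :: nat
  have "bounded (range (\<lambda>x. norm x ^ m * norm (partials [] f x)))"
    using assms unfolding schwartz_def mem_Collect_eq by (metis empty_set empty_subsetI)
  then obtain C where "\<And>x. norm (norm x ^ m * norm (f x)) \<le> C"
    by (auto simp: bounded_iff)
  then show "\<exists>C. \<forall>x. norm x ^ m * norm (f x) \<le> C" by (metis abs_ge_self order_trans real_norm_def)
qed

lemma partials_append: "partials (bs @ cs) f = partials bs (partials cs f)"
  by (induction bs) auto

lemma schwartz_partials: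
  assumes "f \<in> schwartz" "set cs \<subseteq> Basis"
  shows "partials cs f \<in> schwartz"
  using assms unfolding schwartz_def
  by (auto simp flip: partials_append)

lemma schwartz_continuous: "f \<in> schwartz \<Longrightarrow> continuous_on UNIV f"
  by (simp add: continuous_at_imp_continuous_on differentiable_imp_continuous_within
      schwartz_differentiable)

lemma schwartz_borel_measurable: "f \<in> schwartz \<Longrightarrow> f \<in> borel_measurable borel"
  by (simp add: borel_measurable_continuous_onI schwartz_continuous)

lemma partials_singleton:
  "(f has_derivative D) (at x) \<Longrightarrow> partials [b] f x = D b"
  by (simp flip: frechet_derivative_at)

section \<open>Operations preserving rapid decay\<close>

lemma rapid_decay_add:
  assumes "rapid_decay f" "rapid_decay g"
  shows "rapid_decay (\<lambda>x. f x + g x)"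
  unfolding rapid_decay_def
proof
  fix m
  obtain C D where C: "\<And>x. norm x ^ m * norm (f x) \<le> C" and D: "\<And>x. norm x ^ m * norm (g x) \<le> D"
    using assms unfolding rapid_decay_def by metis
  have "norm x ^ m * norm (f x + g x) \<le> C + D" for x
  proof -
    have "norm x ^ m * norm (f x + g x) \<le> norm x ^ m * norm (f x) + norm x ^ m * norm (g x)"
      by (metis distrib_left mult_left_mono norm_triangle_ineq zero_le_power norm_ge_zero)
    with C[of x] D[of x] show ?thesis by linarith
  qed
  then show "\<exists>C. \<forall>x. norm x ^ m * norm (f x + g x) \<le> C" by blast
qed

lemma rapid_decay_mult:
  assumes "rapid_decay f" and "\<And>x. norm (u x) \<le> B * norm x ^ k"
  shows "rapid_decay (\<lambda>x. u x * f x)"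
  unfolding rapid_decay_def
proof
  fix m
  obtain C where C: "\<And>x. norm x ^ (m + k) * norm (f x) \<le> C"
    using assms unfolding rapid_decay_def by metis
  have "norm x ^ m * norm (u x * f x) \<le> \<bar>B\<bar> * C" for x
  proof -
    have "norm x ^ m * norm (u x * f x) \<le> norm x ^ m * ((\<bar>B\<bar> * norm x ^ k) * norm (f x))"
      unfolding norm_mult
      by (intro mult_left_mono mult_right_mono order_trans[OF assms(2)[of x]]) auto
    also have "\<dots> = \<bar>B\<bar> * (norm x ^ (m + k) * norm (f x))" by (simp add: power_add)
    also have "\<dots> \<le> \<bar>B\<bar> * C" by (intro mult_left_mono C) auto
    finally show ?thesis .
  qed
  then show "\<exists>C. \<forall>x. norm x ^ m * norm (u x * f x) \<le> C" by blast
qed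

lemma rapid_decay_scale: "rapid_decay f \<Longrightarrow> rapid_decay (\<lambda>x. c * f x)"
  using rapid_decay_mult[of f "\<lambda>_. c" "norm c" 0] by simp

lemma rapid_decay_coordinate:
  assumes "rapid_decay f" "norm b \<le> 1"
  shows "rapid_decay (\<lambda>x. of_real (x \<bullet> b) * f x)"
proof (rule rapid_decay_mult[OF assms(1), where B=1 and k=1])
  fix x
  have "\<bar>x \<bullet> b\<bar> \<le> norm x * norm b" by (rule Cauchy_Schwarz_ineq2)
  also have "\<dots> \<le> norm x" using assms(2) by (simp add: mult_left_le)
  finally show "norm (complex_of_real (x \<bullet> b)) \<le> 1 * norm x ^ 1" by simp
qed

text \<open>With y = c x + v one has |x| <= (2/|c|) max(|y|, |v|). A power of |x| thus splits into a
  power of |y|, absorbed by the decay of \<open>f\<close>, and a power of |v|, for which boundedness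
  of \<open>f\<close> suffices.\<close>

lemma rapid_decay_affine:
  fixes f :: "'a::euclidean_space \<Rightarrow> complex"
  assumes "rapid_decay f" and c: "c \<noteq> 0"
  shows "rapid_decay (\<lambda>x. f (c *\<^sub>R x + v))"
  unfolding rapid_decay_def
proof
  fix m
  obtain C where C: "\<And>x. norm x ^ m * norm (f x) \<le> C"
    using assms unfolding rapid_decay_def by metis
  obtain D where D: "\<And>x. norm x ^ 0 * norm (f x) \<le> D"
    using assms unfolding rapid_decay_def by metis
  define K where "K = (2 / \<bar>c\<bar>) ^ m"
  have "norm x ^ m * norm (f (c *\<^sub>R x + v)) \<le> K * (C + norm v ^ m * D)" for x
  proof -
    define y where "y = c *\<^sub>R x + v"
    have "x = (1 / c) *\<^sub>R (y - v)" using c by (simp add: y_def)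
    then have "norm x = norm (y - v) / \<bar>c\<bar>" by simp
    also have "\<dots> \<le> (norm y + norm v) / \<bar>c\<bar>"
      by (intro divide_right_mono norm_triangle_ineq4) auto
    also have "\<dots> \<le> (2 * max (norm y) (norm v)) / \<bar>c\<bar>"
      by (intro divide_right_mono) auto
    also have "\<dots> = 2 / \<bar>c\<bar> * max (norm y) (norm v)" by simp
    finally have "norm x ^ m \<le> (2 / \<bar>c\<bar> * max (norm y) (norm v)) ^ m" by (intro power_mono) auto
    also have "\<dots> = K * max (norm y) (norm v) ^ m" by (simp only: power_mult_distrib K_def)
    also have "\<dots> \<le> K * (norm y ^ m + norm v ^ m)"
      by (intro mult_left_mono) (auto simp: K_def max_def)
    finally have "norm x ^ m * norm (f y) \<le> K * (norm y ^ m + norm v ^ m) * norm (f y)"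
      by (intro mult_right_mono) auto
    also have "\<dots> = K * (norm y ^ m * norm (f y) + norm v ^ m * norm (f y))"
      by (simp add: algebra_simps)
    also have "\<dots> \<le> K * (C + norm v ^ m * D)"
      using C[of y] D[of y] by (intro mult_left_mono add_mono) (auto simp: K_def)
    finally show ?thesis by (simp add: y_def)
  qed
  then show "\<exists>C. \<forall>x. norm x ^ m * norm (f (c *\<^sub>R x + v)) \<le> C" by blast
qed

section \<open>Operations preserving the Schwartz space\<close>

lemma schwartz_add:
  assumes "f \<in> schwartz" "g \<in> schwartz"
  shows "(\<lambda>x. f x + g x) \<in> schwartz"
proof (rule schwartz_coinduct[where X="{\<lambda>x. f x + g x | f g. f \<in> schwartz \<and> g \<in> schwartz}"])
  fix h and b :: 'a
  assume "h \<in> {\<lambda>x. f x + g x | f g :: 'a \<Rightarrow> complex. f \<in> schwartz \<and> g \<in> schwartz}" and b: "b \<in> Basis"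
  then obtain f g where h: "h = (\<lambda>x. f x + g x)" and fg: "f \<in> schwartz" "g \<in> schwartz" by auto
  have "partials [b] h = (\<lambda>x. partials [b] f x + partials [b] g x)"
  proof
    fix x
    have "(h has_derivative (\<lambda>v. frechet_derivative f (at x) v + frechet_derivative g (at x) v)) (at x)"
      unfolding h by (intro has_derivative_add schwartz_has_derivative fg)
    from partials_singleton[OF this] show "partials [b] h x = partials [b] f x + partials [b] g x"
      by simp
  qed
  with schwartz_partials[OF fg(1), of "[b]"] schwartz_partials[OF fg(2), of "[b]"] b
  show "partials [b] h \<in> {\<lambda>x. f x + g x | f g. f \<in> schwartz \<and> g \<in> schwartz}" by auto
qed (use assms in \<open>auto intro: rapid_decay_add schwartz_rapid_decay derivative_intros schwartz_differentiable\<close>)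

lemma schwartz_scale:
  assumes "f \<in> schwartz"
  shows "(\<lambda>x. c * f x) \<in> schwartz"
proof (rule schwartz_coinduct[where X="{\<lambda>x. c * f x | f. f \<in> schwartz}"])
  fix h and b :: 'a
  assume "h \<in> {\<lambda>x. c * f x | f :: 'a \<Rightarrow> complex. f \<in> schwartz}" and b: "b \<in> Basis"
  then obtain f where h: "h = (\<lambda>x. c * f x)" and f: "f \<in> schwartz" by auto
  have "partials [b] h = (\<lambda>x. c * partials [b] f x)"
  proof
    fix x
    have "(h has_derivative (\<lambda>v. c * frechet_derivative f (at x) v)) (at x)"
      unfolding h by (intro has_derivative_mult_right schwartz_has_derivative f)
    from partials_singleton[OF this] show "partials [b] h x = c * partials [b] f x"
      by simp
  qed
  with schwartz_partials[OF f, of "[b]"] b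
  show "partials [b] h \<in> {\<lambda>x. c * f x | f. f \<in> schwartz}" by auto
qed (use assms in \<open>auto intro: rapid_decay_scale schwartz_rapid_decay derivative_intros schwartz_differentiable\<close>)

lemma schwartz_diff:
  assumes "f \<in> schwartz" "g \<in> schwartz"
  shows "(\<lambda>x. f x - g x) \<in> schwartz"
  using schwartz_add[OF assms(1) schwartz_scale[OF assms(2), of "-1"]] by simp

lemma schwartz_affine:
  fixes f :: "'a::euclidean_space \<Rightarrow> complex"
  assumes "f \<in> schwartz" "c \<noteq> 0"
  shows "(\<lambda>x. f (c *\<^sub>R x + v)) \<in> schwartz"
proof (rule schwartz_coinduct[where X="{\<lambda>x. f (c *\<^sub>R x + v) | f. f \<in> schwartz}"])
  have D: "((\<lambda>x. f (c *\<^sub>R x + v)) has_derivative (\<lambda>w. frechet_derivative f (at (c *\<^sub>R x + v)) (c *\<^sub>R w))) (at x)"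
    if "f \<in> schwartz" for f :: "'a \<Rightarrow> complex" and x
    by (rule has_derivative_compose[where g=f and f="\<lambda>x. c *\<^sub>R x + v",
        OF _ schwartz_has_derivative[OF that]])
      (auto intro!: derivative_eq_intros)
  fix h
  assume "h \<in> {\<lambda>x. f (c *\<^sub>R x + v) | f :: 'a \<Rightarrow> complex. f \<in> schwartz}"
  then obtain f where h: "h = (\<lambda>x. f (c *\<^sub>R x + v))" and f: "f \<in> schwartz" by auto
  show "h differentiable at x" for x unfolding h using D[OF f] differentiable_def by blast
  show "rapid_decay h" unfolding h by (intro rapid_decay_affine schwartz_rapid_decay f assms(2))
  fix b :: 'a assume b: "b \<in> Basis"
  have "partials [b] h = (\<lambda>x. (\<lambda>y. of_real c * partials [b] f y) (c *\<^sub>R x + v))"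
  proof
    fix x
    interpret bounded_linear "frechet_derivative f (at (c *\<^sub>R x + v))"
      using schwartz_has_derivative[OF f] has_derivative_bounded_linear by blast
    from partials_singleton[OF D[OF f, of x], of b]
    show "partials [b] h x = (\<lambda>y. of_real c * partials [b] f y) (c *\<^sub>R x + v)"
      by (simp add: h scaleR scaleR_conv_of_real)
  qed
  with schwartz_scale[OF schwartz_partials[OF f, of "[b]"], of "of_real c"] b
  show "partials [b] h \<in> {\<lambda>x. f (c *\<^sub>R x + v) | f. f \<in> schwartz}" by auto
qed (use assms in auto)

lemma has_derivative_coordinate_mult:
  assumes "f \<in> schwartz"
  shows "((\<lambda>x. of_real (x \<bullet> b) * f x) has_derivative
     (\<lambda>v. of_real (x \<bullet> b) * frechet_derivative f (at x) v + of_real (v \<bullet> b) * f x)) (at x)"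
proof -
  have "((\<lambda>x. complex_of_real (x \<bullet> b)) has_derivative (\<lambda>v. of_real (v \<bullet> b))) (at x)"
    by (intro has_derivative_of_real has_derivative_inner_left has_derivative_ident)
  from has_derivative_mult[OF this schwartz_has_derivative[OF assms]]
  show ?thesis .
qed

lemma schwartz_coordinate_mult:
  fixes f :: "'a::euclidean_space \<Rightarrow> complex"
  assumes "f \<in> schwartz" and b: "b \<in> Basis"
  shows "(\<lambda>x. of_real (x \<bullet> b) * f x) \<in> schwartz"
\<comment> \<open>The products with a coordinate are not by themselves stable under differentiation,
  since the product rule leaves an undifferentiated \<open>f\<close>; the extra Schwartz summand
  \<open>g\<close> absorbs it.\<close>
proof (rule schwartz_coinduct[where X="{\<lambda>x. of_real (x \<bullet> b) * f x + g x | f g. f \<in> schwartz \<and> g \<in> schwartz}"])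
  let ?X = "{\<lambda>x. of_real (x \<bullet> b) * f x + g x | f g :: 'a \<Rightarrow> complex. f \<in> schwartz \<and> g \<in> schwartz}"
  have "(\<lambda>x::'a. 0) \<in> schwartz" using schwartz_scale[OF assms(1), of 0] by simp
  with assms(1) show "(\<lambda>x. of_real (x \<bullet> b) * f x) \<in> ?X"
    by (intro CollectI exI[of _ f] exI[of _ "\<lambda>x. 0"] conjI) simp_all
  fix h assume "h \<in> ?X"
  then obtain f g where h: "h = (\<lambda>x. of_real (x \<bullet> b) * f x + g x)" and fg: "f \<in> schwartz" "g \<in> schwartz"
    by auto
  have D: "(h has_derivative (\<lambda>v. of_real (x \<bullet> b) * frechet_derivative f (at x) v + of_real (v \<bullet> b) * f x
      + frechet_derivative g (at x) v)) (at x)" for x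
    unfolding h by (intro has_derivative_add has_derivative_coordinate_mult schwartz_has_derivative fg)
  show "h differentiable at x" for x using D[of x] differentiable_def by blast
  show "rapid_decay h" unfolding h using b
    by (intro rapid_decay_add rapid_decay_coordinate schwartz_rapid_decay fg) auto
  fix c :: 'a assume c: "c \<in> Basis"
  have "partials [c] h = (\<lambda>x. of_real (x \<bullet> b) * partials [c] f x + (of_real (c \<bullet> b) * f x + partials [c] g x))"
    using partials_singleton[OF D] by (simp add: fun_eq_iff algebra_simps)
  moreover have "partials [c] f \<in> schwartz" "(\<lambda>x. of_real (c \<bullet> b) * f x + partials [c] g x) \<in> schwartz"
    using fg c by (intro schwartz_add schwartz_scale schwartz_partials; simp)+
  ultimately show "partials [c] h \<in> ?X"
    by (intro CollectI exI[of _ "partials [c] f"] exI[of _ "\<lambda>x. of_real (c \<bullet> b) * f x + partials [c] g x"]) blast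
qed

section \<open>Integrability and seminorms\<close>

text \<open>The standard integrable majorant. Decay of order 2d makes it dominated by a product of
  one-dimensional densities 1/(1+t^2), while bounds of orders 0 and 2d are enough to compare a
  function with it.\<close>

definition weight :: "'a::euclidean_space \<Rightarrow> real" where
  "weight x = 1 / (1 + (norm x)\<^sup>2) ^ DIM('a)"

lemma weight_pos: "0 < weight x"
  by (simp add: weight_def add_pos_nonneg)

lemma weight_borel_measurable[measurable]: "weight \<in> borel_measurable borel"
  unfolding weight_def by measurable

lemma integrable_divide_1_plus_square: "integrable lborel (\<lambda>t::real. 1 / (1 + t\<^sup>2))"
  using Sinc_Integral.integrable_inverse_1_plus_square
  by (simp add: set_integrable_def inverse_eq_divide)

text \<open>Each of the \<open>DIM('a)\<close> factors 1 + |x|^2 dominates 1 + (x \<bullet> b)^2 for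
  one basis vector \<open>b\<close>, so Tonelli reduces the claim to the real line.\<close>

lemma integrable_weight: "integrable lborel (weight :: 'a::euclidean_space \<Rightarrow> real)"
proof (rule integrableI_nonneg)
  show "AE x in lborel. 0 \<le> (weight x::real)" using weight_pos less_imp_le by (intro AE_I2) blast
  have "weight x \<le> (\<Prod>b\<in>Basis. 1 / (1 + (x \<bullet> b)\<^sup>2))" for x :: 'a
  proof -
    have "(\<Prod>b\<in>Basis. 1 + (x \<bullet> b)\<^sup>2) \<le> (\<Prod>b\<in>(Basis::'a set). 1 + (norm x)\<^sup>2)"
    proof (intro prod_mono conjI)
      fix b :: 'a assume "b \<in> Basis"
      then show "1 + (x \<bullet> b)\<^sup>2 \<le> 1 + (norm x)\<^sup>2"
        using Basis_le_norm[of b x] by (simp add: abs_le_square_iff[symmetric])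
    qed auto
    moreover have "0 < (\<Prod>b\<in>Basis. 1 + (x \<bullet> b)\<^sup>2)"
      by (intro prod_pos) (auto simp: add_pos_nonneg)
    ultimately show ?thesis unfolding weight_def
      by (simp add: prod_dividef frac_le)
  qed
  then have "(\<integral>\<^sup>+x. ennreal (weight (x::'a)) \<partial>lborel) \<le> (\<integral>\<^sup>+x. (\<Prod>b\<in>Basis. ennreal (1 / (1 + ((x::'a) \<bullet> b)\<^sup>2))) \<partial>lborel)"
    by (intro nn_integral_mono) (auto simp: prod_ennreal intro!: ennreal_leI)
  also have "\<dots> = (\<Prod>b\<in>(Basis::'a set). \<integral>\<^sup>+t. ennreal (1 / (1 + t\<^sup>2)) \<partial>lborel)"
    by (rule nn_integral_lborel_prod) auto
  also have "(\<integral>\<^sup>+t. ennreal (1 / (1 + t\<^sup>2)) \<partial>lborel) < \<infinity>"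
    using integrable_divide_1_plus_square by (simp add: integrable_iff_bounded)
  then have "(\<Prod>b\<in>(Basis::'a set). \<integral>\<^sup>+t. ennreal (1 / (1 + t\<^sup>2)) \<partial>lborel) < \<infinity>"
    by (simp add: power_less_top_ennreal)
  finally show "(\<integral>\<^sup>+x. ennreal (weight (x::'a)) \<partial>lborel) < \<infinity>" .
qed auto

lemma inverse_weight_le:
  "1 / weight (x::'a::euclidean_space) \<le> 2 ^ DIM('a) * (1 + norm x ^ (2 * DIM('a)))"
proof -
  let ?M = "max 1 ((norm x)\<^sup>2)"
  have "(1 + (norm x)\<^sup>2) ^ DIM('a) \<le> (2 * ?M) ^ DIM('a)" by (intro power_mono) auto
  also have "\<dots> = 2 ^ DIM('a) * ?M ^ DIM('a)" by (simp add: power_mult_distrib)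
  also have "?M ^ DIM('a) \<le> 1 + norm x ^ (2 * DIM('a))" by (auto simp: max_def power_mult)
  finally show ?thesis by (simp add: weight_def)
qed

lemma schwartz_seminorm_upper:
  assumes "f \<in> schwartz" "set bs \<subseteq> Basis"
  shows "norm x ^ m * norm (partials bs f x) \<le> schwartz_seminorm m bs f"
proof -
  have "bounded (range (\<lambda>x. norm x ^ m * norm (partials bs f x)))"
    using assms unfolding schwartz_def by blast
  then show ?thesis unfolding schwartz_seminorm_def
    by (intro cSUP_upper bounded_imp_bdd_above) auto
qed

lemma schwartz_seminorm_nonneg:
  assumes "f \<in> schwartz" "set bs \<subseteq> Basis"
  shows "0 \<le> schwartz_seminorm m bs f"
  using schwartz_seminorm_upper[OF assms, of 0 m]
  by (meson dual_order.trans mult_nonneg_nonneg norm_ge_zero zero_le_power)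

lemma schwartz_seminorm_partials:
  "schwartz_seminorm m bs (partials cs f) = schwartz_seminorm m (bs @ cs) f"
  by (simp add: schwartz_seminorm_def partials_append)

text \<open>The bound is linear in two seminorms, with a factor independent of \<open>f\<close>;
  sequential continuity of the distributions below depends on this uniformity.\<close>

lemma schwartz_le_weight:
  fixes f :: "'a::euclidean_space \<Rightarrow> complex"
  assumes "f \<in> schwartz"
  shows "norm (f x) \<le>
    2 ^ DIM('a) * (schwartz_seminorm 0 [] f + schwartz_seminorm (2 * DIM('a)) [] f) * weight x"
proof -
  have "norm (f x) / weight x \<le> 2 ^ DIM('a) * (1 + norm x ^ (2 * DIM('a))) * norm (f x)"
    using mult_right_mono[OF inverse_weight_le[of x], of "norm (f x)"] by simp
  also have "\<dots> = 2 ^ DIM('a) * (norm x ^ 0 * norm (partials [] f x) + norm x ^ (2 * DIM('a)) * norm (partials [] f x))"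
    by (simp add: algebra_simps)
  also have "\<dots> \<le> 2 ^ DIM('a) * (schwartz_seminorm 0 [] f + schwartz_seminorm (2 * DIM('a)) [] f)"
    by (intro mult_left_mono add_mono schwartz_seminorm_upper assms) auto
  finally show ?thesis using weight_pos[of x] by (simp add: field_simps)
qed

lemma schwartz_integrable:
  fixes f :: "'a::euclidean_space \<Rightarrow> complex"
  assumes "f \<in> schwartz"
  shows "integrable lborel f"
proof (rule Bochner_Integration.integrable_bound)
  show "integrable lborel (\<lambda>x::'a. 2 ^ DIM('a) * (schwartz_seminorm 0 [] f + schwartz_seminorm (2 * DIM('a)) [] f) * weight x)"
    using integrable_weight by (intro integrable_mult_right)
  show "AE x in lborel. norm (f x) \<le> norm (2 ^ DIM('a) * (schwartz_seminorm 0 [] f + schwartz_seminorm (2 * DIM('a)) [] f) * weight x)"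
    using schwartz_le_weight[OF assms] by (intro AE_I2) (metis abs_ge_self order_trans real_norm_def)
qed (use schwartz_borel_measurable[OF assms] in simp)

lemma schwartz_integral_norm_le:
  fixes f :: "'a::euclidean_space \<Rightarrow> complex"
  assumes "f \<in> schwartz"
  shows "(\<integral>x. norm (f x) \<partial>lborel) \<le> (2 ^ DIM('a) * (\<integral>x. weight (x::'a) \<partial>lborel)) *
    (schwartz_seminorm 0 [] f + schwartz_seminorm (2 * DIM('a)) [] f)"
proof -
  have "(\<integral>x. norm (f x) \<partial>lborel) \<le> (\<integral>x. 2 ^ DIM('a) * (schwartz_seminorm 0 [] f + schwartz_seminorm (2 * DIM('a)) [] f) * weight (x::'a) \<partial>lborel)"
  proof (rule Bochner_Integration.integral_mono)
    show "integrable lborel (\<lambda>x. norm (f x))" using schwartz_integrable[OF assms] by (rule integrable_norm)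
  qed (use schwartz_le_weight[OF assms] integrable_weight in auto)
  then show ?thesis by (subst (asm) integral_mult_right_zero) (simp add: mult_ac)
qed

section \<open>The Fourier transform of integrable functions\<close>

definition wave :: "real \<Rightarrow> complex" where
  "wave t = exp (- (2 * of_real pi * \<i> * of_real t))"

lemma wave_eq_iexp: "wave t = iexp (- (2 * pi * t))"
  by (simp add: wave_def mult_ac)

lemma norm_wave[simp]: "norm (wave t) = 1"
  by (simp add: wave_eq_iexp)

lemma wave_add: "wave (s + t) = wave s * wave t"
  by (simp add: wave_def exp_add[symmetric] algebra_simps)

lemma wave_0[simp]: "wave 0 = 1"
  by (simp add: wave_def)

lemma wave_minus_mult[simp]: "wave (- t) * wave t = 1" "wave t * wave (- t) = 1"
  by (simp_all flip: wave_add)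

lemma cnj_wave: "cnj (wave t) = wave (- t)"
  by (simp add: wave_def exp_cnj)

lemma continuous_on_wave[continuous_intros]:
  "continuous_on S f \<Longrightarrow> continuous_on S (\<lambda>x. wave (f x))"
  unfolding wave_def by (intro continuous_intros)

lemma wave_borel_measurable[measurable]: "wave \<in> borel_measurable borel"
  by (intro borel_measurable_continuous_onI continuous_intros)

lemma wave_sum: "finite A \<Longrightarrow> wave (sum f A) = (\<Prod>x\<in>A. wave (f x))"
  by (induction A rule: finite_induct) (auto simp: wave_add)

text \<open>Passage from Lebesgue measure to \<open>lborel\<close>, where Fubini and the product
  structure over coordinates are at hand; the analysis below is carried out there.\<close>

lemma fourier_lborel:
  assumes "f \<in> borel_measurable borel"
  shows "fourier f \<xi> = (\<integral>x. f x * wave (x \<bullet> \<xi>) \<partial>lborel)"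
  unfolding fourier_def wave_def using assms by (subst integral_completion) auto

lemma borel_measurable_fourier:
  fixes f :: "'a::euclidean_space \<Rightarrow> complex"
  assumes [measurable]: "f \<in> borel_measurable borel"
  shows "fourier f \<in> borel_measurable borel"
proof -
  have "(\<lambda>\<xi>. \<integral>x. f x * wave (x \<bullet> \<xi>) \<partial>lborel) \<in> borel_measurable borel"
    by (rule lborel.borel_measurable_lebesgue_integral) measurable
  also have "(\<lambda>\<xi>. \<integral>x. f x * wave (x \<bullet> \<xi>) \<partial>lborel) = fourier f"
    by (simp add: fourier_lborel fun_eq_iff)
  finally show ?thesis .
qed

lemma integrable_mult_wave:
  fixes f :: "'a::euclidean_space \<Rightarrow> complex"
  assumes "integrable lborel f"
  shows "integrable lborel (\<lambda>x. f x * wave (x \<bullet> \<xi>))"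
  by (rule Bochner_Integration.integrable_bound[OF assms]) (use assms in \<open>auto simp: norm_mult\<close>)

lemma norm_fourier_le:
  assumes "f \<in> borel_measurable borel"
  shows "norm (fourier f \<xi>) \<le> (\<integral>x. norm (f x) \<partial>lborel)"
  using integral_norm_bound[of lborel "\<lambda>x. f x * wave (x \<bullet> \<xi>)"]
  by (simp add: fourier_lborel[OF assms] norm_mult)

lemma fourier_add:
  assumes "integrable lborel f" "integrable lborel g"
  shows "fourier (\<lambda>x. f x + g x) \<xi> = fourier f \<xi> + fourier g \<xi>"
  using assms integrable_mult_wave[OF assms(1)] integrable_mult_wave[OF assms(2)]
  by (subst (1 2 3) fourier_lborel) (auto simp: ring_distribs)

lemma fourier_scale: "fourier (\<lambda>x. c * f x) \<xi> = c * fourier f \<xi>"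
  by (simp add: fourier_def mult.assoc)

lemma fourier_diff:
  assumes "integrable lborel f" "integrable lborel g"
  shows "fourier (\<lambda>x. f x - g x) \<xi> = fourier f \<xi> - fourier g \<xi>"
  using fourier_add[OF assms(1) integrable_mult_right[OF assms(2), of "-1"], of \<xi>]
    fourier_scale[of "-1" g \<xi>] by simp

lemma lborel_integral_affine:
  fixes f :: "'a::euclidean_space \<Rightarrow> 'b::{banach, second_countable_topology}"
  assumes [measurable]: "f \<in> borel_measurable borel" and c: "c \<noteq> 0"
  shows "(\<integral>x. f x \<partial>lborel) = \<bar>c\<bar> ^ DIM('a) *\<^sub>R (\<integral>x. f (t + c *\<^sub>R x) \<partial>lborel)"
  by (subst lborel_affine[OF c, of t])
    (simp add: integral_density integral_distr)

lemma fourier_affine: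
  fixes f :: "'a::euclidean_space \<Rightarrow> complex"
  assumes [measurable]: "f \<in> borel_measurable borel" and c: "c \<noteq> 0"
  shows "fourier (\<lambda>x. f (c *\<^sub>R x + v)) \<xi> = of_real (1 / \<bar>c\<bar> ^ DIM('a)) * wave (- (v \<bullet> \<xi>) / c) * fourier f (\<xi> /\<^sub>R c)"
proof -
  have "fourier f (\<xi> /\<^sub>R c) = \<bar>c\<bar> ^ DIM('a) *\<^sub>R (\<integral>x. f (v + c *\<^sub>R x) * wave ((v + c *\<^sub>R x) \<bullet> (\<xi> /\<^sub>R c)) \<partial>lborel)"
    by (subst fourier_lborel, simp, rule lborel_integral_affine[OF _ c]) simp
  also have "\<dots> = \<bar>c\<bar> ^ DIM('a) *\<^sub>R (\<integral>x. wave ((v \<bullet> \<xi>) / c) * (f (c *\<^sub>R x + v) * wave (x \<bullet> \<xi>)) \<partial>lborel)"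
  proof -
    have "(v + c *\<^sub>R x) \<bullet> (\<xi> /\<^sub>R c) = (v \<bullet> \<xi>) / c + x \<bullet> \<xi>" for x
      using c by (simp add: inner_add_left field_simps)
    then show ?thesis by (simp only: wave_add add.commute[of v] mult_ac)
  qed
  also have "\<dots> = \<bar>c\<bar> ^ DIM('a) *\<^sub>R (wave ((v \<bullet> \<xi>) / c) * fourier (\<lambda>x. f (c *\<^sub>R x + v)) \<xi>)"
    by (subst fourier_lborel) auto
  finally have "fourier f (\<xi> /\<^sub>R c) = of_real (\<bar>c\<bar> ^ DIM('a)) * wave ((v \<bullet> \<xi>) / c) * fourier (\<lambda>x. f (c *\<^sub>R x + v)) \<xi>"
    by (simp add: scaleR_conv_of_real)
  then show ?thesis using c wave_minus_mult(1)[of "(v \<bullet> \<xi>) / c"] by (simp add: field_simps)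
qed

text \<open>Fubini for u(x) v(\<xi>) \<open>wave (x \<bullet> \<xi>)\<close>. This symmetry carries
  the Gaussian inversion formula, Plancherel's inequality and the duality step of the final
  estimate.\<close>

lemma fourier_multiplication:
  fixes u v :: "'a::euclidean_space \<Rightarrow> complex"
  assumes u: "integrable lborel u" and v: "integrable lborel v"
  shows "(\<integral>\<xi>. fourier u \<xi> * v \<xi> \<partial>lborel) = (\<integral>x. u x * fourier v x \<partial>lborel)"
proof -
  have [measurable]: "u \<in> borel_measurable borel" "v \<in> borel_measurable borel"
    using u v by auto
  have "integrable (lborel \<Otimes>\<^sub>M lborel) (\<lambda>(x, \<xi>). u x * v \<xi> * wave (x \<bullet> \<xi>))"
  proof (rule lborel_pair.Fubini_integrable)
    show "integrable lborel (\<lambda>x. \<integral>\<xi>. norm (case (x, \<xi>) of (x, \<xi>) \<Rightarrow> u x * v \<xi> * wave (x \<bullet> \<xi>)) \<partial>lborel)"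
      using u v by (simp add: norm_mult)
    show "AE x in lborel. integrable lborel (\<lambda>\<xi>. case (x, \<xi>) of (x, \<xi>) \<Rightarrow> u x * v \<xi> * wave (x \<bullet> \<xi>))"
      using integrable_mult_wave[OF v] by (simp add: mult.assoc inner_commute)
  qed measurable
  from lborel_pair.Fubini_integral[OF this]
  have "(\<integral>\<xi>. (\<integral>x. u x * v \<xi> * wave (x \<bullet> \<xi>) \<partial>lborel) \<partial>lborel) = (\<integral>x. (\<integral>\<xi>. u x * v \<xi> * wave (x \<bullet> \<xi>) \<partial>lborel) \<partial>lborel)" .
  moreover have "(\<integral>x. u x * v \<xi> * wave (x \<bullet> \<xi>) \<partial>lborel) = fourier u \<xi> * v \<xi>" for \<xi>
    by (simp add: fourier_lborel flip: integral_mult_left_zero) (simp add: mult_ac)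
  moreover have "(\<integral>\<xi>. u x * v \<xi> * wave (x \<bullet> \<xi>) \<partial>lborel) = u x * fourier v x" for x
    by (simp add: fourier_lborel inner_commute mult.assoc)
  ultimately show ?thesis by simp
qed

section \<open>The Fourier transform on the Schwartz space\<close>

text \<open>The mean value estimate meets the majorant at points up to distance 1 away; this brings
  it back to \<open>x\<close>. The 3 comes from 1 + (a+1)^2 <= 3 (1 + a^2).\<close>

lemma weight_shift_le:
  fixes x v :: "'a::euclidean_space"
  assumes "norm v \<le> 1"
  shows "weight (x + v) \<le> 3 ^ DIM('a) * weight x"
proof -
  have "norm x \<le> norm (x + v) + norm v"
    using norm_triangle_ineq4[of "x + v" v] by simp
  then have "norm x \<le> norm (x + v) + 1" using assms by simp
  then have "(norm x)\<^sup>2 \<le> (norm (x + v) + 1)\<^sup>2" by (intro power_mono) auto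
  also have "\<dots> \<le> 2 * (norm (x + v))\<^sup>2 + 2"
    using sum_squares_bound[of "norm (x + v)" 1] by (simp add: power2_sum)
  finally have "1 + (norm x)\<^sup>2 \<le> 3 * (1 + (norm (x + v))\<^sup>2)"
    using zero_le_power2[of "norm (x + v)"] unfolding distrib_left by linarith
  then have "(1 + (norm x)\<^sup>2) ^ DIM('a) \<le> (3 * (1 + (norm (x + v))\<^sup>2)) ^ DIM('a)"
    by (intro power_mono) auto
  then have le: "(1 + (norm x)\<^sup>2) ^ DIM('a) \<le> 3 ^ DIM('a) * (1 + (norm (x + v))\<^sup>2) ^ DIM('a)"
    by (simp only: power_mult_distrib)
  have "0 < (1 + (norm x)\<^sup>2) ^ DIM('a)" "0 < (1 + (norm (x + v))\<^sup>2) ^ DIM('a)"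
    by (simp_all add: add_pos_nonneg)
  with le show ?thesis by (simp add: weight_def field_simps)
qed

text \<open>Mean value inequality along the segment from x to x + t b. The factor
  \<open>weight x\<close> provides one integrable majorant for all difference quotients.\<close>

lemma schwartz_difference_le:
  fixes f :: "'a::euclidean_space \<Rightarrow> complex"
  assumes f: "f \<in> schwartz" and b: "b \<in> Basis"
  obtains C where "\<And>x t. 0 < t \<Longrightarrow> t \<le> 1 \<Longrightarrow> norm (f (x + t *\<^sub>R b) - f x) \<le> C * weight x * t"
proof -
  define g where "g = partials [b] f"
  have g: "g \<in> schwartz" unfolding g_def using f b by (intro schwartz_partials) auto
  define K where "K = 2 ^ DIM('a) * (schwartz_seminorm 0 [] g + schwartz_seminorm (2 * DIM('a)) [] g)"
  have K: "norm (g x) \<le> K * weight x" for x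
    unfolding K_def by (rule schwartz_le_weight[OF g])
  have K0: "0 \<le> K" unfolding K_def using schwartz_seminorm_nonneg[OF g, of "[]"] by simp
  have "norm (f (x + t *\<^sub>R b) - f x) \<le> (K * 3 ^ DIM('a)) * weight x * t" if t: "0 < t" "t \<le> 1" for x t
  proof -
    let ?p = "\<lambda>r. f (x + r *\<^sub>R b)"
    have "norm (?p t - ?p 0) \<le> (K * 3 ^ DIM('a) * weight x) * norm (t - 0)"
    proof (rule differentiable_bound[where S="{0..t}" and f'="\<lambda>r s. of_real s * g (x + r *\<^sub>R b)"])
      fix r assume r: "r \<in> {0..t}"
      interpret L: bounded_linear "frechet_derivative f (at (x + r *\<^sub>R b))"
        using schwartz_has_derivative[OF f] has_derivative_bounded_linear by blast
      have "(?p has_derivative (\<lambda>s. frechet_derivative f (at (x + r *\<^sub>R b)) (s *\<^sub>R b))) (at r)"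
        by (rule has_derivative_compose[where g=f and f="\<lambda>r. x + r *\<^sub>R b",
              OF _ schwartz_has_derivative[OF f]]) (auto intro!: derivative_eq_intros)
      then show "(?p has_derivative (\<lambda>s. of_real s * g (x + r *\<^sub>R b))) (at r within {0..t})"
        by (auto simp: g_def L.scaleR scaleR_conv_of_real intro: has_derivative_at_withinI)
      have "norm (g (x + r *\<^sub>R b)) \<le> K * weight (x + r *\<^sub>R b)" by (rule K)
      also have "\<dots> \<le> K * (3 ^ DIM('a) * weight x)"
        using r t b K0 by (intro mult_left_mono weight_shift_le) auto
      finally have "norm (g (x + r *\<^sub>R b)) \<le> K * 3 ^ DIM('a) * weight x" by (simp add: mult.assoc)
      from mult_right_mono[OF this, of "\<bar>_\<bar>"]
      show "onorm (\<lambda>s. of_real s * g (x + r *\<^sub>R b)) \<le> K * 3 ^ DIM('a) * weight x"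
        by (intro onorm_le) (simp add: norm_mult mult.commute)
    qed (use t in auto)
    then show ?thesis using t by simp
  qed
  then show ?thesis using that by blast
qed

lemma vector_derivative_quotient_tendsto:
  fixes f :: "real \<Rightarrow> 'a::real_normed_vector"
  assumes "(f has_vector_derivative D) (at 0)"
  shows "((\<lambda>r. (f r - f 0) /\<^sub>R r) \<longlongrightarrow> D) (at 0)"
proof -
  have "((\<lambda>h. norm (f h - f 0 - h *\<^sub>R D) / norm h) \<longlongrightarrow> 0) (at 0)"
    using assms by (simp add: has_vector_derivative_def has_derivative_at)
  moreover have "\<forall>\<^sub>F h in at 0. norm (f h - f 0 - h *\<^sub>R D) / norm h = norm ((f h - f 0) /\<^sub>R h - D)"
    unfolding eventually_at_filter
  proof (intro always_eventually allI impI)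
    fix h :: real assume "h \<noteq> 0"
    then have "(f h - f 0) /\<^sub>R h - D = inverse h *\<^sub>R (f h - f 0 - h *\<^sub>R D)"
      by (simp add: scaleR_diff_right)
    then show "norm (f h - f 0 - h *\<^sub>R D) / norm h = norm ((f h - f 0) /\<^sub>R h - D)"
      by (simp add: divide_inverse_commute)
  qed
  ultimately have "((\<lambda>h. norm ((f h - f 0) /\<^sub>R h - D)) \<longlongrightarrow> 0) (at 0)"
    by (rule Lim_transform_eventually)
  then show ?thesis by (simp only: tendsto_norm_zero_iff LIM_zero_iff)
qed

text \<open>The difference quotient in direction \<open>b\<close> is transformed in two ways:
  translation becomes multiplication by a \<open>wave\<close>, and dominated convergence passes to
  the derivative under the integral. The two limits agree.\<close>

lemma fourier_partial:
  fixes f :: "'a::euclidean_space \<Rightarrow> complex"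
  assumes f: "f \<in> schwartz" and b: "b \<in> Basis"
  shows "fourier (partials [b] f) \<xi> = 2 * of_real pi * \<i> * of_real (b \<bullet> \<xi>) * fourier f \<xi>"
proof -
  define g where "g = partials [b] f"
  have g: "g \<in> schwartz" unfolding g_def using f b by (intro schwartz_partials) auto
  obtain C where C: "\<And>x t. 0 < t \<Longrightarrow> t \<le> 1 \<Longrightarrow> norm (f (x + t *\<^sub>R b) - f x) \<le> C * weight x * t"
    using schwartz_difference_le[OF f b] by blast
  have [measurable]: "f \<in> borel_measurable borel" "g \<in> borel_measurable borel"
    using f g by (auto intro: schwartz_borel_measurable)
  define t where "t n = 1 / real (Suc n)" for n
  have t: "0 < t n" "t n \<le> 1" for n by (auto simp: t_def)
  have "t \<longlonglongrightarrow> 0" unfolding t_def using LIMSEQ_inverse_real_of_nat by (simp add: inverse_eq_divide)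
  then have t0: "filterlim t (at 0) sequentially"
    using t by (intro filterlim_atI) (auto intro!: always_eventually simp: less_imp_neq[THEN not_sym])
  define q where "q n x = (f (x + t n *\<^sub>R b) - f x) /\<^sub>R t n" for n x
  have q_lim: "(\<lambda>n. q n x) \<longlonglongrightarrow> g x" for x
  proof -
    interpret L: bounded_linear "frechet_derivative f (at x)"
      using schwartz_has_derivative[OF f] has_derivative_bounded_linear by blast
    have "((\<lambda>r. f (x + r *\<^sub>R b)) has_derivative (\<lambda>s. frechet_derivative f (at x) (s *\<^sub>R b))) (at 0)"
      by (rule has_derivative_compose[where g=f and f="\<lambda>r. x + r *\<^sub>R b" and x=0, simplified, OF _ schwartz_has_derivative[OF f]])
        (auto intro!: derivative_eq_intros)
    then have "((\<lambda>r. f (x + r *\<^sub>R b)) has_vector_derivative g x) (at 0)"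
      by (simp add: has_vector_derivative_def g_def L.scaleR)
    from vector_derivative_quotient_tendsto[OF this]
    have "((\<lambda>r. (f (x + r *\<^sub>R b) - f x) /\<^sub>R r) \<longlongrightarrow> g x) (at 0)" by simp
    from filterlim_compose[OF this t0] show ?thesis unfolding q_def .
  qed
  have q_fourier: "fourier (q n) \<xi> = ((wave (- (t n * (b \<bullet> \<xi>))) - 1) /\<^sub>R t n) * fourier f \<xi>" for n
  proof -
    have "fourier (q n) \<xi> = of_real (inverse (t n)) * (fourier (\<lambda>x. f (x + t n *\<^sub>R b)) \<xi> - fourier f \<xi>)"
      unfolding q_def scaleR_conv_of_real fourier_scale
      using schwartz_affine[OF f, of 1 "t n *\<^sub>R b"] f
      by (subst fourier_diff) (auto intro: schwartz_integrable)
    also have "fourier (\<lambda>x. f (x + t n *\<^sub>R b)) \<xi> = wave (- (t n * (b \<bullet> \<xi>))) * fourier f \<xi>"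
      using fourier_affine[of f 1 "t n *\<^sub>R b" \<xi>] by simp
    finally show ?thesis by (simp add: scaleR_conv_of_real algebra_simps)
  qed
  have "(\<lambda>n. fourier (q n) \<xi>) \<longlonglongrightarrow> fourier g \<xi>"
  proof -
    have [measurable]: "q n \<in> borel_measurable borel" for n unfolding q_def by measurable
    have "(\<lambda>n. \<integral>x. q n x * wave (x \<bullet> \<xi>) \<partial>lborel) \<longlonglongrightarrow> (\<integral>x. g x * wave (x \<bullet> \<xi>) \<partial>lborel)"
    proof (rule integral_dominated_convergence[where w="\<lambda>x. C * weight x"])
      show "AE x in lborel. (\<lambda>n. q n x * wave (x \<bullet> \<xi>)) \<longlonglongrightarrow> g x * wave (x \<bullet> \<xi>)"
        by (intro AE_I2 tendsto_intros q_lim)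
      show "AE x in lborel. norm (q n x * wave (x \<bullet> \<xi>)) \<le> C * weight x" for n
      proof (intro AE_I2)
        fix x
        have "norm (q n x) = norm (f (x + t n *\<^sub>R b) - f x) / t n"
          using t[of n] by (simp add: q_def divide_inverse_commute)
        also have "\<dots> \<le> C * weight x"
          using C[OF t[of n], of x] t[of n] by (simp add: pos_divide_le_eq)
        finally show "norm (q n x * wave (x \<bullet> \<xi>)) \<le> C * weight x" by (simp add: norm_mult)
      qed
      show "integrable lborel (\<lambda>x::'a. C * weight x)"
        using integrable_weight by (intro integrable_mult_right)
    qed auto
    then show ?thesis by (simp add: fourier_lborel)
  qed
  moreover have "(\<lambda>n. fourier (q n) \<xi>) \<longlonglongrightarrow> 2 * of_real pi * \<i> * of_real (b \<bullet> \<xi>) * fourier f \<xi>"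
  proof -
    have "((\<lambda>r. wave (- (r * (b \<bullet> \<xi>)))) has_vector_derivative 2 * of_real pi * \<i> * of_real (b \<bullet> \<xi>)) (at 0)"
    proof -
      have "((\<lambda>z. exp (2 * of_real pi * \<i> * of_real (b \<bullet> \<xi>) * z)) has_field_derivative
          2 * of_real pi * \<i> * of_real (b \<bullet> \<xi>)) (at (of_real 0))"
        by (auto intro!: derivative_eq_intros)
      from has_vector_derivative_real_field[OF this] show ?thesis by (simp add: wave_def mult_ac)
    qed
    from vector_derivative_quotient_tendsto[OF this]
    have "((\<lambda>r. (wave (- (r * (b \<bullet> \<xi>))) - 1) /\<^sub>R r) \<longlongrightarrow> 2 * of_real pi * \<i> * of_real (b \<bullet> \<xi>)) (at 0)" by simp
    from filterlim_compose[OF this t0] show ?thesis unfolding q_fourier by (rule tendsto_mult_right)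
  qed
  ultimately show ?thesis unfolding g_def using LIMSEQ_unique by blast
qed

text \<open>Second-order Taylor bound (2 pi t)^2 / 2; its quadratic size makes the remainder in
  \<open>has_derivative_fourier\<close> small compared with |v|.\<close>

lemma wave_remainder: "norm (wave t - 1 + 2 * of_real pi * \<i> * of_real t) \<le> 2 * pi\<^sup>2 * t\<^sup>2"
proof -
  have "norm (iexp (- (2 * pi * t)) - (\<Sum>k\<le>1. (\<i> * of_real (- (2 * pi * t))) ^ k / fact k))
      \<le> \<bar>- (2 * pi * t)\<bar> ^ Suc 1 / fact (Suc 1)"
    by (rule iexp_approx1)
  moreover have "(\<Sum>k\<le>1. (\<i> * of_real (- (2 * pi * t))) ^ k / fact k) = 1 - 2 * of_real pi * \<i> * of_real t"
    by (simp add: mult_ac)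
  moreover have "\<bar>- (2 * pi * t)\<bar> ^ Suc 1 / fact (Suc 1) = 2 * pi\<^sup>2 * t\<^sup>2"
    by (simp add: power2_eq_square)
  ultimately show ?thesis unfolding wave_eq_iexp by (simp only: diff_diff_eq2 add_diff_eq) (simp add: algebra_simps)
qed

lemma norm_square_sum_Basis: "(norm x)\<^sup>2 = (\<Sum>b\<in>Basis. (x \<bullet> b)\<^sup>2)"
  unfolding power2_norm_eq_inner by (subst euclidean_inner) (simp add: power2_eq_square)

lemma schwartz_norm_square_integrable:
  fixes f :: "'a::euclidean_space \<Rightarrow> complex"
  assumes f: "f \<in> schwartz"
  shows "integrable lborel (\<lambda>x. (norm x)\<^sup>2 * norm (f x))"
proof -
  have "integrable lborel (\<lambda>x. norm (of_real (x \<bullet> b) * (of_real (x \<bullet> b) * f x)))" if "b \<in> Basis" for b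
    by (intro integrable_norm schwartz_integrable schwartz_coordinate_mult f that)
  then have "integrable lborel (\<lambda>x. \<Sum>b\<in>Basis. norm (of_real (x \<bullet> b) * (of_real (x \<bullet> b) * f x)))"
    by (intro Bochner_Integration.integrable_sum)
  also have "(\<lambda>x. \<Sum>b\<in>Basis. norm (of_real (x \<bullet> b) * (of_real (x \<bullet> b) * f x))) = (\<lambda>x. (norm x)\<^sup>2 * norm (f x))"
  proof
    fix x :: 'a
    have "norm (of_real (x \<bullet> b) * (of_real (x \<bullet> b) * f x)) = (x \<bullet> b)\<^sup>2 * norm (f x)" for b
      by (simp add: norm_mult power2_eq_square flip: mult.assoc abs_mult)
    then show "(\<Sum>b\<in>Basis. norm (of_real (x \<bullet> b) * (of_real (x \<bullet> b) * f x))) = (norm x)\<^sup>2 * norm (f x)"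
      by (simp only: norm_square_sum_Basis sum_distrib_right)
  qed
  finally show ?thesis .
qed

text \<open>Differentiation under the integral, as the full Frechet derivative on which
  \<open>partials\<close> is built: the remainder is at most C |v|^2, with C equal to 2 pi^2 times
  the second absolute moment of \<open>f\<close>.\<close>

lemma has_derivative_fourier:
  fixes f :: "'a::euclidean_space \<Rightarrow> complex"
  assumes f: "f \<in> schwartz"
  shows "(fourier f has_derivative
    (\<lambda>v. \<Sum>b\<in>Basis. of_real (v \<bullet> b) * fourier (\<lambda>x. (- (2 * of_real pi * \<i>)) * (of_real (x \<bullet> b) * f x)) \<xi>)) (at \<xi>)"
    (is "(_ has_derivative ?D) _")
proof -
  have [measurable]: "f \<in> borel_measurable borel" using f by (rule schwartz_borel_measurable)
  define C where "C = 2 * pi\<^sup>2 * (\<integral>x. (norm x)\<^sup>2 * norm (f x) \<partial>lborel)"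
  have C0: "0 \<le> C" unfolding C_def by (intro mult_nonneg_nonneg integral_nonneg_AE) auto
  have coord: "integrable lborel (\<lambda>x. of_real (x \<bullet> b) * f x)" if "b \<in> Basis" for b
    by (intro schwartz_integrable schwartz_coordinate_mult f that)
  have D: "?D v = (\<integral>x. f x * wave (x \<bullet> \<xi>) * (- (2 * of_real pi * \<i> * of_real (x \<bullet> v))) \<partial>lborel)"
    and D_int: "integrable lborel (\<lambda>x. f x * wave (x \<bullet> \<xi>) * (- (2 * of_real pi * \<i> * of_real (x \<bullet> v))))" for v
  proof -
    let ?h = "\<lambda>b x. of_real (v \<bullet> b) * ((- (2 * of_real pi * \<i>)) * (of_real (x \<bullet> b) * f x) * wave (x \<bullet> \<xi>))"
    have eq: "f x * wave (x \<bullet> \<xi>) * (- (2 * of_real pi * \<i> * of_real (x \<bullet> v))) = (\<Sum>b\<in>Basis. ?h b x)" for x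
      by (subst euclidean_inner) (simp add: sum_distrib_left sum_distrib_right sum_negf mult_ac)
    have int: "integrable lborel (?h b)" if "b \<in> Basis" for b
      by (intro integrable_mult_right integrable_mult_wave[OF integrable_mult_right] coord that)
    show "integrable lborel (\<lambda>x. f x * wave (x \<bullet> \<xi>) * (- (2 * of_real pi * \<i> * of_real (x \<bullet> v))))"
      unfolding eq by (intro Bochner_Integration.integrable_sum int)
    show "?D v = (\<integral>x. f x * wave (x \<bullet> \<xi>) * (- (2 * of_real pi * \<i> * of_real (x \<bullet> v))) \<partial>lborel)"
      unfolding eq using int by (subst Bochner_Integration.integral_sum) (auto simp: fourier_lborel)
  qed
  have main: "norm (fourier f (\<xi> + v) - fourier f \<xi> - ?D v) \<le> C * (norm v)\<^sup>2" for v
  proof -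
    have int1: "integrable lborel (\<lambda>x. f x * wave (x \<bullet> (\<xi> + v)))" "integrable lborel (\<lambda>x. f x * wave (x \<bullet> \<xi>))"
      using schwartz_integrable[OF f] by (simp_all only: integrable_mult_wave)
    have "fourier f (\<xi> + v) - fourier f \<xi> - ?D v = (\<integral>x. f x * wave (x \<bullet> (\<xi> + v)) - f x * wave (x \<bullet> \<xi>)
        - f x * wave (x \<bullet> \<xi>) * (- (2 * of_real pi * \<i> * of_real (x \<bullet> v))) \<partial>lborel)"
      unfolding D fourier_lborel[OF \<open>f \<in> borel_measurable borel\<close>] using int1 D_int by simp
    also have "\<dots> = (\<integral>x. f x * wave (x \<bullet> \<xi>) * (wave (x \<bullet> v) - 1 + 2 * of_real pi * \<i> * of_real (x \<bullet> v)) \<partial>lborel)"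
      by (simp add: inner_add_right wave_add algebra_simps)
    also have "norm \<dots> \<le> (\<integral>x. 2 * pi\<^sup>2 * (norm v)\<^sup>2 * ((norm x)\<^sup>2 * norm (f x)) \<partial>lborel)"
    proof (rule Bochner_Integration.integral_norm_bound_integral)
      show "integrable lborel (\<lambda>x. f x * wave (x \<bullet> \<xi>) * (wave (x \<bullet> v) - 1 + 2 * of_real pi * \<i> * of_real (x \<bullet> v)))"
        using Bochner_Integration.integrable_diff[OF Bochner_Integration.integrable_diff[OF int1] D_int[of v]]
        by (simp add: inner_add_right wave_add algebra_simps)
      fix x
      have "norm (wave (x \<bullet> v) - 1 + 2 * of_real pi * \<i> * of_real (x \<bullet> v)) \<le> 2 * pi\<^sup>2 * (x \<bullet> v)\<^sup>2"
        by (rule wave_remainder)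
      also have "\<dots> \<le> 2 * pi\<^sup>2 * ((norm x)\<^sup>2 * (norm v)\<^sup>2)"
        using Cauchy_Schwarz_ineq[of x v] by (intro mult_left_mono) (auto simp: power2_norm_eq_inner)
      finally have le: "norm (wave (x \<bullet> v) - 1 + 2 * of_real pi * \<i> * of_real (x \<bullet> v))
          \<le> 2 * pi\<^sup>2 * ((norm x)\<^sup>2 * (norm v)\<^sup>2)" .
      from mult_left_mono[OF this, of "norm (f x)"]
      show "norm (f x * wave (x \<bullet> \<xi>) * (wave (x \<bullet> v) - 1 + 2 * of_real pi * \<i> * of_real (x \<bullet> v)))
          \<le> 2 * pi\<^sup>2 * (norm v)\<^sup>2 * ((norm x)\<^sup>2 * norm (f x))"
        unfolding norm_mult[of "f x * _"] norm_mult[of "f x"] norm_wave by (simp add: mult_ac)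
    qed (use schwartz_norm_square_integrable[OF f] in auto)
    also have "\<dots> = C * (norm v)\<^sup>2" by (subst integral_mult_right_zero) (simp add: C_def mult_ac)
    finally show ?thesis .
  qed
  show ?thesis
    unfolding has_derivative_at
  proof
    show "bounded_linear ?D"
      by (intro bounded_linear_sum bounded_linear_mult_left[THEN bounded_linear_compose]
          bounded_linear_compose[OF bounded_linear_of_real] bounded_linear_inner_left)
    have "((\<lambda>v::'a. C * norm v) \<longlongrightarrow> C * norm (0::'a)) (at 0)" by (intro tendsto_intros)
    then have lim: "((\<lambda>v::'a. C * norm v) \<longlongrightarrow> 0) (at 0)" by simp
    show "((\<lambda>v. norm (fourier f (\<xi> + v) - fourier f \<xi> - ?D v) / norm v) \<longlongrightarrow> 0) (at 0)"
    proof (rule Lim_null_comparison[OF always_eventually lim], intro allI)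
      fix v
      show "norm (norm (fourier f (\<xi> + v) - fourier f \<xi> - ?D v) / norm v) \<le> C * norm v"
        using main[of v] C0 by (cases "v = 0") (simp_all add: divide_le_eq power2_eq_square mult.assoc)
    qed
  qed
qed

lemma partials_fourier:
  fixes f :: "'a::euclidean_space \<Rightarrow> complex"
  assumes "f \<in> schwartz" "b \<in> Basis"
  shows "partials [b] (fourier f) = fourier (\<lambda>x. (- (2 * of_real pi * \<i>)) * (of_real (x \<bullet> b) * f x))"
proof
  fix \<xi>
  have "(\<Sum>c\<in>Basis. of_real (b \<bullet> c) * fourier (\<lambda>x. (- (2 * of_real pi * \<i>)) * (of_real (x \<bullet> c) * f x)) \<xi>)
    = (\<Sum>c\<in>Basis. if c = b then fourier (\<lambda>x. (- (2 * of_real pi * \<i>)) * (of_real (x \<bullet> c) * f x)) \<xi> else 0)"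
    using assms(2) by (intro sum.cong) (auto simp: inner_Basis)
  with partials_singleton[OF has_derivative_fourier[OF assms(1), of \<xi>], of b] assms(2)
  show "partials [b] (fourier f) \<xi> = fourier (\<lambda>x. (- (2 * of_real pi * \<i>)) * (of_real (x \<bullet> b) * f x)) \<xi>"
    by simp
qed

text \<open>Each factor \<open>norm \<xi>\<close> costs one derivative of \<open>f\<close>.\<close>

lemma fourier_decay:
  "\<exists>C\<ge>0. \<forall>f :: 'a::euclidean_space \<Rightarrow> complex. f \<in> schwartz \<longrightarrow> (\<forall>\<xi>. norm \<xi> ^ m * norm (fourier f \<xi>) \<le>
    C * (\<Sum>bs\<in>{bs. set bs \<subseteq> Basis \<and> length bs = m}.
      schwartz_seminorm 0 bs f + schwartz_seminorm (2 * DIM('a)) bs f))"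
proof (induction m)
  case 0
  have "{bs :: 'a list. set bs \<subseteq> Basis \<and> length bs = 0} = {[]}" by auto
  then show ?case
    using order_trans[OF norm_fourier_le schwartz_integral_norm_le] schwartz_borel_measurable
    by (intro exI[of _ "2 ^ DIM('a) * (\<integral>x. weight (x::'a) \<partial>lborel)"])
      (auto intro!: mult_nonneg_nonneg Bochner_Integration.integral_nonneg less_imp_le[OF weight_pos])
next
  case (Suc m)
  let ?N = "\<lambda>bs f. schwartz_seminorm 0 bs f + schwartz_seminorm (2 * DIM('a)) bs f"
  let ?B = "\<lambda>m. {bs :: 'a list. set bs \<subseteq> Basis \<and> length bs = m}"
  obtain C where C0: "C \<ge> 0" and C: "\<And>(f :: 'a \<Rightarrow> complex) \<xi>. f \<in> schwartz \<Longrightarrow>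
      norm \<xi> ^ m * norm (fourier f \<xi>) \<le> C * (\<Sum>bs\<in>?B m. ?N bs f)"
    using Suc.IH by blast
  have fin: "finite (?B k)" for k by (rule finite_lists_length_eq) simp
  have "norm \<xi> ^ Suc m * norm (fourier f \<xi>) \<le> C * real DIM('a) * (\<Sum>bs\<in>?B (Suc m). ?N bs f)"
    if f: "f \<in> schwartz" for f :: "'a \<Rightarrow> complex" and \<xi>
  proof -
    have *: "norm \<xi> ^ m * (\<bar>\<xi> \<bullet> b\<bar> * norm (fourier f \<xi>)) \<le> C * (\<Sum>bs\<in>?B (Suc m). ?N bs f)"
      if b: "b \<in> Basis" for b
    proof -
      have pf: "partials [b] f \<in> schwartz" using f b by (intro schwartz_partials) auto
      have "1 \<le> 2 * pi" using pi_gt3 by simp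
      then have "\<bar>\<xi> \<bullet> b\<bar> * norm (fourier f \<xi>) \<le> (2 * pi) * (\<bar>\<xi> \<bullet> b\<bar> * norm (fourier f \<xi>))"
        using mult_right_mono[OF \<open>1 \<le> 2 * pi\<close>, of "\<bar>\<xi> \<bullet> b\<bar> * norm (fourier f \<xi>)"] by simp
      also have "\<dots> = norm (fourier (partials [b] f) \<xi>)"
        unfolding fourier_partial[OF f b] by (simp add: norm_mult inner_commute)
      finally have "norm \<xi> ^ m * (\<bar>\<xi> \<bullet> b\<bar> * norm (fourier f \<xi>)) \<le> norm \<xi> ^ m * norm (fourier (partials [b] f) \<xi>)"
        by (intro mult_left_mono) auto
      also have "\<dots> \<le> C * (\<Sum>bs\<in>?B m. ?N bs (partials [b] f))" by (rule C[OF pf])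
      \<comment> \<open>In \<open>partials\<close> the last list entry is differentiated first, so a
        derivative of \<open>partials [b] f\<close> carries \<open>b\<close> at the end of its
        list.\<close>
      also have "(\<Sum>bs\<in>?B m. ?N bs (partials [b] f)) = (\<Sum>bs\<in>(\<lambda>bs. bs @ [b]) ` ?B m. ?N bs f)"
        by (subst sum.reindex) (simp_all add: inj_on_def schwartz_seminorm_partials del: partials.simps)
      also have "\<dots> \<le> (\<Sum>bs\<in>?B (Suc m). ?N bs f)"
      proof (rule sum_mono2[OF fin])
        show "(\<lambda>bs. bs @ [b]) ` ?B m \<subseteq> ?B (Suc m)" using b by auto
        show "0 \<le> ?N bs f" if "bs \<in> ?B (Suc m) - (\<lambda>bs. bs @ [b]) ` ?B m" for bs
          using that by (intro add_nonneg_nonneg schwartz_seminorm_nonneg f) auto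
      qed
      finally show ?thesis using C0 by (simp only: mult_left_mono)
    qed
    have "norm \<xi> ^ Suc m * norm (fourier f \<xi>) \<le> norm \<xi> ^ m * (\<Sum>b\<in>Basis. \<bar>\<xi> \<bullet> b\<bar>) * norm (fourier f \<xi>)"
      unfolding power_Suc2 by (intro mult_right_mono mult_left_mono norm_le_l1) auto
    also have "\<dots> = (\<Sum>b\<in>Basis. norm \<xi> ^ m * (\<bar>\<xi> \<bullet> b\<bar> * norm (fourier f \<xi>)))"
      by (simp add: sum_distrib_left sum_distrib_right mult.assoc)
    also have "\<dots> \<le> (\<Sum>b\<in>(Basis::'a set). C * (\<Sum>bs\<in>?B (Suc m). ?N bs f))"
      by (intro sum_mono *)
    finally show ?thesis by (simp add: mult_ac)
  qed
  then show ?case using C0 by (intro exI[of _ "C * real DIM('a)"]) auto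
qed

text \<open>By \<open>partials_fourier\<close> the image of the Schwartz space is stable under one
  partial derivative, so it can itself serve as the invariant set.\<close>

lemma schwartz_fourier:
  fixes f :: "'a::euclidean_space \<Rightarrow> complex"
  assumes "f \<in> schwartz"
  shows "fourier f \<in> schwartz"
proof (rule schwartz_coinduct[where X="fourier ` schwartz"])
  fix h :: "'a \<Rightarrow> complex" assume "h \<in> fourier ` schwartz"
  then obtain f where f: "f \<in> schwartz" and h: "h = fourier f" by blast
  show "h differentiable at x" for x
    unfolding h using has_derivative_fourier[OF f] differentiable_def by blast
  show "rapid_decay h"
    unfolding h rapid_decay_def using fourier_decay f by blast
  fix b :: 'a assume b: "b \<in> Basis"
  show "partials [b] h \<in> fourier ` schwartz"
    unfolding h partials_fourier[OF f b] by (intro imageI schwartz_scale schwartz_coordinate_mult f b)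
qed (use assms in blast)

section \<open>Gaussians\<close>

lemma
  fixes f :: "'a::euclidean_space \<Rightarrow> real \<Rightarrow> 'b::{real_normed_field,banach,second_countable_topology}"
  assumes "\<And>b. b \<in> Basis \<Longrightarrow> integrable lborel (f b)"
  shows lborel_integrable_prod: "integrable lborel (\<lambda>x. \<Prod>b\<in>Basis. f b (x \<bullet> b))"
    and lborel_integral_prod: "(\<integral>x. (\<Prod>b\<in>Basis. f b (x \<bullet> b)) \<partial>lborel) = (\<Prod>b\<in>Basis. \<integral>t. f b t \<partial>lborel)"
proof -
  interpret product_sigma_finite "\<lambda>_::'a. lborel :: real measure"
    by standard
  have [measurable]: "b \<in> Basis \<Longrightarrow> f b \<in> borel_measurable borel" for b
    using assms by auto
  have S: "(\<lambda>g. \<Sum>b\<in>Basis. g b *\<^sub>R b) \<in> (\<Pi>\<^sub>M b\<in>(Basis::'a set). lborel) \<rightarrow>\<^sub>M borel"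
    by measurable
  have P: "(\<lambda>x. \<Prod>b\<in>Basis. f b (x \<bullet> b)) \<in> borel_measurable borel"
    by measurable
  show "integrable lborel (\<lambda>x. \<Prod>b\<in>Basis. f b (x \<bullet> b))"
    unfolding lborel_eq[where 'a='a] integrable_distr_eq[OF S P]
    using product_integrable_prod[OF finite_Basis, of f] assms by simp
  show "(\<integral>x. (\<Prod>b\<in>Basis. f b (x \<bullet> b)) \<partial>lborel) = (\<Prod>b\<in>Basis. \<integral>t. f b t \<partial>lborel)"
    unfolding lborel_eq[where 'a='a] integral_distr[OF S P]
    using product_integral_prod[OF finite_Basis, of f] assms by simp
qed

definition gauss :: "real \<Rightarrow> 'a::euclidean_space \<Rightarrow> real" where
  "gauss \<tau> x = exp (- (norm x)\<^sup>2 / (2 * \<tau>\<^sup>2))"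

text \<open>The Fourier transform of \<open>gauss \<tau>\<close>: a kernel of mass 1 that
  concentrates at the origin as \<tau> grows.\<close>

definition gauss_hat :: "real \<Rightarrow> 'a::euclidean_space \<Rightarrow> real" where
  "gauss_hat \<tau> x = (sqrt (2 * pi) * \<tau>) ^ DIM('a) * exp (- 2 * pi\<^sup>2 * \<tau>\<^sup>2 * (norm x)\<^sup>2)"

lemma gauss_pos: "0 < gauss \<tau> x"
  by (simp add: gauss_def)

lemma gauss_hat_nonneg: "0 \<le> \<tau> \<Longrightarrow> 0 \<le> gauss_hat \<tau> x"
  by (simp add: gauss_hat_def)

lemma gauss_borel_measurable[measurable]:
  "gauss \<tau> \<in> borel_measurable borel" "gauss_hat \<tau> \<in> borel_measurable borel"
  unfolding gauss_def gauss_hat_def by measurable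

text \<open>The characteristic function of the standard normal distribution, freed of its
  normalisation.\<close>

lemma std_normal_fourier:
  "(\<integral>x. of_real (exp (- x\<^sup>2 / 2)) * iexp (s * x) \<partial>lborel) = of_real (sqrt (2 * pi) * exp (- s\<^sup>2 / 2))"
proof -
  have "of_real (exp (- s\<^sup>2 / 2)) = char std_normal_distribution s"
    by (simp add: char_std_normal_distribution)
  also have "\<dots> = (\<integral>x. std_normal_density x *\<^sub>R iexp (s * x) \<partial>lborel)"
    unfolding char_def by (subst integral_density) auto
  also have "\<dots> = (\<integral>x. of_real (1 / sqrt (2 * pi)) * (of_real (exp (- x\<^sup>2 / 2)) * iexp (s * x)) \<partial>lborel)"
    by (simp add: std_normal_density_def scaleR_conv_of_real mult.assoc)
  also have "\<dots> = of_real (1 / sqrt (2 * pi)) * (\<integral>x. of_real (exp (- x\<^sup>2 / 2)) * iexp (s * x) \<partial>lborel)"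
    by (rule integral_mult_right_zero)
  finally show ?thesis by (simp add: field_simps)
qed

lemma integrable_gauss_real:
  assumes "\<tau> > 0"
  shows "integrable lborel (\<lambda>t::real. exp (- t\<^sup>2 / (2 * \<tau>\<^sup>2)))"
proof -
  have "integrable lborel (\<lambda>t. sqrt (2 * pi * \<tau>\<^sup>2) * normal_density 0 \<tau> t)"
    using assms by (intro integrable_mult_right integrable_normal_density)
  then show ?thesis using assms by (simp add: normal_density_def)
qed

lemma gauss_fourier_real:
  assumes "\<tau> > 0"
  shows "(\<integral>t. of_real (exp (- t\<^sup>2 / (2 * \<tau>\<^sup>2))) * wave (t * v) \<partial>lborel)
    = of_real (sqrt (2 * pi) * \<tau> * exp (- 2 * pi\<^sup>2 * \<tau>\<^sup>2 * v\<^sup>2))"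
proof -
  have "(\<integral>t. of_real (exp (- t\<^sup>2 / (2 * \<tau>\<^sup>2))) * wave (t * v) \<partial>lborel)
      = \<tau> *\<^sub>R (\<integral>x. of_real (exp (- (0 + \<tau> * x)\<^sup>2 / (2 * \<tau>\<^sup>2))) * wave ((0 + \<tau> * x) * v) \<partial>lborel)"
    using assms by (subst lborel_integral_real_affine[of \<tau> _ 0]) auto
  also have "\<dots> = \<tau> *\<^sub>R (\<integral>x. of_real (exp (- x\<^sup>2 / 2)) * iexp (- (2 * pi * \<tau> * v) * x) \<partial>lborel)"
    using assms by (simp add: wave_eq_iexp power_mult_distrib mult_ac)
  also have "\<dots> = \<tau> *\<^sub>R of_real (sqrt (2 * pi) * exp (- (- (2 * pi * \<tau> * v))\<^sup>2 / 2))"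
    unfolding std_normal_fourier ..
  finally show ?thesis by (simp add: scaleR_conv_of_real power_mult_distrib mult_ac)
qed

lemma gauss_prod: "gauss \<tau> x = (\<Prod>b\<in>Basis. exp (- (x \<bullet> b)\<^sup>2 / (2 * \<tau>\<^sup>2)))"
  unfolding gauss_def norm_square_sum_Basis
  by (simp add: exp_sum[symmetric] sum_negf sum_divide_distrib)

lemma integrable_gauss: "\<tau> > 0 \<Longrightarrow> integrable lborel (gauss \<tau> :: 'a::euclidean_space \<Rightarrow> real)"
  using lborel_integrable_prod[of "\<lambda>b::'a. \<lambda>t. exp (- t\<^sup>2 / (2 * \<tau>\<^sup>2))", OF integrable_gauss_real]
  by (simp only: gauss_prod[abs_def])

lemma fourier_gauss:
  fixes v :: "'a::euclidean_space"
  assumes "\<tau> > 0"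
  shows "fourier (\<lambda>x. of_real (gauss \<tau> x)) v = of_real (gauss_hat \<tau> v)"
proof -
  let ?f = "\<lambda>b t. of_real (exp (- t\<^sup>2 / (2 * \<tau>\<^sup>2))) * wave (t * (v \<bullet> b))"
  have "integrable lborel (?f b)" for b
    using integrable_of_real[OF integrable_gauss_real[OF assms], where 'a=complex]
    by (rule Bochner_Integration.integrable_bound) (auto simp: norm_mult)
  from lborel_integral_prod[of ?f, OF this]
  have "(\<integral>x. (\<Prod>b\<in>Basis. ?f b (x \<bullet> b)) \<partial>lborel) = (\<Prod>b\<in>Basis. of_real (sqrt (2 * pi) * \<tau> * exp (- 2 * pi\<^sup>2 * \<tau>\<^sup>2 * (v \<bullet> b)\<^sup>2)))"
    unfolding gauss_fourier_real[OF assms] by simp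
  moreover have "(\<Prod>b\<in>Basis. ?f b (x \<bullet> b)) = of_real (gauss \<tau> x) * wave (x \<bullet> v)" for x
    by (subst (2) euclidean_inner) (simp add: gauss_prod wave_sum prod.distrib)
  moreover have "(\<Prod>b\<in>Basis. complex_of_real (sqrt (2 * pi) * \<tau> * exp (- 2 * pi\<^sup>2 * \<tau>\<^sup>2 * (v \<bullet> b)\<^sup>2))) = of_real (gauss_hat \<tau> v)"
    unfolding gauss_hat_def norm_square_sum_Basis of_real_prod[symmetric]
    by (simp add: prod.distrib exp_sum[symmetric] sum_negf sum_distrib_left)
  ultimately show ?thesis by (subst fourier_lborel) (simp, simp only:)
qed

lemma gauss_hat_eq_gauss:
  "gauss_hat \<tau> (v::'a::euclidean_space) = (sqrt (2 * pi) * \<tau>) ^ DIM('a) * gauss (1 / (2 * pi * \<tau>)) v"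
  by (simp add: gauss_hat_def gauss_def power_mult_distrib power_divide mult_ac)

lemma integrable_gauss_hat:
  "\<tau> > 0 \<Longrightarrow> integrable lborel (gauss_hat \<tau> :: 'a::euclidean_space \<Rightarrow> real)"
  unfolding gauss_hat_eq_gauss by (intro integrable_mult_right integrable_gauss) simp

text \<open>\<open>gauss_hat \<tau>\<close> is a multiple of the Gaussian of width \<sigma> = 1/(2
  pi \<tau>), whose integral is its Fourier transform at 0. The constants multiply to (2 pi \<tau>
  \<sigma>)^d = 1.\<close>

lemma integral_gauss_hat:
  assumes "\<tau> > 0"
  shows "(\<integral>x. gauss_hat \<tau> (x::'a::euclidean_space) \<partial>lborel) = 1"
proof -
  define \<sigma> where "\<sigma> = 1 / (2 * pi * \<tau>)"
  have \<sigma>: "\<sigma> > 0" using assms by (simp add: \<sigma>_def)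
  have "of_real (\<integral>x. gauss \<sigma> (x::'a) \<partial>lborel) = fourier (\<lambda>x::'a. of_real (gauss \<sigma> x)) 0"
    by (subst fourier_lborel) simp_all
  then have "(\<integral>x. gauss \<sigma> (x::'a) \<partial>lborel) = (sqrt (2 * pi) * \<sigma>) ^ DIM('a)"
    unfolding fourier_gauss[OF \<sigma>] by (simp add: gauss_hat_def del: of_real_mult of_real_power)
  then have "(\<integral>x. gauss_hat \<tau> (x::'a) \<partial>lborel) = ((sqrt (2 * pi) * \<tau>) * (sqrt (2 * pi) * \<sigma>)) ^ DIM('a)"
    unfolding gauss_hat_eq_gauss \<sigma>_def[symmetric] by (simp add: power_mult_distrib)
  also have "(sqrt (2 * pi) * \<tau>) * (sqrt (2 * pi) * \<sigma>) = (sqrt (2 * pi) * sqrt (2 * pi)) * (\<tau> * \<sigma>)"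
    by (simp only: mult_ac)
  also have "\<dots> = 1" using assms by (simp add: \<sigma>_def)
  finally show ?thesis by simp
qed

text \<open>Regularised inversion: the multiplication formula for a modulated Gaussian, whose
  transform is the kernel translated to \<open>x\<close>.\<close>

lemma fourier_gauss_inversion:
  fixes g :: "'a::euclidean_space \<Rightarrow> complex"
  assumes g: "integrable lborel g" and \<tau>: "\<tau> > 0"
  shows "(\<integral>\<xi>. fourier g \<xi> * (of_real (gauss \<tau> \<xi>) * wave (- (x \<bullet> \<xi>))) \<partial>lborel)
    = (\<integral>y. g y * of_real (gauss_hat \<tau> (y - x)) \<partial>lborel)"
proof -
  let ?v = "\<lambda>\<xi>. of_real (gauss \<tau> \<xi>) * wave (- (x \<bullet> \<xi>))"
  have int: "integrable lborel ?v"
    using integrable_of_real[OF integrable_gauss[OF \<tau>], where 'a=complex]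
    by (rule Bochner_Integration.integrable_bound) (auto simp: norm_mult)
  have "fourier ?v y = of_real (gauss_hat \<tau> (y - x))" for y
  proof -
    have "fourier ?v y = fourier (\<lambda>\<xi>. of_real (gauss \<tau> \<xi>)) (y - x)"
      by (subst (1 2) fourier_lborel)
        (simp_all add: mult.assoc inner_diff_right inner_commute[of x] flip: wave_add)
    then show ?thesis by (simp add: fourier_gauss[OF \<tau>])
  qed
  then show ?thesis using fourier_multiplication[OF g int] by simp
qed

section \<open>Plancherel's inequality and injectivity\<close>

lemma nn_integral_lborel_shift:
  fixes f :: "'a::euclidean_space \<Rightarrow> ennreal"
  assumes [measurable]: "f \<in> borel_measurable borel"
  shows "(\<integral>\<^sup>+x. f (x + t) \<partial>lborel) = (\<integral>\<^sup>+x. f x \<partial>lborel)"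
proof -
  have "(\<integral>\<^sup>+x. f x \<partial>lborel) = (\<integral>\<^sup>+x. f x \<partial>distr lborel borel ((+) t))"
    by (simp add: lborel_distr_plus)
  also have "\<dots> = (\<integral>\<^sup>+x. f (t + x) \<partial>lborel)" by (rule nn_integral_distr) auto
  finally show ?thesis by (simp add: add.commute)
qed

text \<open>Regularised inversion turns the left-hand side into the quadratic form of the kernel
  \<open>gauss_hat \<tau> (y - x)\<close> in \<open>g\<close>; a symmetric nonnegative kernel of
  mass 1 is bounded by 1 on L^2.\<close>

lemma plancherel_gauss:
  fixes g :: "'a::euclidean_space \<Rightarrow> complex"
  assumes g: "integrable lborel g" and \<tau>: "\<tau> > 0"
  shows "(\<integral>\<^sup>+\<xi>. ennreal ((norm (fourier g \<xi>))\<^sup>2 * gauss \<tau> \<xi>) \<partial>lborel) \<le> (\<integral>\<^sup>+x. ennreal ((norm (g x))\<^sup>2) \<partial>lborel)"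
proof -
  have gm[measurable]: "g \<in> borel_measurable borel" using g by auto
  have [measurable]: "fourier g \<in> borel_measurable borel" by (rule borel_measurable_fourier[OF gm])
  have [measurable]: "cnj \<in> borel_measurable borel" by (intro borel_measurable_continuous_onI continuous_intros)
  define A where "A = (\<integral>x. norm (g x) \<partial>lborel)"
  have A: "norm (fourier g \<xi>) \<le> A" for \<xi> unfolding A_def by (rule norm_fourier_le[OF gm])
  let ?K = "gauss_hat \<tau> :: 'a \<Rightarrow> real"
  have K0: "0 \<le> ?K x" for x using \<tau> by (simp add: gauss_hat_nonneg)
  \<comment> \<open>Conjugated so that the product with \<open>fourier g\<close> is a squared
    modulus, and damped so that it is integrable.\<close>
  define v where "v \<xi> = cnj (fourier g \<xi>) * of_real (gauss \<tau> \<xi>)" for \<xi>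
  have vm[measurable]: "v \<in> borel_measurable borel" unfolding v_def by measurable
  have v: "integrable lborel v"
  proof (rule Bochner_Integration.integrable_bound)
    show "integrable lborel (\<lambda>\<xi>::'a. A * gauss \<tau> \<xi>)"
      by (intro integrable_mult_right integrable_gauss \<tau>)
    show "AE \<xi> in lborel. norm (v \<xi>) \<le> norm (A * gauss \<tau> \<xi>)"
      using A gauss_pos less_imp_le[OF gauss_pos]
      by (intro AE_I2) (auto simp: v_def norm_mult abs_mult intro!: mult_right_mono order_trans[OF A])
  qed simp
  have sq: "fourier g \<xi> * v \<xi> = of_real ((norm (fourier g \<xi>))\<^sup>2 * gauss \<tau> \<xi>)" for \<xi>
    unfolding v_def by (simp add: complex_norm_square[symmetric] flip: mult.assoc of_real_power)
  have "integrable lborel (\<lambda>\<xi>. A * norm (v \<xi>))" using v by simp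
  then have int: "integrable lborel (\<lambda>\<xi>. fourier g \<xi> * v \<xi>)"
    by (rule Bochner_Integration.integrable_bound)
      (auto simp: norm_mult intro!: AE_I2 mult_right_mono A order_trans[OF _ abs_ge_self])
  then have "integrable lborel (\<lambda>\<xi>. (norm (fourier g \<xi>))\<^sup>2 * gauss \<tau> \<xi>)"
    unfolding sq by (subst (asm) complex_of_real_integrable_eq)
  then have "(\<integral>\<^sup>+\<xi>. ennreal ((norm (fourier g \<xi>))\<^sup>2 * gauss \<tau> \<xi>) \<partial>lborel)
      = ennreal (\<integral>\<xi>. (norm (fourier g \<xi>))\<^sup>2 * gauss \<tau> \<xi> \<partial>lborel)"
    by (intro nn_integral_eq_integral) (auto intro!: AE_I2 mult_nonneg_nonneg less_imp_le[OF gauss_pos])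
  also have "\<dots> \<le> ennreal (norm (\<integral>\<xi>. fourier g \<xi> * v \<xi> \<partial>lborel))"
    unfolding sq integral_complex_of_real norm_of_real by (intro ennreal_leI abs_ge_self)
  also have "(\<integral>\<xi>. fourier g \<xi> * v \<xi> \<partial>lborel) = (\<integral>x. g x * fourier v x \<partial>lborel)"
    by (rule fourier_multiplication[OF g v])
  \<comment> \<open>A non-integrable function has integral 0 by convention, so the bound holds in
    either case.\<close>
  also have "ennreal (norm (\<integral>x. g x * fourier v x \<partial>lborel)) \<le> (\<integral>\<^sup>+x. ennreal (norm (g x * fourier v x)) \<partial>lborel)"
    by (cases "integrable lborel (\<lambda>x. g x * fourier v x)")
      (auto simp: integral_norm_bound_ennreal not_integrable_integral_eq)
  also have "\<dots> \<le> (\<integral>\<^sup>+x. (\<integral>\<^sup>+y. ennreal (norm (g x) * norm (g y) * ?K (y - x)) \<partial>lborel) \<partial>lborel)"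
  proof (intro nn_integral_mono)
    fix x
    have "cnj (fourier v x) = (\<integral>y. g y * of_real (?K (y - x)) \<partial>lborel)"
    proof -
      have "cnj (fourier v x) = (\<integral>\<xi>. cnj (v \<xi> * wave (\<xi> \<bullet> x)) \<partial>lborel)"
        unfolding fourier_lborel[OF vm] by (rule Bochner_Integration.integral_cnj[symmetric])
      also have "\<dots> = (\<integral>\<xi>. fourier g \<xi> * (of_real (gauss \<tau> \<xi>) * wave (- (x \<bullet> \<xi>))) \<partial>lborel)"
        by (intro Bochner_Integration.integral_cong refl) (simp add: v_def cnj_wave mult.assoc inner_commute)
      finally show ?thesis unfolding fourier_gauss_inversion[OF g \<tau>] .
    qed
    then have "norm (fourier v x) = norm (\<integral>y. g y * of_real (?K (y - x)) \<partial>lborel)"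
      by (metis complex_mod_cnj)
    then have "ennreal (norm (fourier v x)) \<le> (\<integral>\<^sup>+y. ennreal (norm (g y * of_real (?K (y - x)))) \<partial>lborel)"
      by (cases "integrable lborel (\<lambda>y. g y * of_real (?K (y - x)))")
        (auto simp: integral_norm_bound_ennreal not_integrable_integral_eq)
    then have "ennreal (norm (g x)) * ennreal (norm (fourier v x)) \<le>
        ennreal (norm (g x)) * (\<integral>\<^sup>+y. ennreal (norm (g y * of_real (?K (y - x)))) \<partial>lborel)"
      by (rule mult_left_mono) simp
    also have "\<dots> = (\<integral>\<^sup>+y. ennreal (norm (g x)) * ennreal (norm (g y * of_real (?K (y - x)))) \<partial>lborel)"
      by (rule nn_integral_cmult[symmetric]) measurable
    also have "\<dots> = (\<integral>\<^sup>+y. ennreal (norm (g x) * norm (g y) * ?K (y - x)) \<partial>lborel)"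
      using K0 by (simp add: norm_mult mult.assoc flip: ennreal_mult)
    finally show "ennreal (norm (g x * fourier v x)) \<le> (\<integral>\<^sup>+y. ennreal (norm (g x) * norm (g y) * ?K (y - x)) \<partial>lborel)"
      by (simp add: norm_mult ennreal_mult)
  qed
  \<comment> \<open>The inequality of arithmetic and geometric means separates |g(x)| from |g(y)|;
    in each half the kernel is then integrated in the other variable, with value 1.\<close>
  also have "\<dots> \<le> (\<integral>\<^sup>+x. (\<integral>\<^sup>+y. ennreal ((norm (g x))\<^sup>2 / 2) * ennreal (?K (y - x)) + ennreal ((norm (g y))\<^sup>2 / 2) * ennreal (?K (y - x)) \<partial>lborel) \<partial>lborel)"
  proof (intro nn_integral_mono)
    fix x y
    have "norm (g x) * norm (g y) \<le> (norm (g x))\<^sup>2 / 2 + (norm (g y))\<^sup>2 / 2"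
      using sum_squares_bound[of "norm (g x)" "norm (g y)"] by simp
    then have "norm (g x) * norm (g y) * ?K (y - x) \<le> ((norm (g x))\<^sup>2 / 2 + (norm (g y))\<^sup>2 / 2) * ?K (y - x)"
      using K0 by (intro mult_right_mono) auto
    then show "ennreal (norm (g x) * norm (g y) * ?K (y - x)) \<le> ennreal ((norm (g x))\<^sup>2 / 2) * ennreal (?K (y - x)) + ennreal ((norm (g y))\<^sup>2 / 2) * ennreal (?K (y - x))"
      using K0 by (simp add: distrib_right ennreal_leI flip: ennreal_mult ennreal_plus)
  qed
  also have "\<dots> = (\<integral>\<^sup>+x. (\<integral>\<^sup>+y. ennreal ((norm (g x))\<^sup>2 / 2) * ennreal (?K (y - x)) \<partial>lborel) \<partial>lborel)
      + (\<integral>\<^sup>+x. (\<integral>\<^sup>+y. ennreal ((norm (g y))\<^sup>2 / 2) * ennreal (?K (y - x)) \<partial>lborel) \<partial>lborel)"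
    by (subst nn_integral_add[symmetric]) (auto simp: nn_integral_add)
  also have "(\<integral>\<^sup>+x. (\<integral>\<^sup>+y. ennreal ((norm (g y))\<^sup>2 / 2) * ennreal (?K (y - x)) \<partial>lborel) \<partial>lborel)
      = (\<integral>\<^sup>+y. (\<integral>\<^sup>+x. ennreal ((norm (g y))\<^sup>2 / 2) * ennreal (?K (y - x)) \<partial>lborel) \<partial>lborel)"
    by (rule lborel_pair.Fubini') measurable
  also have "\<dots> = (\<integral>\<^sup>+y. (\<integral>\<^sup>+x. ennreal ((norm (g y))\<^sup>2 / 2) * ennreal (?K (x - y)) \<partial>lborel) \<partial>lborel)"
    by (simp add: gauss_hat_def norm_minus_commute)
  also have "(\<integral>\<^sup>+x. (\<integral>\<^sup>+y. ennreal ((norm (g x))\<^sup>2 / 2) * ennreal (?K (y - x)) \<partial>lborel) \<partial>lborel)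
      = (\<integral>\<^sup>+x. ennreal ((norm (g x))\<^sup>2 / 2) \<partial>lborel)"
  proof (intro nn_integral_cong)
    fix x
    have "(\<integral>\<^sup>+y. ennreal (?K (y - x)) \<partial>lborel) = (\<integral>\<^sup>+y. ennreal (?K y) \<partial>lborel)"
      using nn_integral_lborel_shift[of "\<lambda>y. ennreal (?K y)" "- x"] by simp
    also have "\<dots> = ennreal (\<integral>y. ?K y \<partial>lborel)"
      using K0 \<tau> by (intro nn_integral_eq_integral integrable_gauss_hat) auto
    finally have "(\<integral>\<^sup>+y. ennreal (?K (y - x)) \<partial>lborel) = 1" by (simp add: integral_gauss_hat[OF \<tau>])
    then show "(\<integral>\<^sup>+y. ennreal ((norm (g x))\<^sup>2 / 2) * ennreal (?K (y - x)) \<partial>lborel) = ennreal ((norm (g x))\<^sup>2 / 2)"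
      by (subst nn_integral_cmult) auto
  qed
  also have "(\<integral>\<^sup>+x. ennreal ((norm (g x))\<^sup>2 / 2) \<partial>lborel) + (\<integral>\<^sup>+x. ennreal ((norm (g x))\<^sup>2 / 2) \<partial>lborel)
      = (\<integral>\<^sup>+x. ennreal ((norm (g x))\<^sup>2) \<partial>lborel)"
    by (subst nn_integral_add[symmetric]) (auto simp flip: ennreal_plus)
  finally show ?thesis .
qed

lemma gauss_tendsto_1: "(\<lambda>n. gauss (real (Suc n)) x) \<longlonglongrightarrow> 1"
proof -
  have "(\<lambda>n. exp (- ((norm x)\<^sup>2 / 2 * (inverse (real (Suc n)))\<^sup>2))) \<longlonglongrightarrow> exp (- ((norm x)\<^sup>2 / 2 * 0\<^sup>2))"
    by (intro tendsto_intros LIMSEQ_inverse_real_of_nat)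
  then show ?thesis by (simp add: gauss_def power_inverse field_simps)
qed

text \<open>The Gaussian factors increase to 1, so monotone convergence removes them. The right-hand
  side is infinite when \<open>g\<close> is not square integrable.\<close>

lemma plancherel_le:
  fixes g :: "'a::euclidean_space \<Rightarrow> complex"
  assumes g: "integrable lborel g"
  shows "(\<integral>\<^sup>+\<xi>. ennreal ((norm (fourier g \<xi>))\<^sup>2) \<partial>lborel) \<le> (\<integral>\<^sup>+x. ennreal ((norm (g x))\<^sup>2) \<partial>lborel)"
proof -
  have gm[measurable]: "g \<in> borel_measurable borel" using g by auto
  have [measurable]: "fourier g \<in> borel_measurable borel" by (rule borel_measurable_fourier[OF gm])
  let ?u = "\<lambda>n \<xi>. ennreal ((norm (fourier g \<xi>))\<^sup>2 * gauss (real (Suc n)) \<xi>)"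
  have "(\<lambda>n. \<integral>\<^sup>+\<xi>. ?u n \<xi> \<partial>lborel) \<longlonglongrightarrow> (\<integral>\<^sup>+\<xi>. ennreal ((norm (fourier g \<xi>))\<^sup>2) \<partial>lborel)"
  proof (rule nn_integral_LIMSEQ)
    have "gauss (real (Suc n)) \<xi> \<le> gauss (real (Suc m)) \<xi>" if "n \<le> m" for n m and \<xi> :: 'a
    proof -
      have "(norm \<xi>)\<^sup>2 / (2 * (real (Suc m))\<^sup>2) \<le> (norm \<xi>)\<^sup>2 / (2 * (real (Suc n))\<^sup>2)"
        using that by (intro divide_left_mono mult_left_mono power_mono) auto
      then show ?thesis by (simp add: gauss_def)
    qed
    then show "incseq ?u"
      by (intro incseq_def[THEN iffD2] allI impI le_funI ennreal_leI mult_left_mono) auto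
    fix \<xi>
    have "(\<lambda>n. (norm (fourier g \<xi>))\<^sup>2 * gauss (real (Suc n)) \<xi>) \<longlonglongrightarrow> (norm (fourier g \<xi>))\<^sup>2 * 1"
      by (intro tendsto_intros gauss_tendsto_1)
    then show "(\<lambda>n. ?u n \<xi>) \<longlonglongrightarrow> ennreal ((norm (fourier g \<xi>))\<^sup>2)" by (intro tendsto_ennrealI) simp
  qed measurable
  then show ?thesis using plancherel_gauss[OF g] by (intro LIMSEQ_le_const2) auto
qed

text \<open>By regularised inversion all Gaussian means of \<open>f\<close> around \<open>x\<close>
  vanish, and by continuity they converge to \<open>f x\<close>.\<close>

lemma fourier_eq_0_imp_eq_0:
  fixes f :: "'a::euclidean_space \<Rightarrow> complex"
  assumes f: "integrable lborel f" and cont: "continuous_on UNIV f"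
    and bound: "\<And>x. norm (f x) \<le> B" and zero: "\<And>\<xi>. fourier f \<xi> = 0"
  shows "f x = 0"
proof -
  have [measurable]: "f \<in> borel_measurable borel" using f by auto
  let ?K = "gauss_hat 1 :: 'a \<Rightarrow> real"
  have conv0: "(\<integral>z. f (x + (1 / real (Suc n)) *\<^sub>R z) * of_real (?K z) \<partial>lborel) = 0" for n
  proof -
    let ?\<tau> = "real (Suc n)"
    have "0 = (\<integral>y. f y * of_real (gauss_hat ?\<tau> (y - x)) \<partial>lborel)"
      using fourier_gauss_inversion[OF f, of ?\<tau> x] by (simp add: zero)
    \<comment> \<open>The substitution y = x + z / \<tau> fixes the kernel and moves the scale into
      \<open>f\<close>, which prepares dominated convergence.\<close>
    also have "\<dots> = \<bar>1 / ?\<tau>\<bar> ^ DIM('a) *\<^sub>R (\<integral>z. f (x + (1 / ?\<tau>) *\<^sub>R z) * of_real (gauss_hat ?\<tau> (x + (1 / ?\<tau>) *\<^sub>R z - x)) \<partial>lborel)"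
      by (rule lborel_integral_affine) auto
    finally have "0 = (\<integral>z. f (x + (1 / ?\<tau>) *\<^sub>R z) * of_real (gauss_hat ?\<tau> ((1 / ?\<tau>) *\<^sub>R z)) \<partial>lborel)"
      by simp
    also have "gauss_hat ?\<tau> ((1 / ?\<tau>) *\<^sub>R z) = ?\<tau> ^ DIM('a) * ?K z" for z :: 'a
    proof -
      have "?\<tau>\<^sup>2 * (norm ((1 / ?\<tau>) *\<^sub>R z))\<^sup>2 = (norm z)\<^sup>2"
        by (simp add: power_divide)
      then show ?thesis unfolding gauss_hat_def by (simp only: mult.assoc power_mult_distrib power_one mult_1 mult_ac)
    qed
    then have "(\<integral>z. f (x + (1 / ?\<tau>) *\<^sub>R z) * of_real (gauss_hat ?\<tau> ((1 / ?\<tau>) *\<^sub>R z)) \<partial>lborel)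
        = (\<integral>z. of_real (?\<tau> ^ DIM('a)) * (f (x + (1 / ?\<tau>) *\<^sub>R z) * of_real (?K z)) \<partial>lborel)"
      by (intro Bochner_Integration.integral_cong refl) (simp only: of_real_mult mult_ac)
    also have "\<dots> = of_real (?\<tau> ^ DIM('a)) * (\<integral>z. f (x + (1 / ?\<tau>) *\<^sub>R z) * of_real (?K z) \<partial>lborel)"
      by (rule integral_mult_right_zero)
    finally show ?thesis by (auto simp del: of_nat_Suc)
  qed
  have "(\<lambda>n. \<integral>z. f (x + (1 / real (Suc n)) *\<^sub>R z) * of_real (?K z) \<partial>lborel) \<longlonglongrightarrow> (\<integral>z. f x * of_real (?K z) \<partial>lborel)"
  proof (rule integral_dominated_convergence[where w="\<lambda>z. B * ?K z"])
    show "integrable lborel (\<lambda>z. B * ?K z)" by (intro integrable_mult_right integrable_gauss_hat) simp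
    show "AE z in lborel. (\<lambda>n. f (x + (1 / real (Suc n)) *\<^sub>R z) * of_real (?K z)) \<longlonglongrightarrow> f x * of_real (?K z)"
    proof (intro AE_I2 tendsto_mult_right)
      fix z
      have "(\<lambda>n. x + inverse (real (Suc n)) *\<^sub>R z) \<longlonglongrightarrow> x + 0 *\<^sub>R z"
        by (intro tendsto_intros LIMSEQ_inverse_real_of_nat)
      then have "(\<lambda>n. x + (1 / real (Suc n)) *\<^sub>R z) \<longlonglongrightarrow> x" by (simp add: inverse_eq_divide)
      then show "(\<lambda>n. f (x + (1 / real (Suc n)) *\<^sub>R z)) \<longlonglongrightarrow> f x"
        using cont by (intro continuous_on_tendsto_compose[of UNIV f]) auto
    qed
    show "AE z in lborel. norm (f (x + (1 / real (Suc n)) *\<^sub>R z) * of_real (?K z)) \<le> B * ?K z" for n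
      using bound by (intro AE_I2) (simp add: norm_mult mult_right_mono gauss_hat_nonneg)
  qed auto
  then have "(\<integral>z. f x * of_real (?K z) \<partial>lborel) = 0"
    unfolding conv0 using LIMSEQ_unique tendsto_const by blast
  then show ?thesis by (simp add: integral_gauss_hat)
qed

text \<open>Supplies the uniqueness half of the definite description in
  \<open>lp_piece\<close>.\<close>

lemma schwartz_fourier_inject:
  fixes f g :: "'a::euclidean_space \<Rightarrow> complex"
  assumes f: "f \<in> schwartz" and g: "g \<in> schwartz" and eq: "\<And>\<xi>. fourier f \<xi> = fourier g \<xi>"
  shows "f = g"
proof
  fix x
  have h: "(\<lambda>x. f x - g x) \<in> schwartz" by (rule schwartz_diff[OF f g])
  then obtain B where "\<And>x. norm x ^ 0 * norm (f x - g x) \<le> B"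
    using schwartz_rapid_decay unfolding rapid_decay_def by blast
  then have "f x - g x = 0"
    using h eq f g by (intro fourier_eq_0_imp_eq_0[of "\<lambda>x. f x - g x" B])
      (auto intro: schwartz_integrable schwartz_continuous simp: fourier_diff schwartz_integrable)
  then show "f x = g x" by simp
qed

section \<open>Paley's inequality\<close>

lemma nn_integral_lborel_affine:
  fixes f :: "'a::euclidean_space \<Rightarrow> ennreal"
  assumes [measurable]: "f \<in> borel_measurable borel" and c: "c \<noteq> 0"
  shows "(\<integral>\<^sup>+x. f x \<partial>lborel) = ennreal (\<bar>c\<bar> ^ DIM('a)) * (\<integral>\<^sup>+x. f (t + c *\<^sub>R x) \<partial>lborel)"
  by (subst lborel_affine[OF c, of t])
    (simp add: nn_integral_density nn_integral_distr nn_integral_cmult)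

text \<open>Rescaling by R leaves R^d R^(-2d) = R^(-d) times the integral over |x| >= 1, where 1 +
  |x|^2 <= 2 |x|^2 bounds the integrand by 2^d \<open>weight x\<close>.\<close>

lemma nn_integral_radial_tail:
  fixes R :: real
  assumes R: "R > 0"
  shows "(\<integral>\<^sup>+\<xi>. (if R \<le> norm \<xi> then ennreal (1 / norm (\<xi>::'a::euclidean_space) ^ (2 * DIM('a))) else 0) \<partial>lborel)
    \<le> ennreal (2 ^ DIM('a) * (\<integral>x. weight (x::'a) \<partial>lborel) / R ^ DIM('a))"
proof -
  let ?d = "DIM('a)"
  have "(\<integral>\<^sup>+\<xi>. (if R \<le> norm \<xi> then ennreal (1 / norm (\<xi>::'a) ^ (2 * ?d)) else 0) \<partial>lborel)
      = ennreal (\<bar>R\<bar> ^ ?d) * (\<integral>\<^sup>+x. (if R \<le> norm (0 + R *\<^sub>R x) then ennreal (1 / norm (0 + R *\<^sub>R (x::'a)) ^ (2 * ?d)) else 0) \<partial>lborel)"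
    by (rule nn_integral_lborel_affine) (use R in auto)
  also have "\<dots> \<le> ennreal (R ^ ?d) * (\<integral>\<^sup>+x. ennreal (2 ^ ?d / R ^ (2 * ?d) * weight (x::'a)) \<partial>lborel)"
  proof (intro mult_mono nn_integral_mono)
    fix x :: 'a
    show "(if R \<le> norm (0 + R *\<^sub>R x) then ennreal (1 / norm (0 + R *\<^sub>R x) ^ (2 * ?d)) else 0)
        \<le> ennreal (2 ^ ?d / R ^ (2 * ?d) * weight x)"
    proof (cases "R \<le> norm (R *\<^sub>R x)")
      case True
      then have x: "1 \<le> norm x" using R by simp
      then have "1 \<le> (norm x)\<^sup>2" by simp
      then have "(1 + (norm x)\<^sup>2) ^ ?d \<le> (2 * (norm x)\<^sup>2) ^ ?d" by (intro power_mono) auto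
      then have "(1 + (norm x)\<^sup>2) ^ ?d \<le> 2 ^ ?d * norm x ^ (2 * ?d)"
        by (simp add: power_mult_distrib power_mult)
      then have "1 / norm x ^ (2 * ?d) \<le> 2 ^ ?d * weight x"
        using x by (simp add: weight_def divide_simps add_pos_nonneg)
      then have "1 / R ^ (2 * ?d) * (1 / norm x ^ (2 * ?d)) \<le> 1 / R ^ (2 * ?d) * (2 ^ ?d * weight x)"
        using R by (intro mult_left_mono) auto
      then show ?thesis using True R by (simp add: power_mult_distrib ennreal_leI mult_ac)
    qed simp
  qed (use R in auto)
  also have "(\<integral>\<^sup>+x. ennreal (2 ^ ?d / R ^ (2 * ?d) * weight (x::'a)) \<partial>lborel)
      = ennreal (\<integral>x. 2 ^ ?d / R ^ (2 * ?d) * weight (x::'a) \<partial>lborel)"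
    using R integrable_weight by (intro nn_integral_eq_integral) (auto simp: less_imp_le[OF weight_pos])
  also have "(\<integral>x. 2 ^ ?d / R ^ (2 * ?d) * weight (x::'a) \<partial>lborel) = 2 ^ ?d / R ^ (2 * ?d) * (\<integral>x. weight (x::'a) \<partial>lborel)"
    by (rule integral_mult_right_zero)
  also have "ennreal (R ^ ?d) * ennreal (2 ^ ?d / R ^ (2 * ?d) * (\<integral>x. weight (x::'a) \<partial>lborel))
      = ennreal (2 ^ ?d * (\<integral>x. weight (x::'a) \<partial>lborel) / R ^ ?d)"
    using R by (subst ennreal_mult'[symmetric]) (auto simp: mult_2 power_add)
  finally show ?thesis .
qed

text \<open>Together with \<open>nn_integral_powr_ge\<close> this evaluates the t-integrals of the
  layer-cake formula: a > 0 gives convergence at 0, there a < 0 gives convergence at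
  infinity.\<close>

lemma nn_integral_powr_less:
  assumes "a > 0" "u \<ge> 0"
  shows "(\<integral>\<^sup>+t. (if 0 \<le> t \<and> t \<le> u then ennreal (t powr (a - 1)) else 0) \<partial>lborel) = ennreal (u powr a / a)"
proof -
  have "((\<lambda>x. x powr (a - 1)) has_integral (u powr (a - 1 + 1) / (a - 1 + 1))) {0..u}"
    using assms by (intro has_integral_powr_from_0) auto
  then have "(\<integral>\<^sup>+x. ennreal (indicator {0..u} x * x powr (a - 1)) \<partial>lborel) = ennreal (u powr a / a)"
    by (intro nn_integral_has_integral_lebesgue) auto
  then show ?thesis
    by (subst (asm) nn_integral_cong[where v="\<lambda>t. (if 0 \<le> t \<and> t \<le> u then ennreal (t powr (a - 1)) else 0)"])
      (auto simp: indicator_def)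
qed

lemma nn_integral_powr_ge:
  assumes "a < 0" "u > 0"
  shows "(\<integral>\<^sup>+t. (if u \<le> t then ennreal (t powr (a - 1)) else 0) \<partial>lborel) = ennreal (u powr a / (- a))"
proof -
  have "((\<lambda>x. x powr (a - 1)) has_integral - (u powr (a - 1 + 1)) / (a - 1 + 1)) {u..}"
    using assms by (intro has_integral_powr_to_inf) auto
  then have "(\<integral>\<^sup>+x. ennreal (indicator {u..} x * x powr (a - 1)) \<partial>lborel) = ennreal (u powr a / (- a))"
    by (intro nn_integral_has_integral_lebesgue) auto
  then show ?thesis
    by (subst (asm) nn_integral_cong[where v="\<lambda>t. (if u \<le> t then ennreal (t powr (a - 1)) else 0)"])
      (auto simp: indicator_def)
qed

lemma borel_measurable_L2_set[measurable]:
  assumes [measurable]: "\<And>k. k \<in> K \<Longrightarrow> f k \<in> borel_measurable M"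
  shows "(\<lambda>x. L2_set (\<lambda>k. f k x) K) \<in> borel_measurable M"
  unfolding L2_set_def by measurable

text \<open>The properties of the multipliers \<open>lp_mult \<phi>\<close> on which the
  vector-valued inequality rests. \<open>K\<close> is finite, but no constant below depends on
  \<open>K\<close> or \<open>m\<close>.\<close>

locale partition_weights =
  fixes K :: "int set" and m :: "int \<Rightarrow> 'a::euclidean_space \<Rightarrow> real"
  assumes finite_K: "finite K"
    and m_measurable: "\<And>k. m k \<in> borel_measurable borel"
    and m_nonneg: "\<And>k x. 0 \<le> m k x"
    and m_sum_le_1: "\<And>x. (\<Sum>k\<in>K. m k x) \<le> 1"
begin

definition wsum :: "(int \<Rightarrow> 'a \<Rightarrow> complex) \<Rightarrow> 'a \<Rightarrow> real" where
  "wsum g \<xi> = (\<Sum>k\<in>K. m k \<xi> * norm (fourier (g k) \<xi>))"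

definition l2norm :: "(int \<Rightarrow> 'a \<Rightarrow> complex) \<Rightarrow> 'a \<Rightarrow> real" where
  "l2norm g x = L2_set (\<lambda>k. norm (g k x)) K"

lemma wsum_nonneg: "0 \<le> wsum g \<xi>"
  unfolding wsum_def by (intro sum_nonneg mult_nonneg_nonneg m_nonneg) auto

lemma l2norm_nonneg: "0 \<le> l2norm g x"
  by (simp add: l2norm_def)

lemma l2norm_square: "(l2norm g x)\<^sup>2 = (\<Sum>k\<in>K. (norm (g k x))\<^sup>2)"
  by (simp add: l2norm_def L2_set_def sum_nonneg)

lemma wsum_measurable:
  assumes [measurable]: "\<And>k. g k \<in> borel_measurable borel"
  shows "wsum g \<in> borel_measurable borel"
proof -
  have [measurable]: "fourier (g k) \<in> borel_measurable borel" for k by (intro borel_measurable_fourier assms)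
  note m_measurable[measurable]
  show ?thesis unfolding wsum_def by measurable
qed

lemma l2norm_measurable:
  assumes [measurable]: "\<And>k. g k \<in> borel_measurable borel"
  shows "l2norm g \<in> borel_measurable borel"
  unfolding l2norm_def by measurable

lemma l2norm_integrable:
  assumes "\<And>k. integrable lborel (g k)"
  shows "integrable lborel (l2norm g)"
proof (rule Bochner_Integration.integrable_bound)
  show "integrable lborel (\<lambda>x. \<Sum>k\<in>K. norm (g k x))"
    using assms by (intro Bochner_Integration.integrable_sum integrable_norm)
  have "l2norm g \<in> borel_measurable borel" using assms by (intro l2norm_measurable) auto
  then show "l2norm g \<in> borel_measurable lborel" by simp
  show "AE x in lborel. norm (l2norm g x) \<le> norm (\<Sum>k\<in>K. norm (g k x))"
    using L2_set_le_sum[of K] by (intro AE_I2) (simp add: l2norm_nonneg sum_nonneg, simp add: l2norm_def)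
qed

text \<open>Each transform is bounded by the L^1 norm of its component, hence by that of the l2
  norm; \<open>wsum\<close> averages these bounds with total weight at most 1.\<close>

lemma wsum_le_integral:
  assumes "\<And>k. integrable lborel (g k)"
  shows "wsum g \<xi> \<le> (\<integral>x. l2norm g x \<partial>lborel)"
proof -
  let ?A = "\<integral>x. l2norm g x \<partial>lborel"
  have A0: "0 \<le> ?A" by (intro Bochner_Integration.integral_nonneg l2norm_nonneg)
  have "norm (fourier (g k) \<xi>) \<le> ?A" if "k \<in> K" for k
  proof -
    have "norm (fourier (g k) \<xi>) \<le> (\<integral>x. norm (g k x) \<partial>lborel)"
      using assms[of k] by (intro norm_fourier_le) auto
    also have "\<dots> \<le> ?A"
      using assms that finite_K
      by (intro Bochner_Integration.integral_mono integrable_norm l2norm_integrable)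
        (auto simp: l2norm_def intro: member_le_L2_set[of K k "\<lambda>k. norm (g k _)"])
    finally show ?thesis .
  qed
  then have "wsum g \<xi> \<le> (\<Sum>k\<in>K. m k \<xi> * ?A)"
    unfolding wsum_def by (intro sum_mono mult_left_mono m_nonneg)
  also have "\<dots> = (\<Sum>k\<in>K. m k \<xi>) * ?A" by (simp add: sum_distrib_right)
  also have "\<dots> \<le> 1 * ?A" by (intro mult_right_mono m_sum_le_1 A0)
  finally show ?thesis by simp
qed

text \<open>Since each weight is at most 1, the squares of the weights also sum to at most 1.
  Cauchy-Schwarz therefore removes them, and Plancherel applies to each component.\<close>

lemma wsum_square_le:
  assumes g: "\<And>k. integrable lborel (g k)"
  shows "(\<integral>\<^sup>+\<xi>. ennreal ((wsum g \<xi>)\<^sup>2) \<partial>lborel) \<le> (\<integral>\<^sup>+x. ennreal ((l2norm g x)\<^sup>2) \<partial>lborel)"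
proof -
  have gm[measurable]: "g k \<in> borel_measurable borel" for k using g[of k] by auto
  have [measurable]: "fourier (g k) \<in> borel_measurable borel" for k by (intro borel_measurable_fourier gm)
  have "(wsum g \<xi>)\<^sup>2 \<le> (\<Sum>k\<in>K. (norm (fourier (g k) \<xi>))\<^sup>2)" for \<xi>
  proof -
    have m1: "m k \<xi> \<le> 1" if "k \<in> K" for k
      using member_le_sum[OF that _ finite_K, of "\<lambda>k. m k \<xi>"] m_nonneg m_sum_le_1[of \<xi>] by fastforce
    have "(wsum g \<xi>)\<^sup>2 \<le> (\<Sum>k\<in>K. (m k \<xi>)\<^sup>2) * (\<Sum>k\<in>K. (norm (fourier (g k) \<xi>))\<^sup>2)"
      unfolding wsum_def by (rule Cauchy_Schwarz_ineq_sum)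
    also have "\<dots> \<le> (\<Sum>k\<in>K. m k \<xi>) * (\<Sum>k\<in>K. (norm (fourier (g k) \<xi>))\<^sup>2)"
      using m1 m_nonneg by (intro mult_right_mono sum_mono sum_nonneg) (auto simp: power2_eq_square mult_left_le)
    also have "\<dots> \<le> 1 * (\<Sum>k\<in>K. (norm (fourier (g k) \<xi>))\<^sup>2)"
      by (intro mult_right_mono m_sum_le_1 sum_nonneg) auto
    finally show ?thesis by simp
  qed
  then have "(\<integral>\<^sup>+\<xi>. ennreal ((wsum g \<xi>)\<^sup>2) \<partial>lborel) \<le> (\<integral>\<^sup>+\<xi>. (\<Sum>k\<in>K. ennreal ((norm (fourier (g k) \<xi>))\<^sup>2)) \<partial>lborel)"
    by (intro nn_integral_mono) (simp add: sum_ennreal ennreal_leI)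
  also have "\<dots> = (\<Sum>k\<in>K. \<integral>\<^sup>+\<xi>. ennreal ((norm (fourier (g k) \<xi>))\<^sup>2) \<partial>lborel)"
    by (rule nn_integral_sum) measurable
  also have "\<dots> \<le> (\<Sum>k\<in>K. \<integral>\<^sup>+x. ennreal ((norm (g k x))\<^sup>2) \<partial>lborel)"
    by (intro sum_mono plancherel_le g)
  also have "\<dots> = (\<integral>\<^sup>+x. (\<Sum>k\<in>K. ennreal ((norm (g k x))\<^sup>2)) \<partial>lborel)"
    by (rule nn_integral_sum[symmetric]) measurable
  also have "\<dots> = (\<integral>\<^sup>+x. ennreal ((l2norm g x)\<^sup>2) \<partial>lborel)"
    by (simp add: l2norm_square sum_ennreal)
  finally show ?thesis .
qed

text \<open>It involves the dimension only, so the final constant can be fixed before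
  \<open>K\<close>.\<close>

definition tail_const :: real where
  "tail_const = 2 ^ DIM('a) * (\<integral>x. weight (x::'a) \<partial>lborel)"

lemma tail_const_nonneg: "0 \<le> tail_const"
  unfolding tail_const_def by (intro mult_nonneg_nonneg Bochner_Integration.integral_nonneg less_imp_le[OF weight_pos]) auto

text \<open>The exponent matches the square of the factor \<open>norm \<xi> ^ DIM('a)\<close>. At
  the origin the value is 0, by division by zero.\<close>

definition radial :: "'a \<Rightarrow> real" where
  "radial \<xi> = 1 / norm \<xi> ^ (2 * DIM('a))"

lemma radial_nonneg: "0 \<le> radial \<xi>"
  by (simp add: radial_def)

lemma radial_measurable[measurable]: "radial \<in> borel_measurable borel"
  unfolding radial_def by measurable

text \<open>
  Marcinkiewicz interpolation for \<open>g \<mapsto> norm \<xi> ^ DIM('a) * wsum g \<xi>\<close> with respect to the measure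
  with density \<open>radial\<close>, between weak type (1,1) and strong type (2,2): in \<open>distribution_le\<close> the
  functions \<open>g\<close> are cut at height \<open>t\<close>.
\<close>

lemma weak_1_1:
  assumes g: "\<And>k. integrable lborel (g k)" and t: "t > 0"
  shows "(\<integral>\<^sup>+\<xi>. (if t \<le> norm \<xi> ^ DIM('a) * wsum g \<xi> then ennreal (radial \<xi>) else 0) \<partial>lborel)
    \<le> ennreal (tail_const / t) * (\<integral>\<^sup>+x. ennreal (l2norm g x) \<partial>lborel)"
proof -
  define A where "A = (\<integral>x. l2norm g x \<partial>lborel)"
  have A0: "0 \<le> A" unfolding A_def by (intro Bochner_Integration.integral_nonneg l2norm_nonneg)
  have A: "(\<integral>\<^sup>+x. ennreal (l2norm g x) \<partial>lborel) = ennreal A"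
    unfolding A_def using g by (intro nn_integral_eq_integral l2norm_integrable) (auto simp: l2norm_nonneg)
  have bound: "norm \<xi> ^ DIM('a) * wsum g \<xi> \<le> norm \<xi> ^ DIM('a) * A" for \<xi>
    unfolding A_def using g by (intro mult_left_mono wsum_le_integral) auto
  show ?thesis
  proof (cases "A = 0")
    case True
    then have "norm \<xi> ^ DIM('a) * wsum g \<xi> < t" for \<xi> using bound[of \<xi>] t by simp
    then show ?thesis by (simp flip: not_less)
  next
    case False
    with A0 have A1: "A > 0" by simp
    \<comment> \<open>\<open>R\<close> solves R^d A = t: since \<open>wsum g\<close> is at most
      \<open>A\<close>, the level set lies outside the ball of radius \<open>R\<close>. For A = 0,
      treated above, the level set is empty.\<close>
    define R where "R = root DIM('a) (t / A)"
    have R: "R > 0" "R ^ DIM('a) = t / A"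
      using A1 t by (auto simp: R_def)
    have "R \<le> norm \<xi>" if "t \<le> norm \<xi> ^ DIM('a) * wsum g \<xi>" for \<xi>
    proof -
      have "t \<le> norm \<xi> ^ DIM('a) * A" using that bound[of \<xi>] by simp
      then have "R ^ DIM('a) \<le> norm \<xi> ^ DIM('a)" using A1 by (simp add: R field_simps)
      then show ?thesis using R(1) power_mono_iff[of R "norm \<xi>" "DIM('a)"] by simp
    qed
    then have "(\<integral>\<^sup>+\<xi>. (if t \<le> norm \<xi> ^ DIM('a) * wsum g \<xi> then ennreal (radial \<xi>) else 0) \<partial>lborel)
        \<le> (\<integral>\<^sup>+\<xi>. (if R \<le> norm \<xi> then ennreal (1 / norm (\<xi>::'a) ^ (2 * DIM('a))) else 0) \<partial>lborel)"
      by (intro nn_integral_mono) (auto simp: radial_def)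
    also have "\<dots> \<le> ennreal (tail_const / R ^ DIM('a))" unfolding tail_const_def by (rule nn_integral_radial_tail[OF R(1)])
    also have "\<dots> = ennreal (tail_const / t) * ennreal A"
      using A1 tail_const_nonneg t by (simp add: R flip: ennreal_mult)
    finally show ?thesis by (simp add: A)
  qed
qed

text \<open>Chebyshev's inequality: |\<xi>|^(2d) times \<open>radial\<close> is 1 away from the
  origin, so the weight disappears and the unweighted L^2 bound remains.\<close>

lemma strong_2_2:
  assumes g: "\<And>k. integrable lborel (g k)" and t: "t > 0"
  shows "(\<integral>\<^sup>+\<xi>. (if t \<le> norm \<xi> ^ DIM('a) * wsum g \<xi> then ennreal (radial \<xi>) else 0) \<partial>lborel)
    \<le> ennreal (1 / t\<^sup>2) * (\<integral>\<^sup>+x. ennreal ((l2norm g x)\<^sup>2) \<partial>lborel)"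
proof -
  have [measurable]: "wsum g \<in> borel_measurable borel" using g by (intro wsum_measurable) auto
  have "(\<integral>\<^sup>+\<xi>. (if t \<le> norm \<xi> ^ DIM('a) * wsum g \<xi> then ennreal (radial \<xi>) else 0) \<partial>lborel)
      \<le> (\<integral>\<^sup>+\<xi>. ennreal (1 / t\<^sup>2) * ennreal ((wsum g \<xi>)\<^sup>2) \<partial>lborel)"
  proof (intro nn_integral_mono)
    fix \<xi>
    show "(if t \<le> norm \<xi> ^ DIM('a) * wsum g \<xi> then ennreal (radial \<xi>) else 0) \<le> ennreal (1 / t\<^sup>2) * ennreal ((wsum g \<xi>)\<^sup>2)"
    proof (cases "t \<le> norm \<xi> ^ DIM('a) * wsum g \<xi>")
      case True
      then have "\<xi> \<noteq> 0" using t by (auto simp: zero_power)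
      have "t\<^sup>2 \<le> (norm \<xi> ^ DIM('a) * wsum g \<xi>)\<^sup>2" using True t by (intro power_mono) auto
      also have "\<dots> = norm \<xi> ^ (2 * DIM('a)) * (wsum g \<xi>)\<^sup>2" by (simp add: power_mult_distrib power_even_eq)
      finally have "radial \<xi> \<le> 1 / t\<^sup>2 * (wsum g \<xi>)\<^sup>2"
        using t \<open>\<xi> \<noteq> 0\<close> by (simp add: radial_def field_simps)
      then show ?thesis using True t by (simp add: ennreal_leI flip: ennreal_mult)
    qed simp
  qed
  also have "\<dots> = ennreal (1 / t\<^sup>2) * (\<integral>\<^sup>+\<xi>. ennreal ((wsum g \<xi>)\<^sup>2) \<partial>lborel)"
    by (rule nn_integral_cmult) measurable
  also have "\<dots> \<le> ennreal (1 / t\<^sup>2) * (\<integral>\<^sup>+x. ennreal ((l2norm g x)\<^sup>2) \<partial>lborel)"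
    by (intro mult_left_mono wsum_square_le g) auto
  finally show ?thesis .
qed

lemma distribution_le:
  assumes g: "\<And>k. integrable lborel (g k)" and t: "t > 0"
  shows "(\<integral>\<^sup>+\<xi>. (if t \<le> norm \<xi> ^ DIM('a) * wsum g \<xi> then ennreal (radial \<xi>) else 0) \<partial>lborel)
    \<le> ennreal (2 * tail_const / t) * (\<integral>\<^sup>+x. (if t < l2norm g x then ennreal (l2norm g x) else 0) \<partial>lborel)
     + ennreal (4 / t\<^sup>2) * (\<integral>\<^sup>+x. (if l2norm g x \<le> t then ennreal ((l2norm g x)\<^sup>2) else 0) \<partial>lborel)"
proof -
  \<comment> \<open>The whole vector is cut according to its l2 norm, not component by component, so
    the l2 norms of \<open>a\<close> and \<open>b\<close> are exactly the truncations of that of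
    \<open>g\<close>.\<close>
  define a where "a k x = (if t < l2norm g x then g k x else 0)" for k x
  define b where "b k x = (if l2norm g x \<le> t then g k x else 0)" for k x
  have gm[measurable]: "g k \<in> borel_measurable borel" for k using g[of k] by auto
  have [measurable]: "l2norm g \<in> borel_measurable borel" using g by (intro l2norm_measurable) auto
  have [measurable]: "a k \<in> borel_measurable borel" "b k \<in> borel_measurable borel" for k
    unfolding a_def b_def by measurable
  have a: "integrable lborel (a k)" for k
    by (rule Bochner_Integration.integrable_bound[OF g[of k]]) (auto simp: a_def)
  have b: "integrable lborel (b k)" for k
    by (rule Bochner_Integration.integrable_bound[OF g[of k]]) (auto simp: b_def)
  have [measurable]: "wsum h \<in> borel_measurable borel" if "\<And>k. integrable lborel (h k)" for h
    using that by (intro wsum_measurable) auto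
  note [measurable] = this[OF a] this[OF b]
  have Na: "l2norm a x = (if t < l2norm g x then l2norm g x else 0)" for x
    unfolding l2norm_def a_def by (auto simp: l2norm_def[symmetric] L2_set_def)
  have Nb: "l2norm b x = (if l2norm g x \<le> t then l2norm g x else 0)" for x
    unfolding l2norm_def b_def by (auto simp: l2norm_def[symmetric] L2_set_def)
  have "g k = (\<lambda>x. a k x + b k x)" for k by (auto simp: a_def b_def)
  then have "fourier (g k) \<xi> = fourier (a k) \<xi> + fourier (b k) \<xi>" for k \<xi>
    using fourier_add[OF a b, of k k \<xi>] by metis
  then have Sab: "wsum g \<xi> \<le> wsum a \<xi> + wsum b \<xi>" for \<xi>
    unfolding wsum_def sum.distrib[symmetric] distrib_left[symmetric]
    by (intro sum_mono mult_left_mono m_nonneg) (simp add: norm_triangle_ineq)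
  \<comment> \<open>If a sum reaches t, one of its two terms reaches t / 2; this is the source of
    the constants 2 / t and 4 / t^2.\<close>
  have "(\<integral>\<^sup>+\<xi>. (if t \<le> norm \<xi> ^ DIM('a) * wsum g \<xi> then ennreal (radial \<xi>) else 0) \<partial>lborel)
      \<le> (\<integral>\<^sup>+\<xi>. (if t / 2 \<le> norm \<xi> ^ DIM('a) * wsum a \<xi> then ennreal (radial \<xi>) else 0)
        + (if t / 2 \<le> norm \<xi> ^ DIM('a) * wsum b \<xi> then ennreal (radial \<xi>) else 0) \<partial>lborel)"
  proof (intro nn_integral_mono)
    fix \<xi>
    have "norm \<xi> ^ DIM('a) * wsum g \<xi> \<le> norm \<xi> ^ DIM('a) * wsum a \<xi> + norm \<xi> ^ DIM('a) * wsum b \<xi>"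
      unfolding distrib_left[symmetric] by (intro mult_left_mono Sab) auto
    then show "(if t \<le> norm \<xi> ^ DIM('a) * wsum g \<xi> then ennreal (radial \<xi>) else 0)
      \<le> (if t / 2 \<le> norm \<xi> ^ DIM('a) * wsum a \<xi> then ennreal (radial \<xi>) else 0)
        + (if t / 2 \<le> norm \<xi> ^ DIM('a) * wsum b \<xi> then ennreal (radial \<xi>) else 0)" by auto
  qed
  also have "\<dots> = (\<integral>\<^sup>+\<xi>. (if t / 2 \<le> norm \<xi> ^ DIM('a) * wsum a \<xi> then ennreal (radial \<xi>) else 0) \<partial>lborel)
      + (\<integral>\<^sup>+\<xi>. (if t / 2 \<le> norm \<xi> ^ DIM('a) * wsum b \<xi> then ennreal (radial \<xi>) else 0) \<partial>lborel)"
    by (rule nn_integral_add) measurable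
  also have "\<dots> \<le> ennreal (tail_const / (t / 2)) * (\<integral>\<^sup>+x. ennreal (l2norm a x) \<partial>lborel)
      + ennreal (1 / (t / 2)\<^sup>2) * (\<integral>\<^sup>+x. ennreal ((l2norm b x)\<^sup>2) \<partial>lborel)"
    using a b t by (intro add_mono weak_1_1 strong_2_2) auto
  also have "(\<integral>\<^sup>+x. ennreal (l2norm a x) \<partial>lborel) = (\<integral>\<^sup>+x. (if t < l2norm g x then ennreal (l2norm g x) else 0) \<partial>lborel)"
    by (intro nn_integral_cong) (simp add: Na)
  also have "(\<integral>\<^sup>+x. ennreal ((l2norm b x)\<^sup>2) \<partial>lborel) = (\<integral>\<^sup>+x. (if l2norm g x \<le> t then ennreal ((l2norm g x)\<^sup>2) else 0) \<partial>lborel)"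
    by (intro nn_integral_cong) (simp add: Nb)
  finally show ?thesis by (simp add: power_divide mult.commute)
qed

text \<open>Layer-cake formula: \<open>distribution_le\<close> is integrated against q t^(q-1) dt
  and the integrals are exchanged. The part above height t contributes t^(q-2) up to the l2 norm,
  integrable at 0 because q > 1; the part below contributes t^(q-3) from the l2 norm on, integrable
  at infinity because q < 2. These give the two summands of the constant.\<close>

lemma paley_less_2:
  assumes g: "\<And>k. integrable lborel (g k)" and q: "1 < q" "q < 2"
  shows "(\<integral>\<^sup>+\<xi>. ennreal (norm \<xi> powr (real DIM('a) * (q - 2)) * wsum g \<xi> powr q) \<partial>lborel)
    \<le> ennreal (2 * tail_const * q / (q - 1) + 4 * q / (2 - q)) * (\<integral>\<^sup>+x. ennreal (l2norm g x powr q) \<partial>lborel)"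
proof -
  have [measurable]: "wsum g \<in> borel_measurable borel" "l2norm g \<in> borel_measurable borel"
    using g by (intro wsum_measurable l2norm_measurable; auto)+
  let ?U = "\<lambda>\<xi>. norm \<xi> ^ DIM('a) * wsum g \<xi>"
  have "(\<integral>\<^sup>+\<xi>. ennreal (norm \<xi> powr (real DIM('a) * (q - 2)) * wsum g \<xi> powr q) \<partial>lborel)
      = (\<integral>\<^sup>+\<xi>. (\<integral>\<^sup>+t. ennreal q * (if 0 \<le> t \<and> t \<le> ?U \<xi> then ennreal (t powr (q - 1)) * ennreal (radial \<xi>) else 0) \<partial>lborel) \<partial>lborel)"
  proof (intro nn_integral_cong)
    fix \<xi> :: 'a
    have "(\<integral>\<^sup>+t. ennreal q * (if 0 \<le> t \<and> t \<le> ?U \<xi> then ennreal (t powr (q - 1)) * ennreal (radial \<xi>) else 0) \<partial>lborel)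
        = (\<integral>\<^sup>+t. (ennreal q * ennreal (radial \<xi>)) * (if 0 \<le> t \<and> t \<le> ?U \<xi> then ennreal (t powr (q - 1)) else 0) \<partial>lborel)"
      by (intro nn_integral_cong) (simp add: mult_ac)
    also have "\<dots> = (ennreal q * ennreal (radial \<xi>)) * (\<integral>\<^sup>+t. (if 0 \<le> t \<and> t \<le> ?U \<xi> then ennreal (t powr (q - 1)) else 0) \<partial>lborel)"
      by (rule nn_integral_cmult) measurable
    also have "(\<integral>\<^sup>+t. (if 0 \<le> t \<and> t \<le> ?U \<xi> then ennreal (t powr (q - 1)) else 0) \<partial>lborel) = ennreal (?U \<xi> powr q / q)"
      using q by (intro nn_integral_powr_less) (auto simp: wsum_nonneg)
    also have "(ennreal q * ennreal (radial \<xi>)) * \<dots> = ennreal (radial \<xi> * ?U \<xi> powr q)"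
      using q radial_nonneg[of \<xi>] by (simp add: mult_ac flip: ennreal_mult)
    also have "radial \<xi> * ?U \<xi> powr q = norm \<xi> powr (real DIM('a) * (q - 2)) * wsum g \<xi> powr q"
    proof (cases "\<xi> = 0")
      case False
      then have "radial \<xi> = norm \<xi> powr (- (2 * real DIM('a)))"
        by (simp add: radial_def powr_minus powr_realpow[symmetric] divide_inverse)
      moreover have "?U \<xi> powr q = norm \<xi> powr (real DIM('a) * q) * wsum g \<xi> powr q"
        using False wsum_nonneg[of g \<xi>] by (simp add: powr_mult powr_powr flip: powr_realpow)
      ultimately show ?thesis by (simp add: algebra_simps flip: powr_add)
    qed (simp add: radial_def)
    finally show "ennreal (norm \<xi> powr (real DIM('a) * (q - 2)) * wsum g \<xi> powr q)
      = (\<integral>\<^sup>+t. ennreal q * (if 0 \<le> t \<and> t \<le> ?U \<xi> then ennreal (t powr (q - 1)) * ennreal (radial \<xi>) else 0) \<partial>lborel)" by simp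
  qed
  also have "\<dots> = (\<integral>\<^sup>+t. (\<integral>\<^sup>+\<xi>. ennreal q * (if 0 \<le> t \<and> t \<le> ?U \<xi> then ennreal (t powr (q - 1)) * ennreal (radial \<xi>) else 0) \<partial>lborel) \<partial>lborel)"
    by (rule lborel_pair.Fubini') measurable
  also have "\<dots> \<le> (\<integral>\<^sup>+t. (\<integral>\<^sup>+x. ennreal (2 * tail_const * q) * ennreal (l2norm g x) * (if 0 \<le> t \<and> t \<le> l2norm g x then ennreal (t powr (q - 1 - 1)) else 0)
      + ennreal (4 * q) * ennreal ((l2norm g x)\<^sup>2) * (if l2norm g x \<le> t then ennreal (t powr (q - 2 - 1)) else 0) \<partial>lborel) \<partial>lborel)"
  proof (rule nn_integral_mono)
    fix t :: real
    show "(\<integral>\<^sup>+\<xi>. ennreal q * (if 0 \<le> t \<and> t \<le> ?U \<xi> then ennreal (t powr (q - 1)) * ennreal (radial \<xi>) else 0) \<partial>lborel)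
      \<le> (\<integral>\<^sup>+x. ennreal (2 * tail_const * q) * ennreal (l2norm g x) * (if 0 \<le> t \<and> t \<le> l2norm g x then ennreal (t powr (q - 1 - 1)) else 0)
      + ennreal (4 * q) * ennreal ((l2norm g x)\<^sup>2) * (if l2norm g x \<le> t then ennreal (t powr (q - 2 - 1)) else 0) \<partial>lborel)"
    proof (cases "t > 0")
      case False
      then have "(\<integral>\<^sup>+\<xi>. ennreal q * (if 0 \<le> t \<and> t \<le> ?U \<xi> then ennreal (t powr (q - 1)) * ennreal (radial \<xi>) else 0) \<partial>lborel) = (\<integral>\<^sup>+_. 0 \<partial>(lborel :: 'a measure))"
        by (intro nn_integral_cong) (cases "t = 0", auto)
      then show ?thesis by simp
    next
      case True
      have "(\<integral>\<^sup>+\<xi>. ennreal q * (if 0 \<le> t \<and> t \<le> ?U \<xi> then ennreal (t powr (q - 1)) * ennreal (radial \<xi>) else 0) \<partial>lborel)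
          = (\<integral>\<^sup>+\<xi>. (ennreal q * ennreal (t powr (q - 1))) * (if t \<le> ?U \<xi> then ennreal (radial \<xi>) else 0) \<partial>lborel)"
        using True by (intro nn_integral_cong) (simp add: mult_ac)
      also have "\<dots> = (ennreal q * ennreal (t powr (q - 1))) * (\<integral>\<^sup>+\<xi>. (if t \<le> ?U \<xi> then ennreal (radial \<xi>) else 0) \<partial>lborel)"
        by (rule nn_integral_cmult) measurable
      also have "\<dots> \<le> (ennreal q * ennreal (t powr (q - 1))) *
          (ennreal (2 * tail_const / t) * (\<integral>\<^sup>+x. (if t < l2norm g x then ennreal (l2norm g x) else 0) \<partial>lborel)
          + ennreal (4 / t\<^sup>2) * (\<integral>\<^sup>+x. (if l2norm g x \<le> t then ennreal ((l2norm g x)\<^sup>2) else 0) \<partial>lborel))"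
        by (intro mult_left_mono distribution_le g True) auto
      also have "\<dots> = ennreal (2 * tail_const * q * t powr (q - 1 - 1)) * (\<integral>\<^sup>+x. (if t < l2norm g x then ennreal (l2norm g x) else 0) \<partial>lborel)
          + ennreal (4 * q * t powr (q - 2 - 1)) * (\<integral>\<^sup>+x. (if l2norm g x \<le> t then ennreal ((l2norm g x)\<^sup>2) else 0) \<partial>lborel)"
      proof -
        have p1: "t powr (q - 1) / t = t powr (q - 1 - 1)"
          using True powr_diff[of t "q - 1" 1] by simp
        have p2: "t powr (q - 1) / t\<^sup>2 = t powr (q - 2 - 1)"
        proof -
          have "t powr (q - 2 - 1) = t powr ((q - 1) - 2)" by simp
          also have "\<dots> = t powr (q - 1) / t\<^sup>2" using True powr_diff[of t "q - 1" 2] by simp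
          finally show ?thesis by simp
        qed
        have e1: "ennreal q * ennreal (t powr (q - 1)) * ennreal (2 * tail_const / t) = ennreal (2 * tail_const * q * t powr (q - 1 - 1))"
          unfolding p1[symmetric] using q tail_const_nonneg True by (simp add: mult_ac flip: ennreal_mult)
        have e2: "ennreal q * ennreal (t powr (q - 1)) * ennreal (4 / t\<^sup>2) = ennreal (4 * q * t powr (q - 2 - 1))"
          unfolding p2[symmetric] using q True by (simp add: mult_ac flip: ennreal_mult)
        show ?thesis unfolding distrib_left mult.assoc[symmetric] e1 e2 ..
      qed
      also have "\<dots> = (\<integral>\<^sup>+x. ennreal (2 * tail_const * q * t powr (q - 1 - 1)) * (if t < l2norm g x then ennreal (l2norm g x) else 0)
          + ennreal (4 * q * t powr (q - 2 - 1)) * (if l2norm g x \<le> t then ennreal ((l2norm g x)\<^sup>2) else 0) \<partial>lborel)"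
        by (subst nn_integral_add) (auto simp: nn_integral_cmult)
      also have "\<dots> \<le> (\<integral>\<^sup>+x. ennreal (2 * tail_const * q) * ennreal (l2norm g x) * (if 0 \<le> t \<and> t \<le> l2norm g x then ennreal (t powr (q - 1 - 1)) else 0)
      + ennreal (4 * q) * ennreal ((l2norm g x)\<^sup>2) * (if l2norm g x \<le> t then ennreal (t powr (q - 2 - 1)) else 0) \<partial>lborel)"
        using True tail_const_nonneg q
        by (intro nn_integral_mono add_mono) (auto simp: l2norm_nonneg mult_ac simp flip: ennreal_mult)
      finally show ?thesis .
    qed
  qed
  also have "\<dots> = (\<integral>\<^sup>+x. (\<integral>\<^sup>+t. ennreal (2 * tail_const * q) * ennreal (l2norm g x) * (if 0 \<le> t \<and> t \<le> l2norm g x then ennreal (t powr (q - 1 - 1)) else 0)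
      + ennreal (4 * q) * ennreal ((l2norm g x)\<^sup>2) * (if l2norm g x \<le> t then ennreal (t powr (q - 2 - 1)) else 0) \<partial>lborel) \<partial>lborel)"
    by (rule lborel_pair.Fubini') measurable
  also have "\<dots> = (\<integral>\<^sup>+x. ennreal (2 * tail_const * q / (q - 1) + 4 * q / (2 - q)) * ennreal (l2norm g x powr q) \<partial>lborel)"
  proof (intro nn_integral_cong)
    fix x
    let ?n = "l2norm g x"
    have "(\<integral>\<^sup>+t. ennreal (2 * tail_const * q) * ennreal ?n * (if 0 \<le> t \<and> t \<le> ?n then ennreal (t powr (q - 1 - 1)) else 0)
      + ennreal (4 * q) * ennreal (?n\<^sup>2) * (if ?n \<le> t then ennreal (t powr (q - 2 - 1)) else 0) \<partial>lborel)
      = ennreal (2 * tail_const * q) * ennreal ?n * (\<integral>\<^sup>+t. (if 0 \<le> t \<and> t \<le> ?n then ennreal (t powr (q - 1 - 1)) else 0) \<partial>lborel)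
      + ennreal (4 * q) * ennreal (?n\<^sup>2) * (\<integral>\<^sup>+t. (if ?n \<le> t then ennreal (t powr (q - 2 - 1)) else 0) \<partial>lborel)"
      by (subst nn_integral_add) (auto simp: nn_integral_cmult)
    also have "(\<integral>\<^sup>+t. (if 0 \<le> t \<and> t \<le> ?n then ennreal (t powr (q - 1 - 1)) else 0) \<partial>lborel) = ennreal (?n powr (q - 1) / (q - 1))"
      using q by (intro nn_integral_powr_less) (auto simp: l2norm_nonneg)
    also have "ennreal (2 * tail_const * q) * ennreal ?n * ennreal (?n powr (q - 1) / (q - 1)) = ennreal (2 * tail_const * q / (q - 1) * ?n powr q)"
    proof -
      have "?n * ?n powr (q - 1) = ?n powr q" using l2norm_nonneg[of g x] by (simp add: powr_mult_base)
      then show ?thesis using q tail_const_nonneg l2norm_nonneg[of g x] by (simp add: mult_ac flip: ennreal_mult)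
    qed
    also have "ennreal (4 * q) * ennreal (?n\<^sup>2) * (\<integral>\<^sup>+t. (if ?n \<le> t then ennreal (t powr (q - 2 - 1)) else 0) \<partial>lborel)
      = ennreal (4 * q / (2 - q) * ?n powr q)"
    \<comment> \<open>For \<open>?n = 0\<close> the t-integral diverges, but its prefactor is 0, and
      0 times infinity is 0 in \<open>ennreal\<close>.\<close>
    proof (cases "?n = 0")
      case False
      then have n: "?n > 0" using l2norm_nonneg[of g x] by simp
      then have "?n\<^sup>2 * ?n powr (q - 2) = ?n powr q"
        by (simp add: powr_diff)
      then show ?thesis
        using q n by (subst nn_integral_powr_ge) (auto simp: mult_ac simp flip: ennreal_mult)
    qed simp
    also have "ennreal (2 * tail_const * q / (q - 1) * ?n powr q) + ennreal (4 * q / (2 - q) * ?n powr q)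
        = ennreal (2 * tail_const * q / (q - 1) + 4 * q / (2 - q)) * ennreal (?n powr q)"
      using q tail_const_nonneg by (simp add: distrib_right flip: ennreal_mult ennreal_plus)
    finally show "(\<integral>\<^sup>+t. ennreal (2 * tail_const * q) * ennreal ?n * (if 0 \<le> t \<and> t \<le> ?n then ennreal (t powr (q - 1 - 1)) else 0)
      + ennreal (4 * q) * ennreal (?n\<^sup>2) * (if ?n \<le> t then ennreal (t powr (q - 2 - 1)) else 0) \<partial>lborel)
      = ennreal (2 * tail_const * q / (q - 1) + 4 * q / (2 - q)) * ennreal (?n powr q)" .
  qed
  also have "\<dots> = ennreal (2 * tail_const * q / (q - 1) + 4 * q / (2 - q)) * (\<integral>\<^sup>+x. ennreal (l2norm g x powr q) \<partial>lborel)"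
    by (rule nn_integral_cmult) measurable
  finally show ?thesis .
qed

text \<open>Adds the endpoint q = 2, which is Plancherel: there \<open>4 * q / (2 - q)\<close> is 0
  by division by zero, and the summand 1 carries the estimate.\<close>

lemma paley:
  assumes g: "\<And>k. integrable lborel (g k)" and q: "1 < q" "q \<le> 2"
  shows "(\<integral>\<^sup>+\<xi>. ennreal (norm \<xi> powr (real DIM('a) * (q - 2)) * wsum g \<xi> powr q) \<partial>lborel)
    \<le> ennreal (1 + 2 * tail_const * q / (q - 1) + 4 * q / (2 - q)) * (\<integral>\<^sup>+x. ennreal (l2norm g x powr q) \<partial>lborel)"
proof (cases "q = 2")
  case True
  \<comment> \<open>Stated as an inequality because \<open>0 powr 0\<close> is 0 at the
    origin.\<close>
  have "(\<integral>\<^sup>+\<xi>. ennreal (norm \<xi> powr (real DIM('a) * (q - 2)) * wsum g \<xi> powr q) \<partial>lborel)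
      \<le> (\<integral>\<^sup>+\<xi>. ennreal ((wsum g \<xi>)\<^sup>2) \<partial>lborel)"
  proof (intro nn_integral_mono ennreal_leI)
    fix \<xi>
    show "norm \<xi> powr (real DIM('a) * (q - 2)) * wsum g \<xi> powr q \<le> (wsum g \<xi>)\<^sup>2"
      using True wsum_nonneg[of g \<xi>] by (cases "\<xi> = 0") simp_all
  qed
  also have "\<dots> \<le> (\<integral>\<^sup>+x. ennreal ((l2norm g x)\<^sup>2) \<partial>lborel)" by (rule wsum_square_le[OF g])
  also have "\<dots> = ennreal 1 * (\<integral>\<^sup>+x. ennreal (l2norm g x powr q) \<partial>lborel)"
    using True l2norm_nonneg[of g] by simp
  also have "\<dots> \<le> ennreal (1 + 2 * tail_const * q / (q - 1) + 4 * q / (2 - q)) * (\<integral>\<^sup>+x. ennreal (l2norm g x powr q) \<partial>lborel)"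
    using True tail_const_nonneg by (intro mult_right_mono ennreal_leI) auto
  finally show ?thesis .
next
  case False
  then have "(\<integral>\<^sup>+\<xi>. ennreal (norm \<xi> powr (real DIM('a) * (q - 2)) * wsum g \<xi> powr q) \<partial>lborel)
    \<le> ennreal (2 * tail_const * q / (q - 1) + 4 * q / (2 - q)) * (\<integral>\<^sup>+x. ennreal (l2norm g x powr q) \<partial>lborel)"
    using q by (intro paley_less_2 g) auto
  also have "\<dots> \<le> ennreal (1 + 2 * tail_const * q / (q - 1) + 4 * q / (2 - q)) * (\<integral>\<^sup>+x. ennreal (l2norm g x powr q) \<partial>lborel)"
    by (intro mult_right_mono ennreal_leI) auto
  finally show ?thesis .
qed

end

section \<open>Littlewood--Paley pieces\<close>

lemma dilate_schwartz:
  fixes f :: "'a::euclidean_space \<Rightarrow> complex"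
  assumes f: "f \<in> schwartz" and c: "c > 0"
  shows "(\<lambda>x. of_real (c ^ DIM('a)) * f (c *\<^sub>R x)) \<in> schwartz" (is "?g \<in> _")
    and "fourier (\<lambda>x. of_real (c ^ DIM('a)) * f (c *\<^sub>R x)) \<xi> = fourier f (\<xi> /\<^sub>R c)"
  using schwartz_scale[OF schwartz_affine[OF f, of c 0], of "of_real (c ^ DIM('a))"]
    fourier_affine[of f c 0 \<xi>] schwartz_borel_measurable[OF f] c
  by (simp_all add: fourier_scale flip: of_real_power of_real_mult)

lemma powi_minus_Suc:
  "(2::real) powi (- (k + 1)) = 2 powi (- k) / 2" "(2::real) powi (- k - 1) = 2 powi (- k) / 2"
proof -
  show *: "(2::real) powi (- (k + 1)) = 2 powi (- k) / 2"
    unfolding power_int_minus by (simp add: power_int_add field_simps)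
  have "- k - 1 = - (k + 1)" by simp
  with * show "(2::real) powi (- k - 1) = 2 powi (- k) / 2" by metis
qed

text \<open>The L^1-normalised dilates D_j of \<phi> by 2^j give the explicit witness D_(k+1) - D_k
  for the description in \<open>lp_piece\<close>; uniqueness is injectivity of the Fourier
  transform.\<close>

lemma lp_piece_properties:
  fixes \<phi> :: "'a::euclidean_space \<Rightarrow> complex"
  assumes \<phi>: "\<phi> \<in> schwartz"
  shows lp_piece_schwartz: "lp_piece \<phi> k \<in> schwartz"
    and fourier_lp_piece: "fourier (lp_piece \<phi> k) \<xi> = lp_symbol \<phi> ((2 powi (- k)) *\<^sub>R \<xi>)"
proof -
  define D where "D j x = of_real ((2 powi j) ^ DIM('a)) * \<phi> ((2 powi j :: real) *\<^sub>R x)" for j :: int and x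
  have D: "D j \<in> schwartz" "fourier (D j) \<xi> = fourier \<phi> ((2 powi (- j)) *\<^sub>R \<xi>)" for j \<xi>
    using dilate_schwartz[OF \<phi>, of "2 powi j"]
    unfolding D_def by (simp_all add: power_int_minus)
  define \<psi> where "\<psi> x = D (k + 1) x - D k x" for x
  have \<psi>: "\<psi> \<in> schwartz" unfolding \<psi>_def by (intro schwartz_diff D)
  have "fourier \<psi> \<xi> = lp_symbol \<phi> ((2 powi (- k)) *\<^sub>R \<xi>)" for \<xi>
    unfolding \<psi>_def
    by (subst fourier_diff) (auto simp: D schwartz_integrable lp_symbol_def powi_minus_Suc)
  with \<psi> have "\<exists>!\<psi>. \<psi> \<in> schwartz \<and> (\<forall>\<xi>. fourier \<psi> \<xi> = lp_symbol \<phi> ((2 powi (- k)) *\<^sub>R \<xi>))"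
    by (intro ex1I[of _ \<psi>]) (auto intro!: schwartz_fourier_inject)
  from theI'[OF this] show "lp_piece \<phi> k \<in> schwartz"
    "fourier (lp_piece \<phi> k) \<xi> = lp_symbol \<phi> ((2 powi (- k)) *\<^sub>R \<xi>)"
    unfolding lp_piece_def by blast+
qed

text \<open>The real part loses nothing for a generator, by \<open>of_real_lp_mult\<close>, and a
  real multiplier permits order arguments.\<close>

definition lp_mult :: "('a::euclidean_space \<Rightarrow> complex) \<Rightarrow> int \<Rightarrow> 'a \<Rightarrow> real" where
  "lp_mult \<phi> k \<xi> = Re (lp_symbol \<phi> ((2 powi (- k)) *\<^sub>R \<xi>))"

text \<open>The multiplier is the increment \<open>H (k + 1) - H k\<close> of one radial profile at
  dyadic scales. Monotonicity of the profile gives the sign, its values in [0, 1] give the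
  telescoping bound, and its being 1 up to radius 1 and 0 from radius 2 on gives the
  support.\<close>

lemma lp_mult_properties:
  fixes \<phi> :: "'a::euclidean_space \<Rightarrow> complex"
  assumes \<phi>: "lp_generator \<phi>"
  shows of_real_lp_mult: "of_real (lp_mult \<phi> k \<xi>) = lp_symbol \<phi> ((2 powi (- k)) *\<^sub>R \<xi>)"
    and lp_mult_uminus: "lp_mult \<phi> k (- \<xi>) = lp_mult \<phi> k \<xi>"
    and lp_mult_nonneg: "0 \<le> lp_mult \<phi> k \<xi>"
    and lp_mult_support: "lp_mult \<phi> k \<xi> \<noteq> 0 \<Longrightarrow> 2 powi k < norm \<xi> \<and> norm \<xi> < 4 * 2 powi k"
    and lp_mult_sum_le_1: "finite K \<Longrightarrow> (\<Sum>k\<in>K. lp_mult \<phi> k \<xi>) \<le> 1"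
    and lp_mult_borel_measurable: "lp_mult \<phi> k \<in> borel_measurable borel"
proof -
  obtain h :: "real \<Rightarrow> real" where anti: "antimono_on {0..} h"
    and h: "\<And>\<xi>. fourier \<phi> \<xi> = of_real (h (norm \<xi>))"
    using \<phi> unfolding lp_generator_def by blast
  \<comment> \<open>A unit vector, along which the values of \<open>h\<close> at every radius are
    read off from \<open>fourier \<phi>\<close>.\<close>
  obtain b :: 'a where b: "b \<in> Basis" using nonempty_Basis by blast
  have h1: "h r = 1" if "0 \<le> r" "r \<le> 1" for r
  proof -
    have "fourier \<phi> (r *\<^sub>R b) = 1" using \<phi> that b unfolding lp_generator_def by simp
    then show ?thesis using that b by (simp add: h)
  qed
  have h0: "h r = 0" if "2 \<le> r" for r
  proof -
    have "fourier \<phi> (r *\<^sub>R b) = 0" using \<phi> that b unfolding lp_generator_def by simp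
    then show ?thesis using that b by (simp add: h)
  qed
  have h_bounds: "0 \<le> h r" "h r \<le> 1" if "0 \<le> r" for r
    using monotone_onD[OF anti, of r "max r 2"] monotone_onD[OF anti, of 0 r] h0[of "max r 2"] h1[of 0] that
    by auto
  define H where "H j \<xi> = h (2 powi (- j) * norm \<xi>)" for j :: int and \<xi> :: 'a
  have symbol: "lp_symbol \<phi> ((2 powi (- j)) *\<^sub>R \<xi>) = of_real (H (j + 1) \<xi> - H j \<xi>)" for j \<xi>
    by (simp add: lp_symbol_def h H_def powi_minus_Suc abs_mult)
  then have mult: "lp_mult \<phi> j \<xi> = H (j + 1) \<xi> - H j \<xi>" for j \<xi>
    by (simp add: lp_mult_def)
  show "of_real (lp_mult \<phi> k \<xi>) = lp_symbol \<phi> ((2 powi (- k)) *\<^sub>R \<xi>)"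
    by (simp only: symbol mult)
  show "lp_mult \<phi> k (- \<xi>) = lp_mult \<phi> k \<xi>"
    by (simp add: mult H_def)
  have nonneg: "0 \<le> lp_mult \<phi> j \<xi>" for j \<xi>
  proof -
    have "2 powi (- (j + 1)) * norm \<xi> \<le> 2 powi (- j) * norm \<xi>"
      by (intro mult_right_mono power_int_increasing) auto
    then have "H j \<xi> \<le> H (j + 1) \<xi>"
      unfolding H_def by (intro monotone_onD[OF anti]) auto
    then show ?thesis by (simp add: mult)
  qed
  then show "0 \<le> lp_mult \<phi> k \<xi>" .
  show "2 powi k < norm \<xi> \<and> norm \<xi> < 4 * 2 powi k" if nz: "lp_mult \<phi> k \<xi> \<noteq> 0"
  proof (rule ccontr)
    assume "\<not> (2 powi k < norm \<xi> \<and> norm \<xi> < 4 * 2 powi k)"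
    then consider "norm \<xi> \<le> 2 powi k" | "norm \<xi> \<ge> 4 * 2 powi k" by linarith
    then show False
    proof cases
      case 1
      then have "2 powi (- k) * norm \<xi> \<le> 1" by (simp add: power_int_minus field_simps)
      moreover from this have "2 powi (- (k + 1)) * norm \<xi> \<le> 1"
        by (simp add: powi_minus_Suc)
      ultimately show False using nz by (simp add: mult H_def h1)
    next
      case 2
      then have "2 powi (- k) * norm \<xi> \<ge> 4" by (simp add: power_int_minus field_simps)
      moreover from this have "2 powi (- (k + 1)) * norm \<xi> \<ge> 2"
        by (simp add: powi_minus_Suc)
      ultimately show False using nz by (simp add: mult H_def h0)
    qed
  qed
  show "(\<Sum>k\<in>K. lp_mult \<phi> k \<xi>) \<le> 1" if K: "finite K"
  proof -
    have tele: "(\<Sum>k\<in>{a..<a + int n}. lp_mult \<phi> k \<xi>) = H (a + int n) \<xi> - H a \<xi>" for a n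
    proof (induction n)
      case (Suc n)
      have "{a..<a + int (Suc n)} = insert (a + int n) {a..<a + int n}" by auto
      then show ?case using Suc by (simp add: mult algebra_simps)
    qed simp
    obtain c where c: "\<forall>k\<in>K. \<bar>k\<bar> \<le> c"
      using K finite_int_iff_bounded_le[of K] by auto
    \<comment> \<open>By nonnegativity \<open>K\<close> may be enlarged to a block of consecutive
      integers, where the sum telescopes.\<close>
    have "K \<subseteq> {- c..<- c + int (nat (2 * c + 1))}" using c by force
    then have "(\<Sum>k\<in>K. lp_mult \<phi> k \<xi>) \<le> (\<Sum>k\<in>{- c..<- c + int (nat (2 * c + 1))}. lp_mult \<phi> k \<xi>)"
      by (intro sum_mono2) (auto simp: nonneg)
    also have "\<dots> \<le> 1"
      unfolding tele H_def
      using h_bounds[of "2 powi (- (- c + int (nat (2 * c + 1)))) * norm \<xi>"] h_bounds[of "2 powi (- (- c)) * norm \<xi>"]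
      by simp
    finally show ?thesis .
  qed
  have [measurable]: "fourier \<phi> \<in> borel_measurable borel"
    using \<phi> unfolding lp_generator_def by (intro borel_measurable_fourier schwartz_borel_measurable) auto
  show "lp_mult \<phi> k \<in> borel_measurable borel"
    unfolding lp_mult_def lp_symbol_def by measurable
qed

section \<open>Lebesgue functions as tempered distributions\<close>

lemma epowr_ennreal: "0 \<le> x \<Longrightarrow> epowr (ennreal x) a = ennreal (x powr a)"
  by (simp add: epowr_def)

lemma epowr_mono:
  assumes "u \<le> v" "0 \<le> a"
  shows "epowr u a \<le> epowr v a"
proof (cases "v = \<infinity>")
  case False
  then have "u \<noteq> \<infinity>" using assms(1) by (auto simp: top_unique)
  with False assms show ?thesis
    by (auto simp: epowr_def less_top intro!: ennreal_leI powr_mono2 enn2real_mono)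
qed (simp add: epowr_def)

lemma epowr_epowr: "0 < a \<Longrightarrow> 0 < b \<Longrightarrow> epowr (epowr u a) b = epowr u (a * b)"
  by (simp add: epowr_def powr_powr)

lemma epowr_one: "epowr u 1 = u"
  by (cases u) (auto simp: epowr_def)

lemma epowr_cmult: "0 < c \<Longrightarrow> epowr (ennreal c * u) a = ennreal (c powr a) * epowr u a"
  by (cases u) (auto simp: epowr_def enn2real_mult powr_mult ennreal_mult ennreal_mult_top simp flip: ennreal_mult)

text \<open>The power has the monotone inverse \<open>epowr _ (1 / a)\<close>, through which a bound
  on all \<open>epowr (X n) a\<close> passes to the supremum.\<close>

lemma epowr_SUP_le:
  assumes "0 < a"
  shows "epowr (SUP n. X n) a \<le> (SUP n. epowr (X n) a)"
proof -
  let ?Z = "SUP n. epowr (X n) a"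
  have "(SUP n. X n) \<le> epowr ?Z (1 / a)"
  proof (rule SUP_least)
    fix n
    have "X n = epowr (epowr (X n) a) (1 / a)" using assms by (simp add: epowr_epowr epowr_one)
    also have "\<dots> \<le> epowr ?Z (1 / a)" using assms by (intro epowr_mono SUP_upper) auto
    finally show "X n \<le> epowr ?Z (1 / a)" .
  qed
  then have "epowr (SUP n. X n) a \<le> epowr (epowr ?Z (1 / a)) a"
    using assms by (intro epowr_mono) auto
  then show ?thesis using assms by (simp add: epowr_epowr epowr_one)
qed

text \<open>Members of \<open>Lp\<close> are only Lebesgue measurable. A Borel function that agrees
  almost everywhere, built from real and imaginary parts, makes the results over
  \<open>lborel\<close> applicable.\<close>

lemma Lp_representative:
  fixes f :: "'a::euclidean_space \<Rightarrow> complex"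
  assumes f: "f \<in> Lp p" and p: "p > 0"
  obtains f' where "f' \<in> borel_measurable borel" "AE x in lborel. f x = f' x"
    "(\<integral>\<^sup>+x. ennreal (norm (f' x) powr p) \<partial>lborel) < \<infinity>"
    "Lp_norm p (\<lambda>x. ennreal (norm (f x))) = epowr (\<integral>\<^sup>+x. ennreal (norm (f' x) powr p) \<partial>lborel) (1 / p)"
proof -
  have fm: "f \<in> borel_measurable (completion lborel)" using f by (simp add: Lp_def)
  have "(\<lambda>x. Re (f x)) \<in> borel_measurable (completion lborel)" "(\<lambda>x. Im (f x)) \<in> borel_measurable (completion lborel)"
    using fm by (auto simp: borel_measurable_complex_iff)
  then obtain r i where [measurable]: "r \<in> borel_measurable lborel" "i \<in> borel_measurable lborel"
    and ae: "AE x in lborel. Re (f x) = r x" "AE x in lborel. Im (f x) = i x"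
    using completion_ex_borel_measurable_real by blast
  define f' where "f' x = Complex (r x) (i x)" for x
  have m: "f' \<in> borel_measurable borel"
    unfolding f'_def by (subst borel_measurable_complex_iff) (use \<open>r \<in> _\<close> \<open>i \<in> _\<close> in simp)
  have eq: "AE x in lborel. f x = f' x"
    using ae by eventually_elim (simp add: f'_def complex_eq_iff)
  have n: "Lp_norm p (\<lambda>x. ennreal (norm (f x))) = epowr (\<integral>\<^sup>+x. ennreal (norm (f' x) powr p) \<partial>lborel) (1 / p)"
  proof -
    have "(\<integral>\<^sup>+x. epowr (ennreal (norm (f x))) p \<partial>lebesgue) = (\<integral>\<^sup>+x. ennreal (norm (f' x) powr p) \<partial>lborel)"
      unfolding nn_integral_completion
      by (rule nn_integral_cong_AE) (use eq in eventually_elim, simp add: epowr_ennreal)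
    then show ?thesis by (simp add: Lp_norm_def)
  qed
  have "Lp_norm p (\<lambda>x. ennreal (norm (f x))) < \<infinity>" using f by (simp add: Lp_def)
  then have "(\<integral>\<^sup>+x. ennreal (norm (f' x) powr p) \<partial>lborel) < \<infinity>"
    unfolding n by (auto simp: epowr_def less_top split: if_splits)
  from that[OF m eq this n] show thesis .
qed

text \<open>An elementary substitute for Hoelder's inequality: |f| is at most 1 or at most |f|^p,
  and \<open>weight\<close> is at most 1, so |f| \<open>weight\<close> is at most
  \<open>weight\<close> + |f|^p.\<close>

lemma integrable_Lp_mult:
  fixes f v :: "'a::euclidean_space \<Rightarrow> complex"
  assumes [measurable]: "f \<in> borel_measurable borel" and fin: "(\<integral>\<^sup>+x. ennreal (norm (f x) powr p) \<partial>lborel) < \<infinity>"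
    and p: "p \<ge> 1" and [measurable]: "v \<in> borel_measurable borel" and v: "\<And>x. norm (v x) \<le> C * weight x"
  shows "integrable lborel (\<lambda>x. f x * v x)"
proof (rule Bochner_Integration.integrable_bound)
  have C: "0 \<le> C" using v[of 0] weight_pos[of "0::'a"] order_trans[OF norm_ge_zero] by (metis zero_le_mult_iff less_le_not_le)
  have "integrable lborel (\<lambda>x. norm (f x) powr p)"
    using fin by (intro integrableI_nonneg) auto
  then show "integrable lborel (\<lambda>x. C * (weight x + norm (f x) powr p))"
    by (intro integrable_mult_right Bochner_Integration.integrable_add integrable_weight)
  show "AE x in lborel. norm (f x * v x) \<le> norm (C * (weight x + norm (f x) powr p))"
  proof (intro AE_I2)
    fix x :: 'a
    have w1: "weight x \<le> 1" by (simp add: weight_def add_pos_nonneg)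
    have "norm (f x) * weight x \<le> weight x + norm (f x) powr p"
    proof (cases "norm (f x) \<le> 1")
      case True
      then have "norm (f x) * weight x \<le> 1 * weight x"
        by (intro mult_right_mono less_imp_le[OF weight_pos])
      also have "\<dots> \<le> weight x + norm (f x) powr p" by simp
      finally show ?thesis .
    next
      case False
      have "norm (f x) * weight x \<le> norm (f x) powr 1"
        using w1 by (simp add: mult_left_le)
      also have "\<dots> \<le> norm (f x) powr p" using False p by (intro powr_mono) auto
      also have "\<dots> \<le> weight x + norm (f x) powr p" using weight_pos[of x] by simp
      finally show ?thesis .
    qed
    then have "C * (norm (f x) * weight x) \<le> C * (weight x + norm (f x) powr p)"
      using C by (rule mult_left_mono)
    moreover have "norm (f x * v x) \<le> norm (f x) * (C * weight x)"
      unfolding norm_mult by (intro mult_left_mono v) auto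
    ultimately show "norm (f x * v x) \<le> norm (C * (weight x + norm (f x) powr p))"
      by (simp add: mult_ac)
  qed
qed simp

text \<open>The seminorms with derivatives of orders 0 and 2d, which is what
  \<open>fourier_decay\<close> spends on bounding the transform by a multiple of
  \<open>weight\<close>.\<close>

definition control_norm :: "('a::euclidean_space \<Rightarrow> complex) \<Rightarrow> real" where
  "control_norm f = (\<Sum>bs\<in>{bs. set bs \<subseteq> Basis \<and> length bs = 0}.
      schwartz_seminorm 0 bs f + schwartz_seminorm (2 * DIM('a)) bs f)
    + (\<Sum>bs\<in>{bs. set bs \<subseteq> Basis \<and> length bs = 2 * DIM('a)}.
      schwartz_seminorm 0 bs f + schwartz_seminorm (2 * DIM('a)) bs f)"

text \<open>Decay of orders 0 and 2d of the transform, combined through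
  \<open>inverse_weight_le\<close>. That \<open>C\<close> does not depend on \<open>f\<close> is
  what sequential continuity asks for.\<close>

lemma fourier_le_weight:
  "\<exists>C. \<forall>f :: 'a::euclidean_space \<Rightarrow> complex. f \<in> schwartz \<longrightarrow>
    (\<forall>\<xi>. norm (fourier f \<xi>) \<le> C * control_norm f * weight \<xi>)"
proof -
  let ?A = "\<lambda>m (f :: 'a \<Rightarrow> complex). \<Sum>bs\<in>{bs. set bs \<subseteq> Basis \<and> length bs = m}.
      schwartz_seminorm 0 bs f + schwartz_seminorm (2 * DIM('a)) bs f"
  obtain C1 where C1: "C1 \<ge> 0" "\<And>f \<xi>. f \<in> schwartz \<Longrightarrow> norm \<xi> ^ 0 * norm (fourier f \<xi>) \<le> C1 * ?A 0 f"
    using fourier_decay[where 'a='a, of 0] by blast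
  obtain C2 where C2: "C2 \<ge> 0" "\<And>f \<xi>. f \<in> schwartz \<Longrightarrow> norm \<xi> ^ (2 * DIM('a)) * norm (fourier f \<xi>) \<le> C2 * ?A (2 * DIM('a)) f"
    using fourier_decay[where 'a='a, of "2 * DIM('a)"] by blast
  let ?C = "2 ^ DIM('a) * (C1 + C2)"
  have "norm (fourier f \<xi>) \<le> ?C * (?A 0 f + ?A (2 * DIM('a)) f) * weight \<xi>" if f: "f \<in> schwartz" for f :: "'a \<Rightarrow> complex" and \<xi>
  proof -
    have A: "0 \<le> ?A m f" for m
      by (intro sum_nonneg add_nonneg_nonneg schwartz_seminorm_nonneg f) auto
    have "norm (fourier f \<xi>) / weight \<xi> \<le> 2 ^ DIM('a) * (1 + norm \<xi> ^ (2 * DIM('a))) * norm (fourier f \<xi>)"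
      using mult_right_mono[OF inverse_weight_le[of \<xi>], of "norm (fourier f \<xi>)"] by simp
    also have "\<dots> = 2 ^ DIM('a) * (norm \<xi> ^ 0 * norm (fourier f \<xi>) + norm \<xi> ^ (2 * DIM('a)) * norm (fourier f \<xi>))"
      by (simp add: algebra_simps)
    also have "\<dots> \<le> 2 ^ DIM('a) * (C1 * ?A 0 f + C2 * ?A (2 * DIM('a)) f)"
      by (intro mult_left_mono add_mono C1 C2 f) auto
    also have "\<dots> \<le> 2 ^ DIM('a) * ((C1 + C2) * (?A 0 f + ?A (2 * DIM('a)) f))"
    proof (intro mult_left_mono)
      have "C1 * a + C2 * b \<le> (C1 + C2) * (a + b)" if "0 \<le> a" "0 \<le> b" for a b
        using C1(1) C2(1) that by (simp add: algebra_simps)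
      from this[OF A A] show "C1 * ?A 0 f + C2 * ?A (2 * DIM('a)) f \<le> (C1 + C2) * (?A 0 f + ?A (2 * DIM('a)) f)" .
    qed simp
    finally show ?thesis using weight_pos[of \<xi>] by (simp only: pos_divide_le_eq mult.assoc)
  qed
  then show ?thesis unfolding control_norm_def by (intro exI[of _ ?C]) blast
qed

lemma fourier_weight_bound:
  fixes g :: "'a::euclidean_space \<Rightarrow> complex"
  assumes "g \<in> schwartz"
  obtains C where "\<And>\<xi>. norm (fourier g \<xi>) \<le> C * weight \<xi>"
  using fourier_le_weight[where 'a='a] assms by blast

context
  fixes f f' :: "'a::euclidean_space \<Rightarrow> complex" and p :: real
  assumes p: "p \<ge> 1"
    and f'_measurable[measurable]: "f' \<in> borel_measurable borel"
    and eq: "AE x in lborel. f x = f' x"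
    and fin: "(\<integral>\<^sup>+x. ennreal (norm (f' x) powr p) \<partial>lborel) < \<infinity>"
begin

lemma fourier_dist_dist_of:
  assumes g: "g \<in> schwartz"
  shows "fourier_dist (dist_of f) g = (\<integral>\<xi>. f' \<xi> * fourier g \<xi> \<partial>lborel)"
proof -
  have [measurable]: "fourier g \<in> borel_measurable borel"
    using g by (intro borel_measurable_fourier schwartz_borel_measurable)
  have "fourier_dist (dist_of f) g = (\<integral>\<xi>. f \<xi> * fourier g \<xi> \<partial>lebesgue)"
    using g schwartz_fourier[OF g] by (simp add: fourier_dist_def dist_of_def)
  also have "\<dots> = (\<integral>\<xi>. f' \<xi> * fourier g \<xi> \<partial>lebesgue)"
  proof (rule integral_cong_AE)
    show 1: "(\<lambda>\<xi>. f' \<xi> * fourier g \<xi>) \<in> borel_measurable lebesgue"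
      by (intro measurable_completion) simp
    show ae: "AE \<xi> in lebesgue. f \<xi> * fourier g \<xi> = f' \<xi> * fourier g \<xi>"
      using eq by (intro AE_completion) auto
    show "(\<lambda>\<xi>. f \<xi> * fourier g \<xi>) \<in> borel_measurable lebesgue"
      by (rule borel_measurable_AE[OF 1]) (use ae in \<open>eventually_elim, auto\<close>)
  qed
  also have "\<dots> = (\<integral>\<xi>. f' \<xi> * fourier g \<xi> \<partial>lborel)"
    by (rule integral_completion) measurable
  finally show ?thesis .
qed

lemma integrable_mult_fourier:
  assumes g: "g \<in> schwartz"
  shows "integrable lborel (\<lambda>\<xi>. f' \<xi> * fourier g \<xi>)"
proof -
  obtain C where "\<And>\<xi>. norm (fourier g \<xi>) \<le> C * weight \<xi>"
    using fourier_weight_bound[OF g] by blast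
  then show ?thesis
    using g by (intro integrable_Lp_mult[OF f'_measurable fin p]) (auto intro: borel_measurable_fourier schwartz_borel_measurable)
qed

text \<open>For continuity, the value at a difference h = G_n - g is at most C
  \<open>control_norm h\<close> times the integral of |f'| \<open>weight\<close>, and
  \<open>control_norm h\<close> tends to 0 as a finite sum of seminorms.\<close>

lemma tempered_fourier_dist: "fourier_dist (dist_of f) \<in> tempered"
proof -
  let ?T = "fourier_dist (dist_of f)"
  have add: "?T (\<lambda>x. g x + h x) = ?T g + ?T h" if "g \<in> schwartz" "h \<in> schwartz" for g h
    using that integrable_mult_fourier
    by (simp add: fourier_dist_dist_of schwartz_add fourier_add schwartz_integrable distrib_left)
  have scale: "?T (\<lambda>x. c * g x) = c * ?T g" if "g \<in> schwartz" for c g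
    using that by (simp add: fourier_dist_dist_of schwartz_scale fourier_scale mult.left_commute)
  have lim: "(\<lambda>n. ?T (G n)) \<longlonglongrightarrow> ?T g"
    if G: "\<And>n. G n \<in> schwartz" and g: "g \<in> schwartz" and lim: "schwartz_tendsto G g" for G g
  proof -
    obtain C where C: "\<And>h :: 'a \<Rightarrow> complex. \<And>\<xi>. h \<in> schwartz \<Longrightarrow>
        norm (fourier h \<xi>) \<le> C * control_norm h * weight \<xi>"
      using fourier_le_weight[where 'a='a] by blast
    define h where "h n x = G n x - g x" for n x
    have h: "h n \<in> schwartz" for n unfolding h_def by (intro schwartz_diff G g)
    define c where "c n = C * control_norm (h n)" for n
    have "(\<lambda>n. schwartz_seminorm m bs (h n)) \<longlonglongrightarrow> 0" if "set bs \<subseteq> Basis" for m bs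
      using lim that by (simp add: schwartz_tendsto_def h_def[abs_def])
    then have "c \<longlonglongrightarrow> C * ((\<Sum>bs\<in>{bs :: 'a list. set bs \<subseteq> Basis \<and> length bs = 0}. 0 + 0)
        + (\<Sum>bs\<in>{bs :: 'a list. set bs \<subseteq> Basis \<and> length bs = 2 * DIM('a)}. 0 + 0))"
      unfolding c_def control_norm_def by (intro tendsto_intros) auto
    then have c0: "c \<longlonglongrightarrow> 0" by simp
    let ?I = "\<integral>\<xi>. norm (f' \<xi>) * weight \<xi> \<partial>lborel"
    have "integrable lborel (\<lambda>\<xi>. f' \<xi> * of_real (weight \<xi>))"
      by (intro integrable_Lp_mult[OF f'_measurable fin p, where C=1]) (auto simp: less_imp_le[OF weight_pos])
    then have int: "integrable lborel (\<lambda>\<xi>. norm (f' \<xi>) * weight \<xi>)"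
      by (drule_tac integrable_norm) (simp add: norm_mult less_imp_le[OF weight_pos])
    have bound: "norm (?T (G n) - ?T g) \<le> c n * ?I" for n
    proof -
      have "?T (G n) - ?T g = (\<integral>\<xi>. f' \<xi> * fourier (h n) \<xi> \<partial>lborel)"
        using integrable_mult_fourier G g
        by (simp add: fourier_dist_dist_of h_def[abs_def] fourier_diff schwartz_integrable right_diff_distrib)
      also have "norm \<dots> \<le> (\<integral>\<xi>. c n * (norm (f' \<xi>) * weight \<xi>) \<partial>lborel)"
      proof (rule Bochner_Integration.integral_norm_bound_integral)
        fix \<xi>
        have "norm (f' \<xi>) * norm (fourier (h n) \<xi>) \<le> norm (f' \<xi>) * (c n * weight \<xi>)"
          unfolding c_def by (intro mult_left_mono C h) auto
        then show "norm (f' \<xi> * fourier (h n) \<xi>) \<le> c n * (norm (f' \<xi>) * weight \<xi>)"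
          by (simp add: norm_mult mult_ac)
      qed (auto intro: integrable_mult_fourier h int)
      also have "\<dots> = c n * ?I" by (rule integral_mult_right_zero)
      finally show ?thesis .
    qed
    have "(\<lambda>n. c n * ?I) \<longlonglongrightarrow> 0" using tendsto_mult_right[OF c0, of ?I] by simp
    then have "(\<lambda>n. ?T (G n) - ?T g) \<longlonglongrightarrow> 0"
      by (rule Lim_null_comparison[rotated]) (rule always_eventually, rule allI, rule bound)
    then show ?thesis by (simp add: LIM_zero_iff)
  qed
  show ?thesis unfolding tempered_def
  proof (intro CollectI conjI ballI allI impI)
    show "?T \<in> extensional schwartz" by (simp add: fourier_dist_def)
  next
    fix G and g :: "'a \<Rightarrow> complex" assume "(\<forall>n. G n \<in> schwartz) \<and> g \<in> schwartz \<and> schwartz_tendsto G g"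
    then show "(\<lambda>n. ?T (G n)) \<longlonglongrightarrow> ?T g" by (intro lim) simp_all
  qed (rule add scale; assumption)+
qed

text \<open>The reflected translate of \<open>lp_piece \<phi> k\<close> has as transform
  \<open>wave (x \<bullet> \<xi>)\<close> times the multiplier at -\<xi>; evenness of the multiplier
  turns the pairing with \<open>f'\<close> into a Fourier integral.\<close>

lemma conv_dist_lp_piece:
  assumes \<phi>: "lp_generator \<phi>"
  shows "conv_dist (lp_piece \<phi> k) (fourier_dist (dist_of f)) x
    = fourier (\<lambda>\<xi>. f' \<xi> * of_real (lp_mult \<phi> k \<xi>)) x"
proof -
  have s: "\<phi> \<in> schwartz" using \<phi> by (simp add: lp_generator_def)
  let ?\<psi> = "lp_piece \<phi> k"
  have [measurable]: "?\<psi> \<in> borel_measurable borel" by (intro schwartz_borel_measurable lp_piece_schwartz s)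
  note lp_mult_borel_measurable[OF \<phi>, measurable]
  have shift: "(\<lambda>y. ?\<psi> (x - y)) = (\<lambda>y. ?\<psi> ((-1) *\<^sub>R y + x))" by simp
  have "(\<lambda>y. ?\<psi> (x - y)) \<in> schwartz"
    unfolding shift by (intro schwartz_affine lp_piece_schwartz s) auto
  moreover have "fourier (\<lambda>y. ?\<psi> (x - y)) \<xi> = of_real (lp_mult \<phi> k \<xi>) * wave (\<xi> \<bullet> x)" for \<xi>
  proof -
    have "fourier (\<lambda>y. ?\<psi> (x - y)) \<xi> = wave (x \<bullet> \<xi>) * fourier ?\<psi> (- \<xi>)"
      unfolding shift by (subst fourier_affine) auto
    also have "fourier ?\<psi> (- \<xi>) = of_real (lp_mult \<phi> k (- \<xi>))"
      by (simp only: fourier_lp_piece[OF s] of_real_lp_mult[OF \<phi>])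
    finally show ?thesis by (simp add: lp_mult_uminus[OF \<phi>] inner_commute)
  qed
  ultimately have "conv_dist ?\<psi> (fourier_dist (dist_of f)) x = (\<integral>\<xi>. f' \<xi> * (of_real (lp_mult \<phi> k \<xi>) * wave (\<xi> \<bullet> x)) \<partial>lborel)"
    by (simp add: conv_dist_def fourier_dist_dist_of)
  then show ?thesis by (subst fourier_lborel) (simp_all add: mult.assoc)
qed

text \<open>A single multiplier lies in [0, 1] and vanishes outside the ball of radius 4 * 2^k, on
  which \<open>weight\<close> is bounded below. Hence each piece of the transform of
  \<open>f\<close> is a bounded function, also for p > 2.\<close>

lemma integrable_mult_lp_mult:
  assumes \<phi>: "lp_generator \<phi>"
  shows "integrable lborel (\<lambda>\<xi>. f' \<xi> * of_real (lp_mult \<phi> k \<xi>))"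
proof -
  note lp_mult_borel_measurable[OF \<phi>, measurable]
  define R where "R = 4 * (2::real) powi k"
  have "norm (complex_of_real (lp_mult \<phi> k \<xi>)) \<le> (1 + R\<^sup>2) ^ DIM('a) * weight \<xi>" for \<xi>
  proof (cases "lp_mult \<phi> k \<xi> = 0")
    case False
    then have "norm \<xi> \<le> R" using lp_mult_support[OF \<phi> False] by (simp add: R_def)
    then have "(1 + (norm \<xi>)\<^sup>2) ^ DIM('a) \<le> (1 + R\<^sup>2) ^ DIM('a)"
      by (intro power_mono add_left_mono) auto
    then have "1 \<le> (1 + R\<^sup>2) ^ DIM('a) * weight \<xi>"
      by (simp add: weight_def divide_simps add_pos_nonneg)
    moreover have "lp_mult \<phi> k \<xi> \<le> 1" using lp_mult_sum_le_1[OF \<phi>, of "{k}" \<xi>] by simp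
    ultimately show ?thesis using lp_mult_nonneg[OF \<phi>, of k \<xi>] by simp
  qed (simp add: less_imp_le[OF weight_pos])
  then show ?thesis by (intro integrable_Lp_mult[OF f'_measurable fin p]) auto
qed

end

section \<open>The square function estimate\<close>

lemma integrable_on_ball:
  fixes g :: "'a::euclidean_space \<Rightarrow> complex"
  assumes [measurable]: "g \<in> borel_measurable borel"
    and bound: "\<And>x. norm (g x) \<le> B" and supp: "\<And>x. R < norm x \<Longrightarrow> g x = 0"
  shows "integrable lborel g"
proof (rule Bochner_Integration.integrable_bound)
  have "emeasure lborel (cball (0::'a) R) < \<infinity>" by (rule emeasure_lborel_cball_finite)
  then show "integrable lborel (\<lambda>x::'a. indicator (cball 0 R) x * B)"
    by (intro integrable_mult_left integrable_real_indicator) auto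
  show "AE x in lborel. norm (g x) \<le> norm (indicator (cball 0 R) x * B)"
    using bound supp by (intro AE_I2) (auto simp: indicator_def not_le intro: order_trans[OF _ abs_ge_self])
qed simp

text \<open>\<open>C\<close> precedes both \<open>f\<close> and the finite set \<open>K\<close>, so
  that \<open>K\<close> may later exhaust the integers.\<close>

lemma square_function_estimate:
  fixes \<phi> :: "'a::euclidean_space \<Rightarrow> complex"
  assumes \<phi>: "lp_generator \<phi>" and p: "2 \<le> p" and s: "s = real DIM('a) * (2 / p - 1)"
  shows "\<exists>C>0. \<forall>(f :: 'a \<Rightarrow> complex) K. f \<in> borel_measurable borel \<longrightarrow>
    (\<integral>\<^sup>+x. ennreal (norm (f x) powr p) \<partial>lborel) < \<infinity> \<longrightarrow> finite K \<longrightarrow>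
    (\<integral>\<^sup>+x. ennreal (L2_set (\<lambda>k. 2 powr (of_int k * s) * norm (fourier (\<lambda>\<xi>. f \<xi> * of_real (lp_mult \<phi> k \<xi>)) x)) K powr p) \<partial>lborel)
    \<le> ennreal C * (\<integral>\<^sup>+x. ennreal (norm (f x) powr p) \<partial>lborel)"
proof -
  define q where "q = p / (p - 1)"
  have q: "1 < q" "q \<le> 2" "1 / p + 1 / q = 1" "(p - 1) * q = p" "s * q = real DIM('a) * (q - 2)"
    using p by (auto simp: q_def s field_simps)
  have s0: "s \<le> 0" using p by (simp add: s mult_nonneg_nonpos)
  \<comment> \<open>The constant of \<open>paley\<close>; as \<open>tail_const\<close> depends on
    the type alone, it is available before any \<open>K\<close> is fixed.\<close>
  define C1 where "C1 = 1 + 2 * partition_weights.tail_const TYPE('a) * q / (q - 1) + 4 * q / (2 - q)"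
  have pw: "partition_weights K (lp_mult \<phi>)" if "finite K" for K
    using that lp_mult_nonneg[OF \<phi>] lp_mult_sum_le_1[OF \<phi>] lp_mult_borel_measurable[OF \<phi>]
    by unfold_locales auto
  have C1: "C1 > 0"
  proof -
    interpret partition_weights "{}" "lp_mult \<phi>" by (rule pw) simp
    show ?thesis unfolding C1_def using q tail_const_nonneg by (intro add_pos_nonneg) auto
  qed
  \<comment> \<open>The parameter of Young's inequality, chosen so that the Paley term becomes
    exactly J / 2. Absorbing that half explains the factor 2 in \<open>C\<close>.\<close>
  define e where "e = (1 / (2 * (4 powr (- s)) powr q * C1)) powr (1 / q)"
  have e: "e > 0" "e powr q * ((4 powr (- s)) powr q * C1) = 1 / 2"
    using C1 q by (auto simp: e_def powr_powr)
  define C where "C = 2 * (1 / e) powr p"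
  have C: "C > 0" using e by (simp add: C_def)
  have "(\<integral>\<^sup>+x. ennreal (L2_set (\<lambda>k. 2 powr (of_int k * s) * norm (fourier (\<lambda>\<xi>. f \<xi> * of_real (lp_mult \<phi> k \<xi>)) x)) K powr p) \<partial>lborel)
    \<le> ennreal C * (\<integral>\<^sup>+x. ennreal (norm (f x) powr p) \<partial>lborel)"
    if f[measurable]: "f \<in> borel_measurable borel" and fin: "(\<integral>\<^sup>+x. ennreal (norm (f x) powr p) \<partial>lborel) < \<infinity>"
      and K: "finite K" for f :: "'a \<Rightarrow> complex" and K
  proof -
    interpret partition_weights K "lp_mult \<phi>" by (rule pw[OF K])
    note lp_mult_borel_measurable[OF \<phi>, measurable]
    define u where "u k = (2::real) powr (of_int k * s)" for k :: int
    have u: "0 < u k" for k by (simp add: u_def)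
    define F where "F k = fourier (\<lambda>\<xi>. f \<xi> * of_real (lp_mult \<phi> k \<xi>))" for k
    have Fint: "integrable lborel (\<lambda>\<xi>. f \<xi> * of_real (lp_mult \<phi> k \<xi>))" for k
      using p by (intro integrable_mult_lp_mult[where p=p and f=f] f fin \<phi>) auto
    have [measurable]: "F k \<in> borel_measurable borel" for k
      unfolding F_def by (intro borel_measurable_fourier) measurable
    define A where "A k = (\<integral>\<xi>. norm (f \<xi> * of_real (lp_mult \<phi> k \<xi>)) \<partial>lborel)" for k
    have A: "norm (F k x) \<le> A k" for k x unfolding F_def A_def by (rule norm_fourier_le) measurable
    define Q where "Q x = L2_set (\<lambda>k. u k * norm (F k x)) K" for x
    have Q0: "0 \<le> Q x" for x by (simp add: Q_def)
    have [measurable]: "Q \<in> borel_measurable borel" unfolding Q_def by measurable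
    \<comment> \<open>A crude bound depending on \<open>f\<close> and \<open>K\<close>; it serves
      integrability only and does not enter \<open>C\<close>.\<close>
    define QB where "QB = (\<Sum>k\<in>K. u k * A k)"
    have QB: "Q x \<le> QB" for x
    proof -
      have "Q x \<le> (\<Sum>k\<in>K. u k * norm (F k x))"
        unfolding Q_def by (rule L2_set_le_sum) (simp add: less_imp_le[OF u])
      also have "\<dots> \<le> QB" unfolding QB_def by (intro sum_mono mult_left_mono A less_imp_le[OF u])
      finally show ?thesis .
    qed
    have ball: "(\<integral>\<^sup>+x. (if norm x \<le> R then ennreal (Q x powr p) else 0) \<partial>lborel) \<le> ennreal C * (\<integral>\<^sup>+x. ennreal (norm (f x) powr p) \<partial>lborel)"
      for R :: real
    proof -
      define J where "J = (\<integral>x. (if norm x \<le> R then Q x powr p else 0) \<partial>lborel)"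
      \<comment> \<open>The dual vector. On the ball the products u_k F_k g_k sum to Q^p, while its
        l2 norm is Q^(p-1), whose q-th power is again Q^p because (p-1) q = p. If p = 2, the
        convention \<open>0 powr 0 = 0\<close> is harmless where Q = 0, since there F_k = 0 for all
        k in \<open>K\<close>.\<close>
      define g where "g k x = (if norm x \<le> R then of_real (u k * Q x powr (p - 2)) * cnj (F k x) else 0)" for k x
      have [measurable]: "cnj \<in> borel_measurable borel" by (intro borel_measurable_continuous_onI continuous_intros)
      have gm[measurable]: "g k \<in> borel_measurable borel" for k unfolding g_def by measurable
      have g: "integrable lborel (g k)" for k
      proof (rule integrable_on_ball[OF gm, where R=R])
        fix x
        have "Q x powr (p - 2) \<le> QB powr (p - 2)" using p Q0 QB by (intro powr_mono2) auto
        then have "u k * Q x powr (p - 2) * norm (F k x) \<le> u k * QB powr (p - 2) * A k"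
          using A u by (intro mult_mono mult_nonneg_nonneg) (auto simp: less_imp_le)
        moreover have "norm (g k x) \<le> u k * Q x powr (p - 2) * norm (F k x)"
          using u[of k] by (auto simp: g_def norm_mult)
        ultimately show "norm (g k x) \<le> u k * QB powr (p - 2) * A k" by linarith
      qed (auto simp: g_def)
      have pow: "(Q x)\<^sup>2 * Q x powr (p - 2) = Q x powr p" "Q x * Q x powr (p - 2) = Q x powr (p - 1)" for x
        using Q0[of x] p powr_mult_base[of "Q x" "p - 2"] powr_mult_base[of "Q x" "p - 1"]
        by (auto simp: power2_eq_square mult.assoc)
      have Ng: "l2norm g x = (if norm x \<le> R then Q x powr (p - 1) else 0)" for x
      proof (cases "norm x \<le> R")
        case True
        have "l2norm g x = L2_set (\<lambda>k. Q x powr (p - 2) * (u k * norm (F k x))) K"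
          unfolding l2norm_def g_def using True u by (intro L2_set_cong refl) (simp add: norm_mult less_imp_le[OF u])
        also have "\<dots> = Q x powr (p - 2) * Q x"
          unfolding Q_def[of x] by (rule L2_set_right_distrib[symmetric]) simp
        finally show ?thesis using True pow(2)[of x] by (simp add: mult.commute)
      qed (simp add: l2norm_def g_def L2_set_def)
      have Nq: "l2norm g x powr q = (if norm x \<le> R then Q x powr p else 0)" for x
        by (simp add: Ng powr_powr q(4))
      \<comment> \<open>\<open>integrable_on_ball\<close> concerns complex functions; the real
        version is recovered by taking real parts.\<close>
      have Jint: "integrable lborel (\<lambda>x. if norm x \<le> R then complex_of_real (Q x powr p) else 0)"
        using Q0 QB p by (intro integrable_on_ball[where B="QB powr p" and R=R]) (auto intro: powr_mono2)
      have Jreal: "integrable lborel (\<lambda>x. if norm x \<le> R then Q x powr p else 0)"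
      proof -
        have "integrable lborel (\<lambda>x. Re (if norm x \<le> R then complex_of_real (Q x powr p) else 0))"
          using Jint by (rule integrable_Re)
        then show ?thesis by (simp add: if_distrib[of Re] cong: if_cong)
      qed
      have J: "(\<integral>\<^sup>+x. (if norm x \<le> R then ennreal (Q x powr p) else 0) \<partial>lborel) = ennreal J"
      proof -
        have "(\<integral>\<^sup>+x. ennreal (if norm x \<le> R then Q x powr p else 0) \<partial>lborel) = ennreal J"
          unfolding J_def by (rule nn_integral_eq_integral[OF Jreal]) auto
        then show ?thesis by (simp add: if_distrib[of ennreal] cong: if_cong)
      qed
      have J0: "0 \<le> J" unfolding J_def by (rule Bochner_Integration.integral_nonneg) auto
      \<comment> \<open>The adjoint side: moving the Fourier transform from f m_k onto g_k leaves
        \<open>f\<close> integrated against \<open>?G\<close>.\<close>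
      let ?G = "\<lambda>\<xi>. \<Sum>k\<in>K. of_real (u k * lp_mult \<phi> k \<xi>) * fourier (g k) \<xi>"
      have Fg: "integrable lborel (\<lambda>x. F k x * g k x)" for k
      proof (rule Bochner_Integration.integrable_bound)
        show "integrable lborel (\<lambda>x. A k * norm (g k x))" using g by (intro integrable_mult_right integrable_norm)
        show "AE x in lborel. norm (F k x * g k x) \<le> norm (A k * norm (g k x))"
          by (intro AE_I2) (auto simp: norm_mult intro!: mult_right_mono A order_trans[OF _ abs_ge_self])
      qed measurable
      have mult_int: "integrable lborel (\<lambda>\<xi>. f \<xi> * of_real (lp_mult \<phi> k \<xi>) * fourier (g k) \<xi>)" for k
      proof (rule Bochner_Integration.integrable_bound)
        show "integrable lborel (\<lambda>\<xi>. (\<integral>x. norm (g k x) \<partial>lborel) * norm (f \<xi> * of_real (lp_mult \<phi> k \<xi>)))"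
          using Fint by (intro integrable_mult_right integrable_norm)
        have [measurable]: "fourier (g k) \<in> borel_measurable borel" by (intro borel_measurable_fourier gm)
        show "(\<lambda>\<xi>. f \<xi> * of_real (lp_mult \<phi> k \<xi>) * fourier (g k) \<xi>) \<in> borel_measurable lborel" by measurable
        show "AE \<xi> in lborel. norm (f \<xi> * of_real (lp_mult \<phi> k \<xi>) * fourier (g k) \<xi>)
          \<le> norm ((\<integral>x. norm (g k x) \<partial>lborel) * norm (f \<xi> * of_real (lp_mult \<phi> k \<xi>)))"
        proof (intro AE_I2)
          fix \<xi>
          have "norm (f \<xi> * of_real (lp_mult \<phi> k \<xi>) * fourier (g k) \<xi>)
            = norm (fourier (g k) \<xi>) * norm (f \<xi> * of_real (lp_mult \<phi> k \<xi>))"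
            by (simp add: norm_mult mult_ac)
          also have "\<dots> \<le> (\<integral>x. norm (g k x) \<partial>lborel) * norm (f \<xi> * of_real (lp_mult \<phi> k \<xi>))"
            by (intro mult_right_mono norm_fourier_le gm) auto
          also have "\<dots> \<le> norm ((\<integral>x. norm (g k x) \<partial>lborel) * norm (f \<xi> * of_real (lp_mult \<phi> k \<xi>)))"
            by (simp only: real_norm_def abs_ge_self)
          finally show "norm (f \<xi> * of_real (lp_mult \<phi> k \<xi>) * fourier (g k) \<xi>)
            \<le> norm ((\<integral>x. norm (g k x) \<partial>lborel) * norm (f \<xi> * of_real (lp_mult \<phi> k \<xi>)))" .
        qed
      qed
      have "of_real J = (\<integral>x. (if norm x \<le> R then complex_of_real (Q x powr p) else 0) \<partial>lborel)"
        unfolding J_def by (subst integral_complex_of_real[symmetric]) (simp add: if_distrib[of of_real] cong: if_cong)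
      also have "\<dots> = (\<integral>x. (\<Sum>k\<in>K. of_real (u k) * (F k x * g k x)) \<partial>lborel)"
      proof (intro Bochner_Integration.integral_cong refl)
        fix x
        show "(if norm x \<le> R then complex_of_real (Q x powr p) else 0) = (\<Sum>k\<in>K. of_real (u k) * (F k x * g k x))"
        proof (cases "norm x \<le> R")
          case True
          have "(\<Sum>k\<in>K. of_real (u k) * (F k x * g k x)) = (\<Sum>k\<in>K. complex_of_real ((u k * norm (F k x))\<^sup>2 * Q x powr (p - 2)))"
          proof (intro sum.cong refl)
            fix k
            have "of_real (u k) * (F k x * g k x) = of_real (u k * u k * Q x powr (p - 2)) * (F k x * cnj (F k x))"
              using True by (simp add: g_def mult_ac)
            also have "\<dots> = complex_of_real ((u k * norm (F k x))\<^sup>2 * Q x powr (p - 2))"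
              unfolding complex_norm_square[symmetric] of_real_mult[symmetric]
              by (simp only: power2_eq_square mult_ac)
            finally show "of_real (u k) * (F k x * g k x) = complex_of_real ((u k * norm (F k x))\<^sup>2 * Q x powr (p - 2))" .
          qed
          also have "\<dots> = of_real ((\<Sum>k\<in>K. (u k * norm (F k x))\<^sup>2) * Q x powr (p - 2))"
            by (simp add: sum_distrib_right)
          also have "(\<Sum>k\<in>K. (u k * norm (F k x))\<^sup>2) = (Q x)\<^sup>2"
            by (simp add: Q_def L2_set_def sum_nonneg)
          finally show ?thesis using True pow(1) by simp
        qed (simp add: g_def)
      qed
      also have "\<dots> = (\<Sum>k\<in>K. of_real (u k) * (\<integral>x. F k x * g k x \<partial>lborel))"
        by (subst Bochner_Integration.integral_sum) (auto intro!: integrable_mult_right Fg)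
      also have "\<dots> = (\<Sum>k\<in>K. of_real (u k) * (\<integral>\<xi>. f \<xi> * of_real (lp_mult \<phi> k \<xi>) * fourier (g k) \<xi> \<partial>lborel))"
        unfolding F_def by (simp only: fourier_multiplication[OF Fint g])
      also have "\<dots> = (\<integral>\<xi>. (\<Sum>k\<in>K. of_real (u k) * (f \<xi> * of_real (lp_mult \<phi> k \<xi>) * fourier (g k) \<xi>)) \<partial>lborel)"
        by (subst Bochner_Integration.integral_sum) (auto intro!: integrable_mult_right mult_int)
      also have "\<dots> = (\<integral>\<xi>. f \<xi> * ?G \<xi> \<partial>lborel)"
        by (simp add: sum_distrib_left mult_ac)
      finally have Jeq: "of_real J = (\<integral>\<xi>. f \<xi> * ?G \<xi> \<partial>lborel)" .
      have Gle: "norm (?G \<xi>) \<le> 4 powr (- s) * norm \<xi> powr s * wsum g \<xi>" for \<xi>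
      proof -
        have "norm (?G \<xi>) \<le> (\<Sum>k\<in>K. (4 powr (- s) * norm \<xi> powr s) * (lp_mult \<phi> k \<xi> * norm (fourier (g k) \<xi>)))"
        proof (rule sum_norm_le)
          fix k
          have "u k * lp_mult \<phi> k \<xi> \<le> (4 powr (- s) * norm \<xi> powr s) * lp_mult \<phi> k \<xi>"
          proof (cases "lp_mult \<phi> k \<xi> = 0")
            case False
            \<comment> \<open>On the support 2^k > |\<xi>| / 4, and the exponent s <= 0 reverses the
              inequality to 2^(ks) <= (|\<xi>| / 4)^s. This is the origin of the factor
              4^(-s).\<close>
            have n: "0 < norm \<xi>" "norm \<xi> / 4 \<le> 2 powi k"
              using lp_mult_support[OF \<phi> False] zero_less_power_int[of "2::real" k] by linarith+
            have "u k = (2 powi k) powr s"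
              by (simp add: u_def powr_powr flip: powr_real_of_int')
            also have "\<dots> \<le> (norm \<xi> / 4) powr s" using n s0 by (intro powr_mono2') auto
            also have "\<dots> = 4 powr (- s) * norm \<xi> powr s"
              using n(1) powr_divide[of "norm \<xi>" 4 s] powr_minus_divide[of 4 s] by simp
            finally show ?thesis using lp_mult_nonneg[OF \<phi>] by (intro mult_right_mono)
          qed simp
          then have "u k * lp_mult \<phi> k \<xi> * norm (fourier (g k) \<xi>) \<le> (4 powr (- s) * norm \<xi> powr s) * lp_mult \<phi> k \<xi> * norm (fourier (g k) \<xi>)"
            by (rule mult_right_mono) simp
          then show "norm (of_real (u k * lp_mult \<phi> k \<xi>) * fourier (g k) \<xi>) \<le> (4 powr (- s) * norm \<xi> powr s) * (lp_mult \<phi> k \<xi> * norm (fourier (g k) \<xi>))"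
            using u[of k] lp_mult_nonneg[OF \<phi>, of k \<xi>] by (simp add: norm_mult mult.assoc)
        qed
        then show ?thesis by (simp add: wsum_def sum_distrib_left)
      qed
      have [measurable]: "wsum g \<in> borel_measurable borel" by (intro wsum_measurable gm)
      have "ennreal J = ennreal (norm (of_real J :: complex))" using J0 by simp
      also have "\<dots> \<le> (\<integral>\<^sup>+\<xi>. ennreal (norm (f \<xi> * ?G \<xi>)) \<partial>lborel)"
        unfolding Jeq by (cases "integrable lborel (\<lambda>\<xi>. f \<xi> * ?G \<xi>)")
          (auto simp: integral_norm_bound_ennreal not_integrable_integral_eq)
      also have "\<dots> \<le> (\<integral>\<^sup>+\<xi>. ennreal ((1 / e) powr p) * ennreal (norm (f \<xi>) powr p)
          + ennreal (e powr q * (4 powr (- s)) powr q) * ennreal (norm \<xi> powr (real DIM('a) * (q - 2)) * wsum g \<xi> powr q) \<partial>lborel)"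
      proof (intro nn_integral_mono)
        fix \<xi>
        let ?X = "4 powr (- s) * norm \<xi> powr s * wsum g \<xi>"
        have X0: "0 \<le> ?X" by (simp add: wsum_nonneg)
        have "norm (f \<xi> * ?G \<xi>) \<le> norm (f \<xi>) * ?X"
          unfolding norm_mult by (intro mult_left_mono Gle) auto
        also have "\<dots> = (norm (f \<xi>) * (1 / e)) * (e * ?X)" using e by simp
        \<comment> \<open>Young's inequality separates \<open>f\<close> from the dual vector; the
          factors 1/p and 1/q are then estimated by 1.\<close>
        also have "\<dots> \<le> (norm (f \<xi>) * (1 / e)) powr p / p + (e * ?X) powr q / q"
          using p q e X0 by (intro Youngs_inequality) auto
        also have "\<dots> \<le> (norm (f \<xi>) * (1 / e)) powr p / 1 + (e * ?X) powr q / 1"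
          using p q by (intro add_mono divide_left_mono) auto
        also have "\<dots> = (1 / e) powr p * norm (f \<xi>) powr p + e powr q * ((4 powr (- s)) powr q * ((norm \<xi> powr s) powr q * wsum g \<xi> powr q))"
        proof -
          have "(norm (f \<xi>) * (1 / e)) powr p = (1 / e) powr p * norm (f \<xi>) powr p"
            using e by (subst powr_mult) (simp_all only: mult.commute norm_ge_zero zero_le_divide_1_iff less_imp_le)
          moreover have "(e * ?X) powr q = e powr q * ((4 powr (- s)) powr q * ((norm \<xi> powr s) powr q * wsum g \<xi> powr q))"
            using e wsum_nonneg[of g \<xi>] by (simp add: powr_mult mult.assoc)
          ultimately show ?thesis by simp
        qed
        \<comment> \<open>Here the value of s yields the Paley weight, by s q = d (q - 2).\<close>
        also have "(norm \<xi> powr s) powr q = norm \<xi> powr (real DIM('a) * (q - 2))"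
          by (simp only: powr_powr q(5))
        finally show "ennreal (norm (f \<xi> * ?G \<xi>)) \<le> ennreal ((1 / e) powr p) * ennreal (norm (f \<xi>) powr p)
          + ennreal (e powr q * (4 powr (- s)) powr q) * ennreal (norm \<xi> powr (real DIM('a) * (q - 2)) * wsum g \<xi> powr q)"
          by (simp add: ennreal_leI mult.assoc flip: ennreal_mult ennreal_plus)
      qed
      also have "\<dots> = ennreal ((1 / e) powr p) * (\<integral>\<^sup>+\<xi>. ennreal (norm (f \<xi>) powr p) \<partial>lborel)
          + ennreal (e powr q * (4 powr (- s)) powr q) * (\<integral>\<^sup>+\<xi>. ennreal (norm \<xi> powr (real DIM('a) * (q - 2)) * wsum g \<xi> powr q) \<partial>lborel)"
        by (subst nn_integral_add) (auto simp: nn_integral_cmult)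
      also have "\<dots> \<le> ennreal ((1 / e) powr p) * (\<integral>\<^sup>+\<xi>. ennreal (norm (f \<xi>) powr p) \<partial>lborel)
          + ennreal (e powr q * (4 powr (- s)) powr q) * (ennreal C1 * (\<integral>\<^sup>+x. ennreal (l2norm g x powr q) \<partial>lborel))"
        unfolding C1_def using q by (intro add_left_mono mult_left_mono paley g) auto
      also have "(\<integral>\<^sup>+x. ennreal (l2norm g x powr q) \<partial>lborel) = ennreal J"
        unfolding Nq J[symmetric] by (intro nn_integral_cong) simp
      also have "ennreal (e powr q * (4 powr (- s)) powr q) * (ennreal C1 * ennreal J) = ennreal (J / 2)"
      proof -
        have "e powr q * (4 powr (- s)) powr q * (C1 * J) = (e powr q * ((4 powr (- s)) powr q * C1)) * J"
          by (simp add: mult_ac)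
        also have "\<dots> = J / 2" by (simp only: e(2))
        finally show ?thesis using C1 J0 by (simp flip: ennreal_mult)
      qed
      finally have absorb: "ennreal J \<le> ennreal ((1 / e) powr p) * (\<integral>\<^sup>+\<xi>. ennreal (norm (f \<xi>) powr p) \<partial>lborel) + ennreal (J / 2)" .
      obtain I where I: "0 \<le> I" "(\<integral>\<^sup>+\<xi>. ennreal (norm (f \<xi>) powr p) \<partial>lborel) = ennreal I"
        using fin by (cases "\<integral>\<^sup>+\<xi>. ennreal (norm (f \<xi>) powr p) \<partial>lborel") auto
      have "ennreal J \<le> ennreal ((1 / e) powr p) * ennreal I + ennreal (J / 2)"
        using absorb unfolding I(2) .
      also have "\<dots> = ennreal ((1 / e) powr p * I + J / 2)"
        using I(1) J0 by (subst ennreal_plus) (auto simp: ennreal_mult)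
      \<comment> \<open>Back in the reals, where J / 2 may be subtracted; this is what the
        restriction to a ball was for.\<close>
      finally have "J \<le> (1 / e) powr p * I + J / 2"
        using I(1) J0 by (subst (asm) ennreal_le_iff) auto
      then have "J \<le> C * I" by (simp add: C_def)
      then show ?thesis unfolding J I(2) using C I by (simp add: ennreal_leI flip: ennreal_mult)
    qed
    \<comment> \<open>The bound is the same for every radius, and balls of integer radius exhaust
      the space.\<close>
    have "(\<integral>\<^sup>+x. ennreal (Q x powr p) \<partial>lborel) = (\<integral>\<^sup>+x. (SUP n. (if norm x \<le> real n then ennreal (Q x powr p) else 0)) \<partial>lborel)"
    proof (intro nn_integral_cong antisym)
      fix x :: 'a
      obtain n where "norm x \<le> real n" using real_arch_simple by blast
      then show "ennreal (Q x powr p) \<le> (SUP n. (if norm x \<le> real n then ennreal (Q x powr p) else 0))"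
        by (intro SUP_upper2[of n]) auto
      show "(SUP n. (if norm x \<le> real n then ennreal (Q x powr p) else 0)) \<le> ennreal (Q x powr p)"
        by (intro SUP_least) auto
    qed
    also have "\<dots> = (SUP n. \<integral>\<^sup>+x. (if norm x \<le> real n then ennreal (Q x powr p) else 0) \<partial>lborel)"
      by (intro nn_integral_monotone_convergence_SUP) (auto simp: incseq_def le_fun_def)
    also have "\<dots> \<le> ennreal C * (\<integral>\<^sup>+x. ennreal (norm (f x) powr p) \<partial>lborel)"
      by (intro SUP_least ball)
    finally show ?thesis unfolding Q_def u_def F_def .
  qed
  with C show ?thesis by blast
qed

text \<open>Every finite set of integers lies in a symmetric interval. The supremum over all finite
  sets is thus replaced by one along a sequence, to which monotone convergence applies.\<close>

lemma infsum_int_le_SUP: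
  fixes a :: "int \<Rightarrow> ennreal"
  shows "(\<Sum>\<^sub>\<infinity>k. a k) \<le> (SUP n. \<Sum>k\<in>{- int n..int n}. a k)"
proof -
  have "(\<Sum>\<^sub>\<infinity>k. a k) = (SUP F\<in>{F. finite F \<and> F \<subseteq> UNIV}. sum a F)"
    by (rule nonneg_infsum_complete) simp
  also have "\<dots> \<le> (SUP n. \<Sum>k\<in>{- int n..int n}. a k)"
  proof (rule SUP_least)
    fix F :: "int set" assume "F \<in> {F. finite F \<and> F \<subseteq> UNIV}"
    then obtain c where c: "\<forall>k\<in>F. \<bar>k\<bar> \<le> c"
      using finite_int_iff_bounded_le[of F] by auto
    then have "F \<subseteq> {- int (nat c)..int (nat c)}" by force
    then have "sum a F \<le> (\<Sum>k\<in>{- int (nat c)..int (nat c)}. a k)"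
      by (intro sum_mono2) auto
    then show "sum a F \<le> (SUP n. \<Sum>k\<in>{- int n..int n}. a k)"
      by (intro SUP_upper2[of "nat c"]) auto
  qed
  finally show ?thesis .
qed

theorem theorem1p10:
  fixes \<phi> :: "'a::euclidean_space \<Rightarrow> complex" and p s :: real
  assumes "lp_generator \<phi>"
    and "2 \<le> p"
    and "s = real DIM('a) * (2 / p - 1)"
  shows "\<exists>C::real. C > 0 \<and> (\<forall>f \<in> Lp p.
           mod_poly `` {fourier_dist (dist_of f)} \<in> homogeneous_sobolev \<phi> p s \<and>
           sobolev_norm \<phi> p s (fourier_dist (dist_of f))
             \<le> ennreal C * Lp_norm p (\<lambda>x. ennreal (norm (f x))))"
proof -
  note \<phi> = assms(1) and p = assms(2)
  obtain C where C: "C > 0" and est: "\<And>(f :: 'a \<Rightarrow> complex) K. f \<in> borel_measurable borel \<Longrightarrow>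
    (\<integral>\<^sup>+x. ennreal (norm (f x) powr p) \<partial>lborel) < \<infinity> \<Longrightarrow> finite K \<Longrightarrow>
    (\<integral>\<^sup>+x. ennreal (L2_set (\<lambda>k. 2 powr (of_int k * s) * norm (fourier (\<lambda>\<xi>. f \<xi> * of_real (lp_mult \<phi> k \<xi>)) x)) K powr p) \<partial>lborel)
    \<le> ennreal C * (\<integral>\<^sup>+x. ennreal (norm (f x) powr p) \<partial>lborel)"
    using square_function_estimate[OF assms] by blast
  have main: "fourier_dist (dist_of f) \<in> tempered"
    "sobolev_norm \<phi> p s (fourier_dist (dist_of f)) \<le> ennreal (C powr (1 / p)) * Lp_norm p (\<lambda>x. ennreal (norm (f x)))"
    if f: "f \<in> Lp p" for f :: "'a \<Rightarrow> complex"
  proof -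
    have p1: "p \<ge> 1" "p > 0" using p by auto
    obtain f' where f'[measurable]: "f' \<in> borel_measurable borel" and eq: "AE x in lborel. f x = f' x"
      and fin: "(\<integral>\<^sup>+x. ennreal (norm (f' x) powr p) \<partial>lborel) < \<infinity>"
      and norm: "Lp_norm p (\<lambda>x. ennreal (norm (f x))) = epowr (\<integral>\<^sup>+x. ennreal (norm (f' x) powr p) \<partial>lborel) (1 / p)"
      using Lp_representative[OF f p1(2)] by blast
    note lp_mult_borel_measurable[OF \<phi>, measurable]
    let ?T = "fourier_dist (dist_of f)"
    let ?I = "\<integral>\<^sup>+x. ennreal (norm (f' x) powr p) \<partial>lborel"
    show "?T \<in> tempered" by (rule tempered_fourier_dist[OF p1(1) f' eq fin])
    define F where "F k = fourier (\<lambda>\<xi>. f' \<xi> * of_real (lp_mult \<phi> k \<xi>))" for k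
    have [measurable]: "F k \<in> borel_measurable borel" for k
      unfolding F_def by (intro borel_measurable_fourier) measurable
    have conv: "conv_dist (lp_piece \<phi> k) ?T = F k" for k
      unfolding F_def by (intro ext conv_dist_lp_piece[OF p1(1) f' eq fin \<phi>])
    define b where "b k x = 2 powr (of_int k * s) * norm (F k x)" for k :: int and x
    have [measurable]: "b k \<in> borel_measurable borel" for k unfolding b_def by measurable
    \<comment> \<open>Square functions over symmetric ranges of k increase with \<open>n\<close>,
      and the uniform estimate applies to each of them.\<close>
    define Q where "Q n x = L2_set (\<lambda>k. b k x) {- int n..int n}" for n and x :: 'a
    have Q0: "0 \<le> Q n x" for n x by (simp add: Q_def)
    have [measurable]: "Q n \<in> borel_measurable borel" for n unfolding Q_def by measurable
    have "sobolev_norm \<phi> p s ?T = epowr (\<integral>\<^sup>+x. epowr (epowr (\<Sum>\<^sub>\<infinity>k. ennreal ((b k x)\<^sup>2)) (1 / 2)) p \<partial>lborel) (1 / p)"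
      unfolding sobolev_norm_def Lp_norm_def nn_integral_completion conv b_def
      by (simp add: norm_mult)
    also have "\<dots> \<le> epowr (ennreal C * ?I) (1 / p)"
    proof (rule epowr_mono)
      have "(\<integral>\<^sup>+x. epowr (epowr (\<Sum>\<^sub>\<infinity>k. ennreal ((b k x)\<^sup>2)) (1 / 2)) p \<partial>lborel)
          \<le> (\<integral>\<^sup>+x. (SUP n. ennreal (Q n x powr p)) \<partial>lborel)"
      proof (rule nn_integral_mono)
        fix x
        have "epowr (epowr (\<Sum>\<^sub>\<infinity>k. ennreal ((b k x)\<^sup>2)) (1 / 2)) p = epowr (\<Sum>\<^sub>\<infinity>k. ennreal ((b k x)\<^sup>2)) (p / 2)"
          using p1 by (simp add: epowr_epowr)
        also have "\<dots> \<le> epowr (SUP n. \<Sum>k\<in>{- int n..int n}. ennreal ((b k x)\<^sup>2)) (p / 2)"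
          using p1 by (intro epowr_mono infsum_int_le_SUP) auto
        also have "\<dots> \<le> (SUP n. epowr (\<Sum>k\<in>{- int n..int n}. ennreal ((b k x)\<^sup>2)) (p / 2))"
          using p1 by (intro epowr_SUP_le) auto
        also have "\<dots> = (SUP n. ennreal (Q n x powr p))"
        proof (rule SUP_cong[OF refl])
          fix n
          have "(\<Sum>k\<in>{- int n..int n}. ennreal ((b k x)\<^sup>2)) = ennreal ((Q n x)\<^sup>2)"
            by (simp add: Q_def L2_set_def sum_nonneg sum_ennreal)
          moreover have "((Q n x)\<^sup>2) powr (p / 2) = (Q n x powr 2) powr (p / 2)" using Q0[of n x] by simp
          moreover have "\<dots> = Q n x powr p" by (simp only: powr_powr) simp
          ultimately show "epowr (\<Sum>k\<in>{- int n..int n}. ennreal ((b k x)\<^sup>2)) (p / 2) = ennreal (Q n x powr p)"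
            by (simp add: epowr_ennreal)
        qed
        finally show "epowr (epowr (\<Sum>\<^sub>\<infinity>k. ennreal ((b k x)\<^sup>2)) (1 / 2)) p \<le> (SUP n. ennreal (Q n x powr p))" .
      qed
      also have "\<dots> = (SUP n. \<integral>\<^sup>+x. ennreal (Q n x powr p) \<partial>lborel)"
      proof (rule nn_integral_monotone_convergence_SUP)
        have "Q n x \<le> Q m x" if "n \<le> m" for n m x
          unfolding Q_def L2_set_def using that by (intro real_sqrt_le_mono sum_mono2) auto
        then show "incseq (\<lambda>n x. ennreal (Q n x powr p))"
          using p1 by (auto simp: incseq_def le_fun_def Q0 intro!: ennreal_leI powr_mono2)
      qed measurable
      also have "\<dots> \<le> ennreal C * ?I"
        unfolding Q_def b_def F_def by (intro SUP_least est f' fin) simp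
      finally show "(\<integral>\<^sup>+x. epowr (epowr (\<Sum>\<^sub>\<infinity>k. ennreal ((b k x)\<^sup>2)) (1 / 2)) p \<partial>lborel) \<le> ennreal C * ?I" .
    qed (use p1 in simp)
    also have "\<dots> = ennreal (C powr (1 / p)) * epowr ?I (1 / p)" by (rule epowr_cmult[OF C])
    finally show "sobolev_norm \<phi> p s ?T \<le> ennreal (C powr (1 / p)) * Lp_norm p (\<lambda>x. ennreal (norm (f x)))"
      unfolding norm .
  qed
  show ?thesis
  \<comment> \<open>The estimate obtained for \<open>C\<close> concerns p-th powers of norms, hence
    the p-th root.\<close>
  proof (intro exI[of _ "C powr (1 / p)"] conjI ballI)
    show "C powr (1 / p) > 0" using C by simp
    fix f :: "'a \<Rightarrow> complex" assume f: "f \<in> Lp p"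
    show le: "sobolev_norm \<phi> p s (fourier_dist (dist_of f)) \<le> ennreal (C powr (1 / p)) * Lp_norm p (\<lambda>x. ennreal (norm (f x)))"
      by (rule main(2)[OF f])
    also have "\<dots> < \<infinity>" using f by (simp add: Lp_def ennreal_mult_less_top)
    \<comment> \<open>The transform itself is the representative of finite norm in its
      class.\<close>
    finally show "mod_poly `` {fourier_dist (dist_of f)} \<in> homogeneous_sobolev \<phi> p s"
      unfolding homogeneous_sobolev_def using main(1)[OF f] by blast
  qed
qed

end
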